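(* Let $1<p,q<\infty$ and define $\frac1r:=\frac1q-\frac1p$ and $\frac\alpha d:=\frac1p-\frac1q$. Let $\mu,\lambda,\nu$ be weights on $\mathbb{R}^d$ with $\nu^{\frac1p+\frac1{q'}}=\mu^{\frac1p}\lambda^{-\frac1q}$ and, with $\mu':=\mu^{-p'/p}$, $(\mu',\lambda,\nu)\in B_{p',q}$. Let $\mathcal D$ be a dyadic lattice. There is a constant $C>0$, depending only on $p,q,d$, such that for any $b\in L^1_{\mathrm{loc}}(\mathbb{R}^d)$ $$\|\Pi_b\|_{L^p(\mu)\to L^q(\lambda)}\le C\,[\mu',\lambda,\nu]_{B_{p',q}}[\mu']_{A_\infty}^{1/p}[\lambda]_{A_\infty}^{1/q'}\cdot\begin{cases}\|b\|_{\mathrm{BMO}^\alpha_\nu}&\text{if }p\le q,\\ [\nu]_{A_\infty}^{1/r}\,\|M^{\#}_\nu b\|_{L^r(\nu)}&\text{if }p>q,\end{cases}$$ where the sum $$\Pi_bf:=\sum_{Q\in\mathcal D}D_Qb\,\langle f\rangle_Q,\qquad f\in L^p(\mu),$$ converges unconditionally in $L^q(\lambda)$ if $b\in\mathrm{BMO}^\alpha_\nu$ in the case $p\le q$, and if $M^{\#}_\nu b\in L^r(\nu)$ in the case $p>q$.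
   Context: A dyadic lattice $\mathcal D=\bigcup_{k\in\mathbb Z}\mathcal D_k$ on $\mathbb{R}^d$: $\mathcal D_k$ is a partition of $\mathbb{R}^d$ into (axis-parallel) cubes of side length $2^{-k}$ and $\mathcal D_{k+1}$ refines $\mathcal D_k$. For $Q\in\mathcal D$, $\widehat Q$ is the smallest $R\in\mathcal D$ with $Q\subsetneq R$. All suprema over cubes below are over $Q\in\mathcal D$. $\langle f\rangle_Q:=\frac1{|Q|}\int_Qf\,dx$; $p'$ is the conjugate exponent. A weight is a locally integrable $w:\mathbb{R}^d\to(0,\infty)$; $w(E):=\int_Ew\,dx$; $\|f\|_{L^p(w)}:=(\int|f|^pw\,dx)^{1/p}$. $[w]_{A_\infty}:=\sup_{Q}\frac1{w(Q)}\int_Q\sup_{R\in\mathcal D,\,x\in R\subseteq Q}\frac{w(R)}{|R|}\,dx$. Moreover $$[\mu',\lambda,\nu]_{B_{p',q}}:=\sup_Q\langle\mu'\rangle_Q^{1/p'}\langle\lambda\rangle_Q^{1/q}\langle\nu\rangle_Q^{1/p+1/q'},$$ and $(\mu',\lambda,\nu)\in B_{p',q}$ means this is finite. $\|b\|_{\mathrm{BMO}^\alpha_\nu}:=\sup_Q\frac1{\nu(Q)^{1+\alpha/d}}\int_Q|b-\langle b\rangle_Q|\,dx$ (with $b\in\mathrm{BMO}^\alpha_\nu$ meaning this is finite) and $M^{\#}_\nu b:=\sup_Q\frac{\mathbf 1_Q}{\nu(Q)}\int_Q|b-\langle b\rangle_Q|\,dx$. $D_Qb:=\sum_{R\in\mathcal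 D:\widehat R=Q}\langle b\rangle_R\mathbf 1_R-\langle b\rangle_Q\mathbf 1_Q$. The norm bound is understood as: if the right-hand side is finite, then $\Pi_b$, defined by the unconditionally convergent sum, satisfies $\|\Pi_bf\|_{L^q(\lambda)}\le(\text{right-hand side})\|f\|_{L^p(\mu)}$ for all $f\in L^p(\mu)$. *)

theory Defs
  imports "HOL-Analysis.Analysis"
begin

text \<open>Functions are Lebesgue measurable, and integration is with respect to \<^const>\<open>lebesgue\<close>.
  Quantities built from nonnegative functions (masses of weights, characteristics, norms) may be
  infinite and take values in \<^typ>\<open>ennreal\<close>. The functions \<open>b\<close> and \<open>f\<close> are complex valued, which
  includes the real valued case.\<close>

section \<open>Dyadic lattices\<close>

text \<open>A cube is a product of intervals of equal length, each of which may contain or omit either of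
  its endpoints.\<close>

definition is_cube :: "real \<Rightarrow> (real^'n) set \<Rightarrow> bool" where
  "is_cube l Q \<longleftrightarrow> (\<exists>a I. (\<forall>i. {a $ i <..< a $ i + l} \<subseteq> I i \<and> I i \<subseteq> {a $ i .. a $ i + l}) \<and>
     Q = {x. \<forall>i. x $ i \<in> I i})"

definition dyadic_lattice :: "(int \<Rightarrow> (real^'n) set set) \<Rightarrow> bool" where
  "dyadic_lattice D \<longleftrightarrow>
     (\<forall>k. partition_on UNIV (D k)) \<and>
     (\<forall>k. \<forall>Q\<in>D k. is_cube (2 powi (- k)) Q) \<and>
     (\<forall>k. refines UNIV (D (k + 1)) (D k))"

abbreviation cubes :: "(int \<Rightarrow> (real^'n) set set) \<Rightarrow> (real^'n) set set" where
  "cubes D \<equiv> (\<Union>k. D k)"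

text \<open>The smallest cube strictly containing \<open>Q\<close>; the order on sets is inclusion.\<close>

definition dyadic_parent :: "(int \<Rightarrow> (real^'n) set set) \<Rightarrow> (real^'n) set \<Rightarrow> (real^'n) set" where
  "dyadic_parent D Q = (LEAST R. R \<in> cubes D \<and> Q \<subset> R)"


section \<open>Averages, weights and weighted Lebesgue spaces\<close>

definition conj_exp :: "real \<Rightarrow> real" where
  "conj_exp p = p / (p - 1)"

text \<open>Real powers on \<open>[0,\<infinity>]\<close>, for positive exponents only.\<close>

definition ennpowr :: "ennreal \<Rightarrow> real \<Rightarrow> ennreal"  (infixr \<open>ennpowr\<close> 80) where
  "x ennpowr s = (if x = \<infinity> then \<infinity> else ennreal (enn2real x powr s))"

definition locally_integrable :: "(real^'n \<Rightarrow> 'b::{banach, second_countable_topology}) \<Rightarrow> bool" where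
  "locally_integrable f \<longleftrightarrow> (\<forall>K. compact K \<longrightarrow> f absolutely_integrable_on K)"

definition weight :: "(real^'n \<Rightarrow> real) \<Rightarrow> bool" where
  "weight w \<longleftrightarrow> (\<forall>x. 0 < w x) \<and> locally_integrable w"

definition avg :: "(real^'n \<Rightarrow> complex) \<Rightarrow> (real^'n) set \<Rightarrow> complex" where
  "avg f Q = (LINT x:Q|lebesgue. f x) /\<^sub>R measure lebesgue Q"

definition mass :: "(real^'n \<Rightarrow> real) \<Rightarrow> (real^'n) set \<Rightarrow> ennreal" where
  "mass w E = (\<integral>\<^sup>+x\<in>E. ennreal (w x) \<partial>lebesgue)"

definition wavg :: "(real^'n \<Rightarrow> real) \<Rightarrow> (real^'n) set \<Rightarrow> ennreal" where
  "wavg w Q = mass w Q / emeasure lebesgue Q"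

definition nn_Lp_norm :: "real \<Rightarrow> (real^'n \<Rightarrow> real) \<Rightarrow> (real^'n \<Rightarrow> ennreal) \<Rightarrow> ennreal" where
  "nn_Lp_norm p w F = (\<integral>\<^sup>+x. (F x) ennpowr p * ennreal (w x) \<partial>lebesgue) ennpowr (1 / p)"

definition Lp_norm :: "real \<Rightarrow> (real^'n \<Rightarrow> real) \<Rightarrow> (real^'n \<Rightarrow> complex) \<Rightarrow> ennreal" where
  "Lp_norm p w f = nn_Lp_norm p w (\<lambda>x. ennreal (norm (f x)))"

definition Lp_space :: "real \<Rightarrow> (real^'n \<Rightarrow> real) \<Rightarrow> (real^'n \<Rightarrow> complex) set" where
  "Lp_space p w = {f \<in> borel_measurable lebesgue. Lp_norm p w f < \<infinity>}"

text \<open>Unconditional convergence of \<open>\<Sum>i\<in>A. F i\<close> to \<open>g\<close> in \<open>L\<^sup>p(w)\<close>: as for \<^const>\<open>HAS_SUM\<close>, the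
  finite partial sums converge along \<^const>\<open>finite_subsets_at_top\<close>. The limit \<open>g\<close> is unique up to
  equality almost everywhere.\<close>

definition Lp_has_sum ::
  "real \<Rightarrow> (real^'n \<Rightarrow> real) \<Rightarrow> ('i \<Rightarrow> real^'n \<Rightarrow> complex) \<Rightarrow> 'i set \<Rightarrow> (real^'n \<Rightarrow> complex) \<Rightarrow> bool" where
  "Lp_has_sum p w F A g \<longleftrightarrow>
     (\<forall>i\<in>A. F i \<in> Lp_space p w) \<and> g \<in> Lp_space p w \<and>
     ((\<lambda>X. Lp_norm p w (\<lambda>x. (\<Sum>i\<in>X. F i x) - g x)) \<longlongrightarrow> 0) (finite_subsets_at_top A)"


section \<open>Weight characteristics\<close>

definition A_inf :: "(int \<Rightarrow> (real^'n) set set) \<Rightarrow> (real^'n \<Rightarrow> real) \<Rightarrow> ennreal" where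
  "A_inf D w = (SUP Q\<in>cubes D.
     (\<integral>\<^sup>+x\<in>Q. (SUP R\<in>{R \<in> cubes D. x \<in> R \<and> R \<subseteq> Q}. wavg w R) \<partial>lebesgue) / mass w Q)"

definition dual_weight :: "real \<Rightarrow> (real^'n \<Rightarrow> real) \<Rightarrow> real^'n \<Rightarrow> real" where
  "dual_weight p \<mu> = (\<lambda>x. \<mu> x powr (- (conj_exp p / p)))"

text \<open>The characteristic of the class \<open>B\<close> with exponents \<open>p'\<close> and \<open>q\<close>. The argument is \<open>p\<close>, not
  its conjugate exponent \<open>p'\<close>.\<close>

definition B_char ::
  "(int \<Rightarrow> (real^'n) set set) \<Rightarrow> real \<Rightarrow> real \<Rightarrow>
   (real^'n \<Rightarrow> real) \<Rightarrow> (real^'n \<Rightarrow> real) \<Rightarrow> (real^'n \<Rightarrow> real) \<Rightarrow> ennreal" where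
  "B_char D p q \<mu>' lam \<nu> = (SUP Q\<in>cubes D.
     (wavg \<mu>' Q) ennpowr (1 / conj_exp p) * (wavg lam Q) ennpowr (1 / q) *
     (wavg \<nu> Q) ennpowr (1 / p + 1 / conj_exp q))"


section \<open>Mean oscillation\<close>

definition oscillation :: "(real^'n \<Rightarrow> complex) \<Rightarrow> (real^'n) set \<Rightarrow> ennreal" where
  "oscillation b Q = (\<integral>\<^sup>+x\<in>Q. ennreal (norm (b x - avg b Q)) \<partial>lebesgue)"

definition BMO_norm ::
  "(int \<Rightarrow> (real^'n) set set) \<Rightarrow> real \<Rightarrow> (real^'n \<Rightarrow> real) \<Rightarrow> (real^'n \<Rightarrow> complex) \<Rightarrow> ennreal" where
  "BMO_norm D \<alpha> \<nu> b =
     (SUP Q\<in>cubes D. oscillation b Q / (mass \<nu> Q) ennpowr (1 + \<alpha> / real CARD('n)))"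

definition sharp_max ::
  "(int \<Rightarrow> (real^'n) set set) \<Rightarrow> (real^'n \<Rightarrow> real) \<Rightarrow> (real^'n \<Rightarrow> complex) \<Rightarrow> real^'n \<Rightarrow> ennreal" where
  "sharp_max D \<nu> b x = (SUP Q\<in>cubes D. indicator Q x * (oscillation b Q / mass \<nu> Q))"


section \<open>The paraproduct\<close>

definition mart_diff ::
  "(int \<Rightarrow> (real^'n) set set) \<Rightarrow> (real^'n \<Rightarrow> complex) \<Rightarrow> (real^'n) set \<Rightarrow> real^'n \<Rightarrow> complex" where
  "mart_diff D b Q x =
     (\<Sum>R\<in>{R \<in> cubes D. dyadic_parent D R = Q}. avg b R * indicator R x) - avg b Q * indicator Q x"

text \<open>\<open>g\<close> represents the paraproduct of \<open>f\<close> with symbol \<open>b\<close> as an element of \<open>L\<^sup>q(lam)\<close>.\<close>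

definition is_paraproduct ::
  "(int \<Rightarrow> (real^'n) set set) \<Rightarrow> real \<Rightarrow> (real^'n \<Rightarrow> real) \<Rightarrow>
   (real^'n \<Rightarrow> complex) \<Rightarrow> (real^'n \<Rightarrow> complex) \<Rightarrow> (real^'n \<Rightarrow> complex) \<Rightarrow> bool" where
  "is_paraproduct D q lam b f g \<longleftrightarrow>
     Lp_has_sum q lam (\<lambda>Q x. mart_diff D b Q x * avg f Q) (cubes D) g"

end

theory Submission
  imports Defs
begin

text \<open>The paraproduct is dominated pointwise by a sparse operator. Stopping cubes are selected where
  the average of \<open>|f|\<close>, the oscillation of \<open>b\<close>, or the partial sum of the series itself grows too
  much. Between stopping times the partial sums are martingale transforms of a truncation of \<open>b\<close> with
  bounded coefficients, so orthogonality in \<open>L\<^sup>2\<close> and Chebyshev's inequality bound the last kind.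

  The sparse operator is tested against \<open>k = G\<^bsup>q - 1\<^esup>\<close>, where \<open>G\<close> is its own value. With \<open>f = h \<mu>'\<close>, the
  characteristic of the triple turns each summand into a product of the averages of \<open>h\<close> and \<open>k\<close>
  weighted by \<open>\<mu>'(S)\<^bsup>1/p\<^esup>\<close> and \<open>\<lambda>(S)\<^bsup>1/q'\<^esup>\<close>, times a power of \<open>\<nu>(S)\<close> if \<open>p > q\<close>, and one concludes with
  Hoelder's inequality for sums and the Carleson embedding theorem, to which each weight contributes
  its \<open>A\<^sub>\<infinity>\<close> characteristic.

  The bound is uniform over finite subfamilies and signs, which in the uniformly convex space
  \<open>L\<^sup>q(\<lambda>)\<close> forces unconditional convergence. Since the product of suitable powers of the three
  weights is 1, finiteness of their characteristic makes each of them an \<open>A\<^sub>\<infinity>\<close> weight, so the bound is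
  finite whenever the norm of \<open>b\<close> is.\<close>

section \<open>Dyadic cubes\<close>

text \<open>Write \<open>s = 1 / p + 1 / conj_exp q\<close>. Three identities between exponents
  shape the estimate. First, \<open>(1 - 1 / p) + 1 / q + s = 2\<close>, so the characteristic
  bounds a product of masses by the square of the volume, and this square is what the two averages
  in a sparse summand, of \<open>|f|\<close> and of the oscillation of \<open>b\<close>, divide by.
  Second, \<open>s = 1 + \<alpha> / d\<close> is the power of the mass of \<nu> that normalises the
  oscillation in the BMO norm. Third, \<open>1 - s = 1 / r\<close>: if p \<le> q, the exponents
  \<open>1 / p\<close> and \<open>1 - 1 / q\<close> add up to at least 1, which suffices for sums;
  if p > q, they fall short of 1 by exactly \<open>1 / r\<close>, and the sharp maximal function
  supplies this part. Uniformity in the signs costs nothing, because the domination sees the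
  coefficients only through the bound of their absolute values by averages of \<open>|f|\<close>.
  Products in [0, \<infinity>] satisfy 0 * \<infinity> = 0, so a finite right-hand side controls the
  norm of \<open>b\<close> only after the other factors are known to be positive.\<close>

lemma is_cube_lebesgue:
  fixes Q :: "(real^'n) set"
  assumes "is_cube l Q" "0 < l"
  shows "Q \<in> lmeasurable" "measure lebesgue Q = l ^ CARD('n)" "bounded Q"
proof -
  obtain a I where I: "\<And>i. {a $ i <..< a $ i + l} \<subseteq> I i" "\<And>i. I i \<subseteq> {a $ i .. a $ i + l}"
    and Q: "Q = {x. \<forall>i. x $ i \<in> I i}"
    using assms(1) unfolding is_cube_def by blast
  let ?b = "a + (\<chi> i. l)"
  have sub1: "box a ?b \<subseteq> Q" and sub2: "Q \<subseteq> cbox a ?b"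
    using I unfolding Q by (fastforce simp: mem_box_cart)+
  \<comment> \<open>Which faces belong to the cube is immaterial: it lies between an open box and
    its closure, whose difference is a null set.\<close>
  have neg: "negligible (cbox a ?b - box a ?b)"
    by (metis negligible_frontier_interval)
  then have neg': "negligible (Q - box a ?b)"
    by (rule negligible_subset) (use sub2 in auto)
  have Qeq: "Q = box a ?b \<union> (Q - box a ?b)"
    using sub1 by auto
  show lm: "Q \<in> lmeasurable"
    by (subst Qeq) (intro fmeasurable.Un negligible_imp_measurable neg' lmeasurable_box)
  have "measure lebesgue Q = measure lebesgue (cbox a ?b)"
    by (rule measure_negligible_symdiff)
       (use lm neg sub1 sub2 in \<open>auto intro: negligible_subset\<close>)
  also have "\<dots> = l ^ CARD('n)"
  proof -
    have "cbox a ?b \<noteq> {}"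
      using assms(2) by (simp add: interval_ne_empty_cart(1))
    then show ?thesis
      by (simp add: content_cbox_if_cart)
  qed
  finally show "measure lebesgue Q = l ^ CARD('n)" .
  show "bounded Q"
    using sub2 bounded_cbox bounded_subset by blast
qed

abbreviation vol :: "(real^'n) set \<Rightarrow> real" where
  "vol Q \<equiv> measure lebesgue Q"

locale lattice =
  fixes D :: "int \<Rightarrow> (real^'n) set set"
  assumes lattice: "dyadic_lattice D"
begin

lemma partition_D: "partition_on UNIV (D k)"
  and cube_D: "Q \<in> D k \<Longrightarrow> is_cube (2 powi (- k)) Q"
  and refines_D: "refines UNIV (D (k + 1)) (D k)"
  using lattice unfolding dyadic_lattice_def by auto

lemma lmeasurable_cube: "Q \<in> cubes D \<Longrightarrow> Q \<in> lmeasurable"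
  using is_cube_lebesgue(1)[OF cube_D] by (auto simp: zero_less_power_int)

lemma sets_cube [measurable]: "Q \<in> cubes D \<Longrightarrow> Q \<in> sets lebesgue"
  using lmeasurable_cube by (auto simp: fmeasurable_def)

lemma bounded_cube: "Q \<in> cubes D \<Longrightarrow> bounded Q"
  using is_cube_lebesgue(3)[OF cube_D] by (auto simp: zero_less_power_int)

lemma vol_D: "Q \<in> D k \<Longrightarrow> vol Q = (2 powi (- k)) ^ CARD('n)"
  using is_cube_lebesgue(2)[OF cube_D] by (auto simp: zero_less_power_int)

lemma vol_pos: "Q \<in> cubes D \<Longrightarrow> 0 < vol Q"
  using vol_D by (auto simp: zero_less_power_int)

lemma vol_ne_0 [simp]: "Q \<in> cubes D \<Longrightarrow> vol Q \<noteq> 0"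
  using vol_pos by fastforce

lemma emeasure_cube: "Q \<in> cubes D \<Longrightarrow> emeasure lebesgue Q = ennreal (vol Q)"
  using lmeasurable_cube by (simp add: emeasure_eq_measure2)

lemma vol_mono: "P \<in> cubes D \<Longrightarrow> Q \<in> cubes D \<Longrightarrow> P \<subseteq> Q \<Longrightarrow> vol P \<le> vol Q"
  by (intro measure_mono_fmeasurable) (auto simp: lmeasurable_cube)

section \<open>Generations and nesting\<close>

lemma vol_less:
  assumes "P \<in> D j" "Q \<in> D k" "k < j"
  shows "vol P < vol Q"
proof -
  have "(2::real) powi (- j) < 2 powi (- k)"
    using assms(3) by (intro power_int_strict_increasing) auto
  then show ?thesis
    unfolding vol_D[OF assms(1)] vol_D[OF assms(2)]
    by (intro power_strict_mono) (auto simp: zero_le_power_int)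
qed

text \<open>The volume strictly decreases with the generation. Hence one may speak of the generation
  of a cube although \<open>cubes D\<close> forgets the index.\<close>

lemma generation_unique: "Q \<in> D j \<Longrightarrow> Q \<in> D k \<Longrightarrow> j = k"
  using vol_less[of Q j Q k] vol_less[of Q k Q j] by (cases j k rule: linorder_cases) auto

lemma nonempty_cube: "Q \<in> cubes D \<Longrightarrow> Q \<noteq> {}"
  using partition_D by (auto simp: partition_on_def)

lemma same_generation: "Q \<in> D k \<Longrightarrow> R \<in> D k \<Longrightarrow> Q \<inter> R \<noteq> {} \<Longrightarrow> Q = R"
  using partition_D[of k] unfolding partition_on_def disjoint_def by blast

lemma ancestor:
  assumes "Q \<in> D j" "k \<le> j"
  shows "\<exists>R\<in>D k. Q \<subseteq> R"
  using assms(2,1)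
proof (induction arbitrary: Q rule: int_le_induct)
  case base
  then show ?case by auto
next
  case (step i)
  then obtain R where "R \<in> D i" "Q \<subseteq> R"
    by blast
  moreover obtain R' where "R' \<in> D (i - 1)" "R \<subseteq> R'"
    using refines_D[of "i - 1"] \<open>R \<in> D i\<close> unfolding refines_def by auto
  ultimately show ?case by blast
qed

lemma cube_at:
  obtains Q where "Q \<in> D k" "x \<in> Q"
  using partition_D[of k] unfolding partition_on_def by blast

text \<open>The ancestor of \<open>Q\<close> in generation \<open>k\<close> meets \<open>R\<close>,
  and cubes of one generation that meet are equal.\<close>

lemma nested_D:
  assumes "Q \<in> D j" "R \<in> D k" "Q \<inter> R \<noteq> {}" "k \<le> j"
  shows "Q \<subseteq> R"
proof -
  obtain R' where "R' \<in> D k" "Q \<subseteq> R'"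
    using ancestor[OF assms(1,4)] by blast
  then show ?thesis
    using same_generation[of R' k R] assms by blast
qed

lemma nested:
  assumes "Q \<in> cubes D" "R \<in> cubes D" "Q \<inter> R \<noteq> {}"
  shows "Q \<subseteq> R \<or> R \<subseteq> Q"
proof -
  obtain j k where "Q \<in> D j" "R \<in> D k"
    using assms by blast
  then show ?thesis
    using nested_D[of Q j R k] nested_D[of R k Q j] assms(3) by (cases "k \<le> j") auto
qed

lemma generation_le: "Q \<in> D j \<Longrightarrow> R \<in> D k \<Longrightarrow> Q \<subseteq> R \<Longrightarrow> k \<le> j"
  using vol_less[of R k Q j] vol_mono[of Q R] by fastforce

lemma generation_less: "Q \<in> D j \<Longrightarrow> R \<in> D k \<Longrightarrow> Q \<subset> R \<Longrightarrow> k < j"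
  using generation_le[of Q j R k] same_generation[of Q k R] nonempty_cube[of Q]
  by (cases "k = j") (auto simp: psubset_eq)

text \<open>Any cube strictly containing \<open>R\<close> has generation at most
  \<open>k - 1\<close> and meets \<open>Q\<close>, hence contains it. So the \<open>LEAST\<close> in
  \<open>dyadic_parent\<close> exists and is the cube one generation up.\<close>

lemma dyadic_parent_eq:
  assumes "R \<in> D k" "Q \<in> D (k - 1)" "R \<subseteq> Q"
  shows "dyadic_parent D R = Q"
  unfolding dyadic_parent_def
proof (rule Least_equality)
  have "R \<noteq> Q"
    using generation_unique[of R k "k - 1"] assms by auto
  then show "Q \<in> cubes D \<and> R \<subset> Q"
    using assms by auto
next
  fix S assume S: "S \<in> cubes D \<and> R \<subset> S"
  then obtain i where i: "S \<in> D i" by blast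
  then have "i \<le> k - 1"
    using generation_less[of R k S i] S assms by auto
  then show "Q \<subseteq> S"
    using nested_D[of Q "k-1" S i] assms i S nonempty_cube[of R] by blast
qed

text \<open>The index set of the sum in \<open>mart_diff\<close>, named so that it can be located
  inside a single generation.\<close>

definition children :: "(real^'n) set \<Rightarrow> (real^'n) set set" where
  "children Q = {R \<in> cubes D. dyadic_parent D R = Q}"

lemma children_D:
  assumes "Q \<in> D k"
  shows "children Q = {R \<in> D (k + 1). R \<subseteq> Q}"
proof (intro equalityI subsetI)
  fix R assume "R \<in> children Q"
  then obtain j where j: "R \<in> D j" "dyadic_parent D R = Q"
    by (auto simp: children_def)
  obtain P where P: "P \<in> D (j - 1)" "R \<subseteq> P"
    using ancestor[OF j(1), of "j - 1"] by auto
  then have "P = Q"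
    using dyadic_parent_eq j by blast
  then have "j = k + 1"
    using generation_unique[of Q "j - 1" k] P assms by auto
  then show "R \<in> {R \<in> D (k + 1). R \<subseteq> Q}"
    using j P \<open>P = Q\<close> by auto
next
  fix R assume "R \<in> {R \<in> D (k + 1). R \<subseteq> Q}"
  then show "R \<in> children Q"
    using dyadic_parent_eq[of R "k + 1" Q] assms by (auto simp: children_def)
qed

lemma children_cubes: "R \<in> children Q \<Longrightarrow> R \<in> cubes D"
  by (auto simp: children_def)

lemma children_subset: "Q \<in> cubes D \<Longrightarrow> R \<in> children Q \<Longrightarrow> R \<subseteq> Q"
  using children_D by auto

lemma children_disjoint:
  assumes "Q \<in> cubes D"
  shows "disjoint (children Q)"
proof -
  obtain k where "Q \<in> D k" using assms by blast
  then show ?thesis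
    using same_generation unfolding disjoint_def children_D[OF \<open>Q \<in> D k\<close>] by blast
qed

lemma Union_children: "Q \<in> cubes D \<Longrightarrow> \<Union> (children Q) = Q"
proof -
  assume "Q \<in> cubes D"
  then obtain k where k: "Q \<in> D k" by blast
  have "x \<in> \<Union> (children Q)" if "x \<in> Q" for x
  proof -
    obtain R where "R \<in> D (k + 1)" "x \<in> R"
      using cube_at by blast
    moreover from this have "R \<subseteq> Q"
      by (intro nested_D[of R "k+1" Q k]) (use that k in auto)
    ultimately show ?thesis
      unfolding children_D[OF k] by blast
  qed
  then show ?thesis
    using children_subset[OF \<open>Q \<in> cubes D\<close>] by blast
qed

lemma vol_child:
  assumes "Q \<in> cubes D" "R \<in> children Q"
  shows "vol Q = 2 ^ CARD('n) * vol R"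
proof -
  obtain k where k: "Q \<in> D k" using assms by blast
  then have "R \<in> D (k + 1)"
    using assms children_D by auto
  moreover have "(2::real) powi (- k) = 2 * 2 powi (- (k + 1))"
    using power_int_add[of "2::real" 1 "- (k + 1)"] by simp
  ultimately show ?thesis
    using vol_D[OF k] vol_D[of R "k + 1"] by (simp add: power_mult_distrib)
qed

lemma sum_vol_disjoint:
  assumes "finite A" "A \<subseteq> cubes D" "disjoint A" "\<Union> A \<subseteq> Q" "Q \<in> cubes D"
  shows "(\<Sum>R\<in>A. vol R) \<le> vol Q"
proof -
  have "(\<Sum>R\<in>A. vol R) = vol (\<Union> A)"
    by (subst measure_Union') 
       (use assms in \<open>auto simp: lmeasurable_cube disjoint_def pairwise_def disjnt_def subset_iff\<close>)
  also have "\<dots> \<le> vol Q"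
    by (intro measure_mono_fmeasurable)
       (use assms sets_cube lmeasurable_cube in \<open>blast intro!: sets.finite_Union\<close>)+
  finally show ?thesis .
qed

text \<open>Volume counting: one child more than 2 to the power d would not fit disjointly into
  \<open>Q\<close>. Finiteness matters because the sum in \<open>mart_diff\<close> would be 0 over
  an infinite set.\<close>

lemma finite_children: "Q \<in> cubes D \<Longrightarrow> finite (children Q)"
proof (rule ccontr)
  assume Q: "Q \<in> cubes D" and inf: "infinite (children Q)"
  then obtain A where A: "A \<subseteq> children Q" "finite A" "card A = 2 ^ CARD('n) + 1"
    using infinite_arbitrarily_large by blast
  have "(\<Sum>R\<in>A. vol R) \<le> vol Q"
    using A Q children_cubes children_subset[OF Q] children_disjoint[OF Q]
    by (intro sum_vol_disjoint) (auto simp: disjoint_def subset_iff)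
  moreover have "(\<Sum>R\<in>A. vol R) = (\<Sum>R\<in>A. vol Q / 2 ^ CARD('n))"
    using vol_child[OF Q] A by (intro sum.cong) auto
  ultimately have "(2 ^ CARD('n) + 1) * (vol Q / 2 ^ CARD('n)) \<le> vol Q"
    using A by (simp add: add.commute)
  moreover have "(2 ^ CARD('n) + 1) * (vol Q / 2 ^ CARD('n)) = vol Q + vol Q / 2 ^ CARD('n)"
    by (simp add: field_simps)
  ultimately show False
    using vol_pos[OF Q] by (simp add: field_simps)
qed

lemma countable_cubes: "countable (cubes D)"
proof -
  have "countable (D k)" for k
  proof (rule countable_disjoint_nonempty_interior_subsets)
    show "disjoint (D k)"
      using partition_D by (simp add: partition_on_def)
  next
    fix Q assume Q: "Q \<in> D k" "interior Q = {}"
    obtain a I where I: "\<And>i. {a $ i <..< a $ i + 2 powi (- k)} \<subseteq> I i"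
      and Qe: "Q = {x. \<forall>i. x $ i \<in> I i}"
      using cube_D[OF Q(1)] unfolding is_cube_def by blast
    have "box a (a + (\<chi> i. 2 powi (- k))) \<subseteq> Q"
      using I unfolding Qe by (fastforce simp: mem_box_cart)
    then have "box a (a + (\<chi> i. 2 powi (- k))) \<subseteq> interior Q"
      by (simp add: interior_maximal open_box)
    moreover have "box a (a + (\<chi> i. 2 powi (- k))) \<noteq> {}"
      by (simp add: interval_ne_empty_cart zero_less_power_int)
    ultimately show "Q = {}"
      using Q(2) by auto
  qed
  then show ?thesis by auto
qed

text \<open>Each generation contributes at most one cube containing \<open>P\<close>. This keeps the
  convex hull of a finite family of cubes finite.\<close>

lemma finite_interval:
  assumes "P \<in> cubes D" "S \<in> cubes D"
  shows "finite {R \<in> cubes D. P \<subseteq> R \<and> R \<subseteq> S}"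
proof -
  obtain j k where jk: "P \<in> D j" "S \<in> D k" using assms by blast
  have "{R \<in> cubes D. P \<subseteq> R \<and> R \<subseteq> S} \<subseteq> (\<Union>i\<in>{k..j}. {R \<in> D i. P \<subseteq> R})"
  proof
    fix R assume R: "R \<in> {R \<in> cubes D. P \<subseteq> R \<and> R \<subseteq> S}"
    then obtain i where i: "R \<in> D i" by blast
    then have "i \<in> {k..j}"
      using R generation_le[OF jk(1) i] generation_le[OF i jk(2)] by auto
    then show "R \<in> (\<Union>i\<in>{k..j}. {R \<in> D i. P \<subseteq> R})"
      using i R by blast
  qed
  moreover have "finite {R \<in> D i. P \<subseteq> R}" for i
  proof -
    obtain x where x: "x \<in> P"
      using nonempty_cube[OF assms(1)] by blast
    obtain R0 where R0: "R0 \<in> D i" "x \<in> R0"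
      using cube_at by blast
    have "{R \<in> D i. P \<subseteq> R} \<subseteq> {R0}"
      using same_generation[OF _ R0(1)] R0(2) x by blast
    then show ?thesis
      by (meson finite.emptyI finite_insert finite_subset)
  qed
  ultimately show ?thesis
    by (meson finite_UN finite_atLeastAtMost_int finite_subset)
qed

lemma maximal_disjoint:
  assumes "A \<subseteq> cubes D" "R \<in> A" "S \<in> A" "R \<inter> S \<noteq> {}"
    "\<And>P. P \<in> A \<Longrightarrow> \<not> R \<subset> P" "\<And>P. P \<in> A \<Longrightarrow> \<not> S \<subset> P"
  shows "R = S"
proof -
  have "R \<subseteq> S \<or> S \<subseteq> R"
    using nested[of R S] assms(1-4) by (meson subsetD)
  then show ?thesis
    using assms(2,3,5,6) by (metis psubsetI)
qed

lemma exists_maximal: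
  assumes "finite A" "(R :: 'a set) \<in> A"
  shows "\<exists>S\<in>A. R \<subseteq> S \<and> (\<forall>P\<in>A. \<not> S \<subset> P)"
  using finite_has_maximal2[OF assms] by (metis psubset_eq)

section \<open>Stopping cubes and martingale differences\<close>

text \<open>Sparse with parameter 1/2. Finiteness is built in because only finite partial sums are
  ever dominated.\<close>

definition sparse :: "(real^'n) set set \<Rightarrow> bool" where
  "sparse S \<longleftrightarrow> finite S \<and> S \<subseteq> cubes D \<and> (\<exists>E. disjoint_family_on E S \<and>
     (\<forall>Q\<in>S. E Q \<in> sets lebesgue \<and> E Q \<subseteq> Q \<and> vol Q \<le> 2 * vol (E Q)))"

text \<open>\<open>bad\<close> takes the top cube as its first argument because all thresholds are
  relative to the stopping cube from which one descends.\<close>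

definition stopping :: "(real^'n) set set \<Rightarrow> ((real^'n) set \<Rightarrow> (real^'n) set \<Rightarrow> bool)
    \<Rightarrow> (real^'n) set \<Rightarrow> (real^'n) set set" where
  "stopping F bad S = {R \<in> F. R \<subset> S \<and> bad S R \<and> (\<forall>P\<in>F. P \<subset> S \<and> bad S P \<longrightarrow> \<not> R \<subset> P)}"

text \<open>The cubes between two successive stopping times: if \<open>S\<close> is itself a
  stopping cube, these are the cubes that \<open>S\<close> is responsible for.\<close>

definition unstopped :: "(real^'n) set set \<Rightarrow> ((real^'n) set \<Rightarrow> (real^'n) set \<Rightarrow> bool)
    \<Rightarrow> (real^'n) set \<Rightarrow> (real^'n) set set" where
  "unstopped F bad S = {Q \<in> F. Q \<subseteq> S \<and> (\<forall>R\<in>stopping F bad S. \<not> Q \<subseteq> R)}"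

lemma stopping_disjoint:
  assumes "F \<subseteq> cubes D"
  shows "disjoint (stopping F bad S)"
  unfolding disjoint_def
proof (intro ballI impI)
  fix P Q assume *: "P \<in> stopping F bad S" "Q \<in> stopping F bad S" "P \<noteq> Q"
  show "P \<inter> Q = {}"
  proof (rule ccontr)
    assume "P \<inter> Q \<noteq> {}"
    then have "P = Q"
      by (intro maximal_disjoint[of "{R \<in> F. R \<subset> S \<and> bad S R}"])
         (use * assms in \<open>auto simp: stopping_def\<close>)
    then show False using * by simp
  qed
qed

text \<open>A bad cube strictly inside \<open>S\<close> lies in a maximal one, which is a stopping
  cube. The top cube is excluded because the rule never tests it.\<close>

lemma unstopped_not_bad:
  assumes "finite F" "Q \<in> unstopped F bad S" "Q \<noteq> S"
  shows "\<not> bad S Q"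
proof
  assume "bad S Q"
  then have "Q \<in> {R \<in> F. R \<subset> S \<and> bad S R}"
    using assms by (auto simp: unstopped_def)
  then obtain R where "R \<in> {R \<in> F. R \<subset> S \<and> bad S R}" "Q \<subseteq> R"
      "\<forall>P\<in>{R \<in> F. R \<subset> S \<and> bad S R}. \<not> R \<subset> P"
    using exists_maximal[of "{R \<in> F. R \<subset> S \<and> bad S R}" Q] assms(1) by auto
  then have "R \<in> stopping F bad S"
    by (auto simp: stopping_def)
  then show False
    using assms(2) \<open>Q \<subseteq> R\<close> by (auto simp: unstopped_def)
qed

lemma unstopped_top: "S \<in> F \<Longrightarrow> S \<in> unstopped F bad S"
  by (auto simp: unstopped_def stopping_def)

text \<open>Iterating the stopping rule partitions \<open>F0\<close> into the unstopped cubes of the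
  selected cubes, with \<open>\<pi>\<close> the stopping ancestor. What remains of a selected cube
  after removing its stopping cubes serves as its major subset, and \<open>half\<close> makes that
  set large enough.\<close>

lemma stopping_sparse:
  assumes F0: "finite F0" "F0 \<subseteq> cubes D"
    and half: "\<And>S. S \<in> F0 \<Longrightarrow> 2 * vol (\<Union> (stopping F0 bad S)) \<le> vol S"
  shows "\<exists>\<S> \<pi>. sparse \<S> \<and> \<S> \<subseteq> F0 \<and> \<pi> ` F0 \<subseteq> \<S> \<and>
           (\<forall>S\<in>\<S>. {Q \<in> F0. \<pi> Q = S} = unstopped F0 bad S)"
proof -
  let ?ch = "stopping F0 bad"
  let ?C = "\<lambda>F. \<exists>\<S> E \<pi>. \<S> \<subseteq> F \<and> disjoint_family_on E \<S> \<and>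
     (\<forall>S\<in>\<S>. E S \<in> sets lebesgue \<and> E S \<subseteq> S \<and> vol S \<le> 2 * vol (E S)) \<and> \<pi> ` F \<subseteq> \<S> \<and>
     (\<forall>S\<in>\<S>. {Q \<in> F. \<pi> Q = S} = unstopped F0 bad S)"
  \<comment> \<open>Induction over subfamilies that contain, with a cube, all smaller cubes of
    \<open>F0\<close>. Splitting off the unstopped cubes of one maximal cube \<open>S\<close>
    preserves this property, and it ensures that the stopping cubes of \<open>S\<close>, computed in
    \<open>F0\<close>, belong to \<open>F\<close>.\<close>
  have "?C F" if "F \<subseteq> F0" "\<And>P Q. P \<in> F0 \<Longrightarrow> Q \<in> F \<Longrightarrow> P \<subseteq> Q \<Longrightarrow> P \<in> F" for F
    using that
  proof (induction "card F" arbitrary: F rule: less_induct)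
    case less
    have finF: "finite F" using less.prems(1) F0(1) finite_subset by blast
    show ?case
    proof (cases "F = {}")
      case True
      then show ?thesis by (auto simp: disjoint_family_on_def)
    next
      case False
      then obtain S where S: "S \<in> F" "\<And>P. P \<in> F \<Longrightarrow> \<not> S \<subset> P"
        using finite_has_maximal[OF finF] by (metis psubset_eq)
      have SF0: "S \<in> F0" using S less.prems by auto
      define F' where "F' = {Q \<in> F0. \<exists>R\<in>?ch S. Q \<subseteq> R} \<union> {Q \<in> F. \<not> Q \<subseteq> S}"
      have chS: "R \<subset> S" "R \<in> F0" if "R \<in> ?ch S" for R
        using that by (auto simp: stopping_def)
      have disj: "Q \<inter> S = {}" if "Q \<in> F" "\<not> Q \<subseteq> S" for Q
      proof (rule ccontr)
        assume "Q \<inter> S \<noteq> {}"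
        then have "Q \<subseteq> S \<or> S \<subseteq> Q"
          by (intro nested) (use that S F0(2) less.prems(1) in auto)
        then show False
          using that S(2)[OF that(1)] by auto
      qed
      have F'F: "F' \<subseteq> F"
        unfolding F'_def using less.prems(2)[OF _ S(1)] chS by blast
      have "S \<notin> F'"
        unfolding F'_def using chS by blast
      then have card: "card F' < card F"
        using F'F S(1) finF by (metis psubsetI psubset_card_mono)
      have down: "P \<in> F'" if "P \<in> F0" "Q \<in> F'" "P \<subseteq> Q" for P Q
      proof (cases "\<exists>R\<in>?ch S. Q \<subseteq> R")
        case True
        then show ?thesis using that unfolding F'_def by blast
      next
        case False
        then have Q: "Q \<in> F" "\<not> Q \<subseteq> S"
          using that unfolding F'_def by auto
        then have "P \<in> F" using less.prems(2) that by blast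
        moreover have "\<not> P \<subseteq> S"
          using disj[OF Q] that(1,3) nonempty_cube[of P] F0(2) by blast
        ultimately show ?thesis unfolding F'_def by blast
      qed
      have "?C F'"
        by (rule less.hyps[OF card]) (use F'F less.prems(1) down in blast)+
      then obtain \<S> E \<pi> where IH0: "\<S> \<subseteq> F'" "disjoint_family_on E \<S>"
          "\<forall>S\<in>\<S>. E S \<in> sets lebesgue \<and> E S \<subseteq> S \<and> vol S \<le> 2 * vol (E S)" "\<pi> ` F' \<subseteq> \<S>"
          "\<forall>S\<in>\<S>. {Q \<in> F'. \<pi> Q = S} = unstopped F0 bad S"
        by (elim exE conjE) (rule that)
      note IH = IH0(1,2) IH0(3)[rule_format] IH0(4) IH0(5)[rule_format]
      have "S \<notin> \<S>" using IH(1) \<open>S \<notin> F'\<close> by auto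
      \<comment> \<open>The new set misses the earlier ones, since each of those lies either inside
        a stopping cube of \<open>S\<close> or outside \<open>S\<close>.\<close>
      define E' where "E' = E(S := S - \<Union> (?ch S))"
      define \<pi>' where "\<pi>' = (\<lambda>Q. if Q \<in> F' then \<pi> Q else S)"
      have fin_ch: "finite (?ch S)"
        using F0(1) by (auto simp: stopping_def)
      have meas: "\<Union> (?ch S) \<in> lmeasurable"
        by (intro fmeasurable.finite_Union fin_ch) (use chS F0(2) lmeasurable_cube in blast)
      have Sm: "S \<in> lmeasurable"
        using lmeasurable_cube SF0 F0(2) by blast
      have sub: "\<Union> (?ch S) \<subseteq> S"
        using chS by blast
      have volE': "vol S \<le> 2 * vol (S - \<Union> (?ch S))"
        using half[OF SF0] measurable_measure_Diff[OF Sm fmeasurableD[OF meas] sub] by simp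
      have disjE: "(S - \<Union> (?ch S)) \<inter> E T = {}" if T: "T \<in> \<S>" for T
      proof (cases "\<exists>R\<in>?ch S. T \<subseteq> R")
        case True
        then show ?thesis using IH(3)[OF T] by blast
      next
        case False
        then have "T \<in> F" "\<not> T \<subseteq> S"
          using T IH(1) unfolding F'_def by auto
        then show ?thesis
          using disj[of T] IH(3)[OF T] by blast
      qed
      have "disjoint_family_on E' (insert S \<S>)"
      proof -
        have E': "E' S = S - \<Union> (?ch S)" "\<And>T. T \<in> \<S> \<Longrightarrow> E' T = E T"
          using \<open>S \<notin> \<S>\<close> by (auto simp: E'_def)
        have "E' S \<inter> E' T = {}" if "T \<in> \<S>" for T
          using disjE[OF that] E' that by simp
        moreover have "E' T \<inter> E' U = {}" if "T \<in> \<S>" "U \<in> \<S>" "T \<noteq> U" for T U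
          using IH(2) E' that unfolding disjoint_family_on_def by simp
        ultimately show ?thesis
          unfolding disjoint_family_on_def by (metis insertE inf_commute)
      qed
      moreover have "\<forall>T\<in>insert S \<S>. E' T \<in> sets lebesgue \<and> E' T \<subseteq> T \<and> vol T \<le> 2 * vol (E' T)"
        using IH(3) \<open>S \<notin> \<S>\<close> volE' meas Sm unfolding E'_def by (auto simp: fmeasurable_def)
      moreover have "\<pi>' ` F \<subseteq> insert S \<S>"
        using IH(4) unfolding \<pi>'_def by auto
      moreover have "\<forall>T\<in>insert S \<S>. {Q \<in> F. \<pi>' Q = T} = unstopped F0 bad T"
      proof
        fix T assume "T \<in> insert S \<S>"
        then consider "T = S" | "T \<in> \<S>" "T \<noteq> S" by blast
        then show "{Q \<in> F. \<pi>' Q = T} = unstopped F0 bad T"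
        proof cases
          case 1
          have "{Q \<in> F. \<pi>' Q = S} = F - F'"
            using IH(4) \<open>S \<notin> \<S>\<close> unfolding \<pi>'_def by auto
          also have "\<dots> = unstopped F0 bad S"
            using less.prems S(1) unfolding F'_def unstopped_def by blast
          finally show ?thesis using 1 by simp
        next
          case 2
          have "{Q \<in> F. \<pi>' Q = T} = {Q \<in> F'. \<pi> Q = T}"
            using 2 F'F unfolding \<pi>'_def by auto
          then show ?thesis using IH(5)[OF 2(1)] by simp
        qed
      qed
      moreover have "insert S \<S> \<subseteq> F"
        using IH(1) F'F S(1) by auto
      ultimately show ?thesis by blast
    qed
  qed
  then have "?C F0" by blast
  then obtain \<S> E \<pi> where *: "\<S> \<subseteq> F0" "disjoint_family_on E \<S>"
     "\<forall>S\<in>\<S>. E S \<in> sets lebesgue \<and> E S \<subseteq> S \<and> vol S \<le> 2 * vol (E S)" "\<pi> ` F0 \<subseteq> \<S>"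
     "\<forall>S\<in>\<S>. {Q \<in> F0. \<pi> Q = S} = unstopped F0 bad S"
    by (elim exE conjE) (rule that)
  have "sparse \<S>"
    unfolding sparse_def using * F0 finite_subset by blast
  then show ?thesis using * by blast
qed

section \<open>Averages over disjoint cubes\<close>

abbreviation ravg :: "(real^'n \<Rightarrow> real) \<Rightarrow> (real^'n) set \<Rightarrow> real" where
  "ravg g Q \<equiv> (LINT x:Q|lebesgue. g x) / vol Q"

lemma ravg_nonneg: "(\<And>x. 0 \<le> g x) \<Longrightarrow> 0 \<le> ravg g Q"
  unfolding set_lebesgue_integral_def by (intro divide_nonneg_nonneg integral_nonneg) auto

lemma sum_set_integral_disjoint_le:
  fixes g :: "real^'n \<Rightarrow> real"
  assumes "finite A" "A \<subseteq> cubes D" "disjoint A" "\<Union> A \<subseteq> S" "S \<in> cubes D"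
    "\<And>x. 0 \<le> g x" "set_integrable lebesgue S g"
  shows "(\<Sum>R\<in>A. LINT x:R|lebesgue. g x) \<le> (LINT x:S|lebesgue. g x)"
proof -
  have int: "set_integrable lebesgue R g" if "R \<in> A" for R
    using assms(2,4,7) that by (intro set_integrable_subset[OF assms(7)]) (auto intro: sets_cube)
  have "(\<Sum>R\<in>A. LINT x:R|lebesgue. g x) = (LINT x|lebesgue. (\<Sum>R\<in>A. indicator R x *\<^sub>R g x))"
    unfolding set_lebesgue_integral_def
    by (rule Bochner_Integration.integral_sum[symmetric]) (use int in \<open>auto simp: set_integrable_def\<close>)
  also have "\<dots> \<le> (LINT x|lebesgue. indicator S x *\<^sub>R g x)"
  proof (rule integral_mono)
    show "integrable lebesgue (\<lambda>x. \<Sum>R\<in>A. indicator R x *\<^sub>R g x)"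
      using int by (auto simp: set_integrable_def)
    show "integrable lebesgue (\<lambda>x. indicat_real S x *\<^sub>R g x)"
      using assms(7) by (simp add: set_integrable_def)
    fix x
    have "(\<Sum>R\<in>A. indicator R x *\<^sub>R g x) = (\<Sum>R\<in>{R\<in>A. x \<in> R}. g x)"
      using assms(1) by (intro sum.mono_neutral_cong_right) auto
    also have "\<dots> \<le> indicat_real S x *\<^sub>R g x"
    proof (cases "\<exists>R\<in>A. x \<in> R")
      case True
      then obtain R where R: "R \<in> A" "x \<in> R" by blast
      then have "{R\<in>A. x \<in> R} = {R}"
        using assms(3) unfolding disjoint_def by blast
      then show ?thesis
        using R assms(4) by (auto simp: indicator_def)
    next
      case False
      then have "(\<Sum>R\<in>{R\<in>A. x \<in> R}. g x) = 0"
        by (intro sum.neutral) auto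
      moreover have "0 \<le> indicat_real S x *\<^sub>R g x"
        using assms(6) by simp
      ultimately show ?thesis by linarith
    qed
    finally show "(\<Sum>R\<in>A. indicator R x *\<^sub>R g x) \<le> indicat_real S x *\<^sub>R g x" .
  qed
  finally show ?thesis
    by (simp add: set_lebesgue_integral_def)
qed

text \<open>Chebyshev's inequality for disjoint cubes. The strict inequality in the hypothesis lets
  the factor \<open>ravg g S\<close> be cancelled: if it vanishes, \<open>A\<close> must be
  empty.\<close>

lemma vol_large_average:
  assumes A: "finite A" "A \<subseteq> cubes D" "disjoint A" "\<Union> A \<subseteq> S" and S: "S \<in> cubes D"
    and g: "\<And>x. 0 \<le> g x" "set_integrable lebesgue S g"
    and K: "0 < K" "\<And>R. R \<in> A \<Longrightarrow> K * ravg g S < ravg g R"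
  shows "K * vol (\<Union> A) \<le> vol S"
proof (cases "A = {}")
  case True
  then show ?thesis using K by simp
next
  case False
  have lt: "K * ravg g S * vol R < (LINT x:R|lebesgue. g x)" if "R \<in> A" for R
  proof -
    have "0 < vol R" using that A(2) vol_pos by auto
    then show ?thesis using K(2)[OF that] by (simp add: pos_less_divide_eq)
  qed
  have "K * ravg g S * (\<Sum>R\<in>A. vol R) < (\<Sum>R\<in>A. LINT x:R|lebesgue. g x)"
    unfolding sum_distrib_left using A(1) False lt by (intro sum_strict_mono) auto
  also have "\<dots> \<le> (LINT x:S|lebesgue. g x)"
    by (intro sum_set_integral_disjoint_le assms)
  also have "\<dots> = ravg g S * vol S"
    using S by simp
  finally have *: "ravg g S * (K * (\<Sum>R\<in>A. vol R)) < ravg g S * vol S"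
    by (simp add: mult_ac)
  moreover have "0 \<le> ravg g S" using ravg_nonneg[of g S] g by blast
  ultimately have "K * (\<Sum>R\<in>A. vol R) < vol S"
    by (metis mult_less_cancel_left_disj not_less)
  moreover have "vol (\<Union> A) \<le> (\<Sum>R\<in>A. vol R)"
    using A measure_Union_le[of A lebesgue] sets_cube by (auto simp: subset_iff)
  ultimately show ?thesis
    using K(1) by (meson less_eq_real_def mult_left_mono order_trans)
qed


section \<open>Martingale differences and their orthogonality\<close>

lemma mart_diff_outside:
  assumes "Q \<in> cubes D" "x \<notin> Q"
  shows "mart_diff D b Q x = 0"
proof -
  have "(\<Sum>R\<in>children Q. avg b R * indicator R x) = 0"
    using children_subset[OF assms(1)] assms(2) by (intro sum.neutral) (auto simp: indicator_def)
  then show ?thesis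
    using assms(2) by (simp add: mart_diff_def children_def)
qed

lemma mart_diff_child:
  assumes "Q \<in> cubes D" "R \<in> children Q" "x \<in> R"
  shows "mart_diff D b Q x = avg b R - avg b Q"
proof -
  have "x \<notin> R'" if "R' \<in> children Q" "R' \<noteq> R" for R'
    using children_disjoint[OF assms(1)] that assms unfolding disjoint_def by blast
  then have "(\<Sum>R'\<in>children Q. avg b R' * indicator R' x) = (\<Sum>R'\<in>{R}. avg b R' * indicator R' x)"
    using assms(2) finite_children[OF assms(1)] by (intro sum.mono_neutral_right) auto
  moreover have "x \<in> Q" using children_subset[OF assms(1,2)] assms(3) by auto
  ultimately show ?thesis
    using assms(3) by (simp add: mart_diff_def children_def)
qed

lemma child_containing:
  assumes "P \<in> cubes D" "Q \<in> cubes D" "P \<subset> Q"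
  obtains R where "R \<in> children Q" "P \<subseteq> R"
proof -
  obtain j k where jk: "P \<in> D j" "Q \<in> D k" using assms by blast
  have "k < j" using generation_less[OF jk assms(3)] .
  obtain x where x: "x \<in> P" using nonempty_cube[OF assms(1)] by blast
  then have "x \<in> \<Union> (children Q)"
    using assms(3) Union_children[OF assms(2)] by blast
  then obtain R where R: "R \<in> children Q" "x \<in> R" by blast
  then have "R \<in> D (k + 1)" using children_D[OF jk(2)] by blast
  then have "P \<subseteq> R"
    using nested_D[OF jk(1), of R "k + 1"] x R \<open>k < j\<close> by auto
  then show ?thesis using that R by blast
qed

text \<open>A cube strictly inside \<open>Q\<close> lies in a single child of \<open>Q\<close>, and
  there the difference takes one value.\<close>

lemma mart_diff_const:
  assumes "P \<in> cubes D" "Q \<in> cubes D" "P \<subset> Q" "x \<in> P" "y \<in> P"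
  shows "mart_diff D b Q x = mart_diff D b Q y"
proof -
  obtain R where "R \<in> children Q" "P \<subseteq> R"
    using child_containing[OF assms(1-3)] .
  then show ?thesis
    using mart_diff_child[OF assms(2)] assms by (metis subsetD)
qed

lemma integral_const_indicator:
  fixes c :: complex
  assumes "R \<in> cubes D"
  shows "integrable lebesgue (\<lambda>x. c * indicator R x)"
    "(LINT x|lebesgue. c * indicator R x) = vol R *\<^sub>R c"
proof -
  have eq: "(\<lambda>x. c * indicator R x) = (\<lambda>x. indicat_real R x *\<^sub>R c)"
    by (auto simp: indicator_def)
  have "integrable lebesgue (indicat_real R)"
    using lmeasurable_cube[OF assms] by (auto simp: fmeasurable_def)
  then show "integrable lebesgue (\<lambda>x. c * indicator R x)"
      "(LINT x|lebesgue. c * indicator R x) = vol R *\<^sub>R c"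
    unfolding eq by auto
qed

lemma integrable_mart_diff:
  assumes "Q \<in> cubes D"
  shows "integrable lebesgue (mart_diff D b Q)"
proof -
  have "integrable lebesgue (\<lambda>x. (\<Sum>R\<in>children Q. avg b R * indicator R x) - avg b Q * indicator Q x)"
    using assms children_cubes integral_const_indicator(1) by (intro Bochner_Integration.integrable_diff Bochner_Integration.integrable_sum) auto
  then show ?thesis
    unfolding mart_diff_def[abs_def] children_def by simp
qed

lemma bounded_mart_diff:
  assumes "Q \<in> cubes D"
  obtains B where "\<And>x. norm (mart_diff D b Q x) \<le> B"
proof
  fix x
  have "norm (mart_diff D b Q x) \<le> norm (\<Sum>R\<in>children Q. avg b R * indicator R x) + norm (avg b Q * indicator Q x)"
    unfolding mart_diff_def children_def by (rule norm_triangle_ineq4)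
  also have "\<dots> \<le> (\<Sum>R\<in>children Q. norm (avg b R)) + norm (avg b Q)"
    by (intro add_mono sum_norm_le) (auto simp: indicator_def norm_mult)
  finally show "norm (mart_diff D b Q x) \<le> (\<Sum>R\<in>children Q. norm (avg b R)) + norm (avg b Q)" .
qed

lemma vol_scale_avg: "Q \<in> cubes D \<Longrightarrow> vol Q *\<^sub>R avg b Q = (LINT x:Q|lebesgue. b x)"
  by (simp add: avg_def)

lemma integral_mart_diff:
  assumes Q: "Q \<in> cubes D" and b: "set_integrable lebesgue Q b"
  shows "(LINT x|lebesgue. mart_diff D b Q x) = 0"
proof -
  have i: "integrable lebesgue (\<lambda>x. avg b R * indicator R x)"
      "(LINT x|lebesgue. avg b R * indicator R x) = (LINT x:R|lebesgue. b x)" if "R \<in> cubes D" for R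
    using integral_const_indicator[OF that] vol_scale_avg[OF that, of b] by auto
  have "(LINT x|lebesgue. mart_diff D b Q x)
      = (\<Sum>R\<in>children Q. LINT x:R|lebesgue. b x) - (LINT x:Q|lebesgue. b x)"
    unfolding mart_diff_def children_def[symmetric] using i Q children_cubes
    by (subst Bochner_Integration.integral_diff) 
       (auto intro!: Bochner_Integration.integrable_sum simp: Bochner_Integration.integral_sum)
  also have "(\<Sum>R\<in>children Q. LINT x:R|lebesgue. b x) = (LINT x:(\<Union>R\<in>children Q. R)|lebesgue. b x)"
  proof (rule set_integral_finite_Union[symmetric])
    show "disjoint_family_on (\<lambda>R. R) (children Q)"
      using children_disjoint[OF Q] by (auto simp: disjoint_family_on_def disjoint_def)
    show "set_integrable lebesgue R b" if "R \<in> children Q" for R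
      using that Q children_cubes children_subset sets_cube by (intro set_integrable_subset[OF b]) blast+
  qed (use finite_children Q children_cubes sets_cube in blast)+
  also have "(\<Union>R\<in>children Q. R) = Q"
    using Union_children[OF Q] by simp
  finally show ?thesis by simp
qed

lemma integrable_norm_square:
  fixes f :: "real^'n \<Rightarrow> complex"
  assumes "integrable lebesgue f" "\<And>x. norm (f x) \<le> B"
  shows "integrable lebesgue (\<lambda>x. (norm (f x))\<^sup>2)"
proof (rule Bochner_Integration.integrable_bound)
  show "integrable lebesgue (\<lambda>x. B * norm (f x))"
    using assms(1) by simp
  show "(\<lambda>x. (norm (f x))\<^sup>2) \<in> borel_measurable lebesgue"
    using borel_measurable_integrable[OF assms(1)] by measurable
  show "AE x in lebesgue. norm ((norm (f x))\<^sup>2) \<le> norm (B * norm (f x))"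
  proof (rule AE_I2)
    fix x
    have "(norm (f x))\<^sup>2 \<le> B * norm (f x)"
      unfolding power2_eq_square by (intro mult_right_mono assms(2)) auto
    then show "norm ((norm (f x))\<^sup>2) \<le> norm (B * norm (f x))"
      by simp
  qed
qed

lemma bounded_mart_transform:
  assumes "finite G" "G \<subseteq> cubes D"
  obtains B where "\<And>x. norm (\<Sum>P\<in>G. c P * mart_diff D b P x) \<le> B"
proof -
  have "\<exists>B. \<forall>P\<in>G. \<forall>x. norm (mart_diff D b P x) \<le> B P"
    using bounded_mart_diff assms(2) by (intro bchoice) (metis subsetD)
  then obtain B where B: "\<And>P x. P \<in> G \<Longrightarrow> norm (mart_diff D b P x) \<le> B P" by blast
  have "norm (\<Sum>P\<in>G. c P * mart_diff D b P x) \<le> (\<Sum>P\<in>G. norm (c P) * B P)" for x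
    by (intro sum_norm_le) (auto simp: norm_mult intro!: mult_left_mono B)
  then show ?thesis using that by blast
qed

lemma integrable_mart_transform:
  assumes "finite G" "G \<subseteq> cubes D"
  shows "integrable lebesgue (\<lambda>x. \<Sum>P\<in>G. c P * mart_diff D b P x)"
    "integrable lebesgue (\<lambda>x. (norm (\<Sum>P\<in>G. c P * mart_diff D b P x))\<^sup>2)"
proof -
  show *: "integrable lebesgue (\<lambda>x. \<Sum>P\<in>G. c P * mart_diff D b P x)"
    using assms integrable_mart_diff
    by (intro Bochner_Integration.integrable_sum integrable_mult_right) auto
  obtain B where "\<And>x. norm (\<Sum>P\<in>G. c P * mart_diff D b P x) \<le> B"
    using bounded_mart_transform[OF assms, of c b] by blast
  then show "integrable lebesgue (\<lambda>x. (norm (\<Sum>P\<in>G. c P * mart_diff D b P x))\<^sup>2)"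
    by (rule integrable_norm_square[OF *])
qed

text \<open>Pythagoras, splitting off a minimal cube \<open>P\<close>. The other differences are
  constant on \<open>P\<close>, whereas the difference of \<open>P\<close> lives on \<open>P\<close>
  and has integral zero, so the cross term vanishes.\<close>

lemma mart_diff_orthogonal:
  assumes "finite G" "G \<subseteq> cubes D" "\<And>Q. Q \<in> cubes D \<Longrightarrow> set_integrable lebesgue Q b"
  shows "(LINT x|lebesgue. (norm (\<Sum>P\<in>G. c P * mart_diff D b P x))\<^sup>2)
       = (\<Sum>P\<in>G. (norm (c P))\<^sup>2 * (LINT x|lebesgue. (norm (mart_diff D b P x))\<^sup>2))"
  using assms(1,2)
proof (induction "card G" arbitrary: G rule: less_induct)
  case less
  show ?case
  proof (cases "G = {}")
    case True then show ?thesis by simp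
  next
    case False
    then obtain P where P: "P \<in> G" "\<And>Q. Q \<in> G \<Longrightarrow> \<not> Q \<subset> P"
      using finite_has_minimal[OF less.prems(1)] by (metis psubset_eq)
    define G' where "G' = G - {P}"
    have G': "finite G'" "G' \<subseteq> cubes D" "P \<notin> G'" "G = insert P G'" "card G' < card G"
      using less.prems P card_Diff1_less[of G P] by (auto simp: G'_def)
    have PD: "P \<in> cubes D" using P less.prems by auto
    define T where "T = (\<lambda>x. \<Sum>Q\<in>G'. c Q * mart_diff D b Q x)"
    define d where "d = (\<lambda>x. c P * mart_diff D b P x)"
    obtain x0 where x0: "x0 \<in> P" using nonempty_cube[OF PD] by blast
    have T: "T x = T x0" if "x \<in> P" for x
      unfolding T_def
    proof (intro sum.cong refl arg_cong2[where f="(*)"])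
      fix Q assume Q: "Q \<in> G'"
      then have QD: "Q \<in> cubes D" "Q \<noteq> P" "\<not> Q \<subset> P" using G' P by auto
      show "mart_diff D b Q x = mart_diff D b Q x0"
      proof (cases "Q \<inter> P = {}")
        case True
        then show ?thesis using mart_diff_outside[OF QD(1)] that x0 by (metis disjoint_iff)
      next
        case False
        then have "P \<subset> Q" using nested[OF QD(1) PD] QD by blast
        then show ?thesis using mart_diff_const[OF PD QD(1)] that x0 by blast
      qed
    qed
    have d: "integrable lebesgue d" "(LINT x|lebesgue. d x) = 0"
      unfolding d_def using integrable_mart_diff[OF PD] integral_mart_diff[OF PD assms(3)[OF PD]] by auto
    have d2: "integrable lebesgue (\<lambda>x. (norm (d x))\<^sup>2)"
      using integrable_mart_transform(2)[of "{P}" c b] PD by (simp add: d_def)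
    have T2: "integrable lebesgue (\<lambda>x. (norm (T x))\<^sup>2)"
      unfolding T_def by (rule integrable_mart_transform(2)[OF G'(1,2)])
    have "(norm (\<Sum>P\<in>G. c P * mart_diff D b P x))\<^sup>2 = (norm (T x))\<^sup>2 + (norm (d x))\<^sup>2 + 2 * (T x0 \<bullet> d x)" for x
    proof -
      have "T x \<bullet> d x = T x0 \<bullet> d x"
        using T mart_diff_outside[OF PD] by (cases "x \<in> P") (auto simp: d_def)
      moreover have "(\<Sum>P\<in>G. c P * mart_diff D b P x) = T x + d x"
        using G'(1,3) unfolding G'(4) T_def d_def by simp
      ultimately show ?thesis
        by (simp add: power2_norm_eq_inner inner_add_left inner_add_right inner_commute)
    qed
    then have "(LINT x|lebesgue. (norm (\<Sum>P\<in>G. c P * mart_diff D b P x))\<^sup>2)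
        = (LINT x|lebesgue. (norm (T x))\<^sup>2) + (LINT x|lebesgue. (norm (d x))\<^sup>2)"
      using d d2 T2 by simp
    also have "(LINT x|lebesgue. (norm (T x))\<^sup>2)
       = (\<Sum>P\<in>G'. (norm (c P))\<^sup>2 * (LINT x|lebesgue. (norm (mart_diff D b P x))\<^sup>2))"
      unfolding T_def by (intro less.hyps G')
    also have "(LINT x|lebesgue. (norm (d x))\<^sup>2) = (norm (c P))\<^sup>2 * (LINT x|lebesgue. (norm (mart_diff D b P x))\<^sup>2)"
      by (simp add: d_def norm_mult power_mult_distrib)
    finally show ?thesis
      using G'(1,3) unfolding G'(4) by simp
  qed
qed

section \<open>Sparse domination\<close>

lemma norm_avg_diff_le:
  assumes "P \<in> cubes D" "set_integrable lebesgue P b"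
  shows "norm (avg b P - z) \<le> ravg (\<lambda>x. norm (b x - z)) P"
proof -
  have P: "set_integrable lebesgue P (\<lambda>x. z)"
    using lmeasurable_cube[OF assms(1)] by (auto simp: set_integrable_def fmeasurable_def)
  have "(LINT x:P|lebesgue. z) = vol P *\<^sub>R z"
  proof -
    have "(\<lambda>x. indicat_real P x *\<^sub>R z) = (\<lambda>x. z * indicator P x)"
      by (auto simp: indicator_def)
    then show ?thesis
      using integral_const_indicator(2)[OF assms(1), of z] by (simp add: set_lebesgue_integral_def)
  qed
  then have "vol P *\<^sub>R (avg b P - z) = (LINT x:P|lebesgue. b x - z)"
    using vol_scale_avg[OF assms(1), of b] set_integral_diff(2)[OF assms(2) P]
    by (simp add: scaleR_diff_right)
  then have "vol P * norm (avg b P - z) = norm (LINT x:P|lebesgue. b x - z)"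
    by (metis measure_nonneg norm_scaleR abs_of_nonneg)
  also have "\<dots> \<le> (LINT x:P|lebesgue. norm (b x - z))"
    unfolding set_lebesgue_integral_def
    by (rule order_trans[OF integral_norm_bound]) (simp add: mult.commute)
  finally show ?thesis
    using vol_pos[OF assms(1)] by (simp add: field_simps)
qed

text \<open>An unstopped cube may have bad children, yet its martingale difference involves their
  averages. This is the price of going one generation beyond the last good cube.\<close>

lemma ravg_child_le:
  assumes "Q \<in> cubes D" "R \<in> children Q" "\<And>x. 0 \<le> g x" "set_integrable lebesgue Q g"
  shows "ravg g R \<le> 2 ^ CARD('n) * ravg g Q"
proof -
  have R: "R \<in> cubes D" "R \<subseteq> Q"
    using children_cubes children_subset assms by auto
  have "(LINT x:R|lebesgue. g x) \<le> (LINT x:Q|lebesgue. g x)"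
    using sum_set_integral_disjoint_le[of "{R}" Q g] R assms by (auto simp: disjoint_def)
  then have "ravg g R \<le> (LINT x:Q|lebesgue. g x) / vol R"
    by (simp add: divide_right_mono)
  also have "\<dots> = 2 ^ CARD('n) * ravg g Q"
    using vol_child[OF assms(1,2)] R(1) by simp
  finally show ?thesis .
qed

text \<open>Telescoping along the chain from \<open>S\<close> down to \<open>Q\<close>, by induction
  on the generation of \<open>Q\<close>. The sum ends at a child of \<open>Q\<close> because the
  difference of \<open>Q\<close> already sees the next generation.\<close>

lemma sum_mart_diff_chain:
  assumes "Q \<in> cubes D" "S \<in> cubes D" "Q \<subseteq> S" "R \<in> children Q" "x \<in> R"
  shows "(\<Sum>P\<in>{P \<in> cubes D. Q \<subseteq> P \<and> P \<subseteq> S}. mart_diff D b P x) = avg b R - avg b S"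
proof -
  obtain j k where jk: "Q \<in> D j" "S \<in> D k" using assms by blast
  have "k \<le> j" using generation_le[OF jk assms(3)] .
  then show ?thesis
    using jk assms
  proof (induction j arbitrary: Q R rule: int_ge_induct)
    case base
    then have "Q = S"
      using same_generation[of Q k S] nonempty_cube[of Q] by blast
    then have "{P \<in> cubes D. Q \<subseteq> P \<and> P \<subseteq> S} = {S}"
      using base by auto
    then show ?case
      using mart_diff_child[of S R x b] base \<open>Q = S\<close> by simp
  next
    case (step i)
    obtain Q1 where Q1: "Q1 \<in> D i" "Q \<subseteq> Q1"
      using ancestor[OF step.prems(1), of i] by auto
    obtain y where y: "y \<in> Q" using nonempty_cube[OF step.prems(3)] by blast
    have QS1: "Q1 \<subseteq> S"
      by (rule nested_D[OF Q1(1) step.prems(2) _ step.hyps]) (use y Q1 step.prems in blast)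
    have "Q \<in> children Q1"
      using children_D[OF Q1(1)] Q1(2) step.prems(1) by auto
    have xQ: "x \<in> Q" using children_subset[OF step.prems(3)] step.prems by blast
    have IH: "(\<Sum>P\<in>{P \<in> cubes D. Q1 \<subseteq> P \<and> P \<subseteq> S}. mart_diff D b P x) = avg b Q - avg b S"
      by (rule step.IH) (use Q1 step.prems QS1 \<open>Q \<in> children Q1\<close> xQ in auto)
    have "{P \<in> cubes D. Q \<subseteq> P \<and> P \<subseteq> S} = insert Q {P \<in> cubes D. Q1 \<subseteq> P \<and> P \<subseteq> S}"
    proof (intro equalityI subsetI)
      fix P assume P: "P \<in> {P \<in> cubes D. Q \<subseteq> P \<and> P \<subseteq> S}"
      show "P \<in> insert Q {P \<in> cubes D. Q1 \<subseteq> P \<and> P \<subseteq> S}"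
      proof (cases "P = Q")
        case False
        obtain l where l: "P \<in> D l" using P by blast
        then have "l \<le> i"
          using generation_less[OF step.prems(1) l] P False by auto
        moreover have "Q1 \<inter> P \<noteq> {}" using Q1 P y by blast
        ultimately show ?thesis
          using nested_D[OF Q1(1) l] P by auto
      qed auto
    qed (use Q1 QS1 step.prems in auto)
    moreover have "Q \<notin> {P \<in> cubes D. Q1 \<subseteq> P \<and> P \<subseteq> S}"
      using generation_unique[OF step.prems(1), of i] Q1 by auto
    moreover have "finite {P \<in> cubes D. Q1 \<subseteq> P \<and> P \<subseteq> S}"
      by (rule finite_interval[OF _ step.prems(4)]) (use Q1(1) in blast)
    ultimately have "(\<Sum>P\<in>{P \<in> cubes D. Q \<subseteq> P \<and> P \<subseteq> S}. mart_diff D b P x)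
       = mart_diff D b Q x + (\<Sum>P\<in>{P \<in> cubes D. Q1 \<subseteq> P \<and> P \<subseteq> S}. mart_diff D b P x)"
      by (metis (no_types, lifting) sum.insert)
    then show ?case
      using mart_diff_child[OF step.prems(3,6,7), of b] IH by simp
  qed
qed

text \<open>Convexity of \<open>F\<close> makes the unstopped cubes around a point a chain without
  gaps, so with unit coefficients their differences telescope to a bounded function. That is the
  input for the estimate in the mean square; the general coefficients are compared with it by
  orthogonality.\<close>

lemma sparse_domination_convex:
  fixes b f :: "real^'n \<Rightarrow> complex" and c :: "(real^'n) set \<Rightarrow> complex"
  defines "\<Omega> \<equiv> \<lambda>S. ravg (\<lambda>x. norm (b x - avg b S)) S"
    and "fa \<equiv> ravg (\<lambda>x. norm (f x))"
  assumes F: "finite F" "F \<subseteq> cubes D"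
    and conv: "\<And>P Q S. Q \<in> F \<Longrightarrow> S \<in> F \<Longrightarrow> P \<in> cubes D \<Longrightarrow> Q \<subseteq> P \<Longrightarrow> P \<subseteq> S \<Longrightarrow> P \<in> F"
    and b: "\<And>Q. Q \<in> cubes D \<Longrightarrow> set_integrable lebesgue Q b"
    and f: "\<And>Q. Q \<in> cubes D \<Longrightarrow> set_integrable lebesgue Q f"
    and c: "\<And>Q. Q \<in> F \<Longrightarrow> norm (c Q) \<le> fa Q"
  shows "\<exists>\<S>. sparse \<S> \<and> (\<forall>x. norm (\<Sum>Q\<in>F. c Q * mart_diff D b Q x)
           \<le> 512 * 2 ^ CARD('n) * (\<Sum>S\<in>\<S>. \<Omega> S * fa S * indicator S x))"
proof -
  define d where "d = mart_diff D b"
  define N :: real where "N = 2 ^ CARD('n)"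
  have N: "1 \<le> N" by (simp add: N_def)
  define \<beta> where "\<beta> = (\<lambda>S R. ravg (\<lambda>x. norm (b x - avg b S)) R)"
  \<comment> \<open>No maximal inequality is needed: on a maximal stopping cube \<open>R\<close> the sum over \<open>P\<close> with
    \<open>R \<subset> P \<subseteq> S\<close> is the value of the full sum \<open>T S\<close> over the unstopped cubes.\<close>
  define bad3 where "bad3 = (\<lambda>S R. \<exists>x\<in>R. 256 * N * (\<Omega> S * fa S)
      < norm (\<Sum>P\<in>{P \<in> F. R \<subset> P \<and> P \<subseteq> S}. c P * d P x))"
  \<comment> \<open>The first two conditions each select at most an eighth of \<open>S\<close>, and
    \<open>bad3\<close> at most a sixteenth; together this stays below one half.\<close>
  define bad where "bad = (\<lambda>S R. 8 * fa S < fa R \<or> 8 * \<Omega> S < \<beta> S R \<or> bad3 S R)"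
  define G where "G = unstopped F bad"
  let ?ch = "stopping F bad"
  have \<Omega>\<beta>: "\<Omega> S = \<beta> S S" for S by (simp add: \<Omega>_def \<beta>_def)
  have nn: "0 \<le> \<beta> S R" "0 \<le> \<Omega> S" "0 \<le> fa S" for S R
    unfolding \<Omega>_def \<beta>_def fa_def by (rule ravg_nonneg; simp)+
  have bi: "set_integrable lebesgue Q (\<lambda>x. norm (b x - z))" if "Q \<in> cubes D" for Q z
  proof -
    have "set_integrable lebesgue Q (\<lambda>x. z)"
      using lmeasurable_cube[OF that] by (auto simp: set_integrable_def fmeasurable_def)
    then have "set_integrable lebesgue Q (\<lambda>x. b x - z)"
      by (intro set_integral_diff(1) b that)
    from set_integrable_norm[OF this] show ?thesis .
  qed
  have fi: "set_integrable lebesgue Q (\<lambda>x. norm (f x))" if "Q \<in> cubes D" for Q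
    by (rule set_integrable_norm[OF f[OF that]])
  have G_F: "P \<in> F" "P \<subseteq> S" "P \<in> cubes D" if "P \<in> G S" for P S
    using that F(2) by (auto simp: G_def unstopped_def)
  \<comment> \<open>For \<open>Q = S\<close> nothing was tested, but there the three bounds are
    trivial: the averages agree with those of \<open>S\<close>, and the sum is empty.\<close>
  have not_bad: "fa Q \<le> 8 * fa S" "\<beta> S Q \<le> 8 * \<Omega> S"
      "x \<in> Q \<Longrightarrow> norm (\<Sum>P\<in>{P \<in> F. Q \<subset> P \<and> P \<subseteq> S}. c P * d P x) \<le> 256 * N * (\<Omega> S * fa S)"
    if "Q \<in> G S" for Q S x
  proof -
    have "fa Q \<le> 8 * fa S \<and> \<beta> S Q \<le> 8 * \<Omega> S \<and>
      (\<forall>x\<in>Q. norm (\<Sum>P\<in>{P \<in> F. Q \<subset> P \<and> P \<subseteq> S}. c P * d P x) \<le> 256 * N * (\<Omega> S * fa S))"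
    proof (cases "Q = S")
      case True
      have "{P \<in> F. S \<subset> P \<and> P \<subseteq> S} = {}" by auto
      then have "(\<Sum>P\<in>{P \<in> F. S \<subset> P \<and> P \<subseteq> S}. c P * d P x) = 0" for x
        by (simp only: sum.empty)
      then show ?thesis
        unfolding True using nn[of S] nn(1)[of S S] \<Omega>\<beta>[of S] N by auto
    next
      case False
      have "\<not> bad S Q"
        using unstopped_not_bad[OF F(1), of Q bad S] False \<open>Q \<in> G S\<close> by (simp add: G_def)
      then show ?thesis
        unfolding bad_def bad3_def by (meson not_less)
    qed
    then show "fa Q \<le> 8 * fa S" "\<beta> S Q \<le> 8 * \<Omega> S"
      "x \<in> Q \<Longrightarrow> norm (\<Sum>P\<in>{P \<in> F. Q \<subset> P \<and> P \<subseteq> S}. c P * d P x) \<le> 256 * N * (\<Omega> S * fa S)"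
      by blast+
  qed
  have c_le: "norm (c Q) \<le> 8 * fa S" if "Q \<in> G S" for Q S
    using c[OF G_F(1)[OF that]] not_bad(1)[OF that] by linarith
  have avg_child: "norm (avg b R - avg b S) \<le> 8 * N * \<Omega> S"
    if "Q \<in> G S" "R \<in> children Q" for Q R S
  proof -
    have Q: "Q \<in> cubes D" by (rule G_F(3)) (rule that)
    have R: "R \<in> cubes D" by (rule children_cubes) (rule that)
    have "norm (avg b R - avg b S) \<le> \<beta> S R"
      unfolding \<beta>_def by (rule norm_avg_diff_le[OF R b[OF R]])
    also have "\<dots> \<le> N * \<beta> S Q"
      unfolding \<beta>_def N_def by (rule ravg_child_le[OF Q that(2) _ bi[OF Q]]) simp
    also have "\<dots> \<le> N * (8 * \<Omega> S)"
      using not_bad(2)[OF that(1)] N by (intro mult_left_mono) auto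
    finally show ?thesis by (simp add: mult_ac)
  qed
  have d_le: "norm (d Q x) \<le> 16 * N * \<Omega> S" if "Q \<in> G S" for Q S x
  proof (cases "x \<in> Q")
    case False
    then show ?thesis
      using mart_diff_outside[OF G_F(3)[OF that]] nn N by (simp add: d_def)
  next
    case True
    have Q: "Q \<in> cubes D" by (rule G_F(3)) (rule that)
    obtain R where R: "R \<in> children Q" "x \<in> R"
      using Union_children[OF Q] True by blast
    have "norm (avg b Q - avg b S) \<le> \<beta> S Q"
      unfolding \<beta>_def by (rule norm_avg_diff_le[OF Q b[OF Q]])
    then have 1: "norm (avg b Q - avg b S) \<le> 8 * \<Omega> S"
      using not_bad(2)[OF that] by linarith
    have "d Q x = (avg b R - avg b S) - (avg b Q - avg b S)"
      unfolding d_def using mart_diff_child[OF Q R] by simp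
    then have "norm (d Q x) \<le> norm (avg b R - avg b S) + norm (avg b Q - avg b S)"
      by (metis norm_triangle_ineq4)
    also have "\<dots> \<le> 8 * N * \<Omega> S + 8 * \<Omega> S"
      using avg_child[OF that R(1)] 1 by linarith
    also have "\<dots> \<le> 16 * N * \<Omega> S"
      using N mult_right_mono[OF N nn(2)[of S]] by simp
    finally show ?thesis .
  qed
  \<comment> \<open>All cubes between the smallest unstopped cube \<open>Q\<close> at
    \<open>x\<close> and \<open>S\<close> are in \<open>F\<close> by convexity, and they are
    unstopped because a stopping cube containing one of them would contain \<open>Q\<close>.\<close>
  have minimal: "\<exists>Q\<in>G S. x \<in> Q \<and> {P \<in> G S. x \<in> P} = {P \<in> cubes D. Q \<subseteq> P \<and> P \<subseteq> S} \<and>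
      {P \<in> cubes D. Q \<subseteq> P \<and> P \<subseteq> S} = insert Q {P \<in> F. Q \<subset> P \<and> P \<subseteq> S}"
    if "S \<in> F" "x \<in> S" for S x
  proof -
    have "S \<in> {P \<in> G S. x \<in> P}"
      using that unstopped_top[of S F bad] by (simp add: G_def)
    moreover have "finite {P \<in> G S. x \<in> P}"
      using F(1) by (auto simp: G_def unstopped_def)
    ultimately obtain Q where Q: "Q \<in> G S" "x \<in> Q" "\<And>P. P \<in> G S \<Longrightarrow> x \<in> P \<Longrightarrow> \<not> P \<subset> Q"
      using finite_has_minimal[of "{P \<in> G S. x \<in> P}"]
      by (metis (mono_tags, lifting) empty_iff mem_Collect_eq psubset_eq)
    have 1: "P \<in> F" if "P \<in> cubes D" "Q \<subseteq> P" "P \<subseteq> S" for P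
      using conv[OF G_F(1)[OF Q(1)] \<open>S \<in> F\<close>] that by blast
    have 2: "P \<in> G S" if "P \<in> cubes D" "Q \<subseteq> P" "P \<subseteq> S" for P
      using 1[OF that] Q(1) that unfolding G_def unstopped_def by blast
    have 3: "Q \<subseteq> P" if "P \<in> G S" "x \<in> P" for P
      using nested[OF G_F(3)[OF Q(1)] G_F(3)[OF that(1)]] Q that by blast
    have "{P \<in> G S. x \<in> P} = {P \<in> cubes D. Q \<subseteq> P \<and> P \<subseteq> S}"
    proof (rule set_eqI)
      fix P
      have "P \<in> cubes D \<and> P \<subseteq> S" if "P \<in> G S"
        using G_F(2,3)[OF that] by simp
      then show "P \<in> {P \<in> G S. x \<in> P} \<longleftrightarrow> P \<in> {P \<in> cubes D. Q \<subseteq> P \<and> P \<subseteq> S}"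
        using 2[of P] 3[of P] Q(2) by (metis (no_types, lifting) mem_Collect_eq subsetD)
    qed
    moreover have "{P \<in> cubes D. Q \<subseteq> P \<and> P \<subseteq> S} = insert Q {P \<in> F. Q \<subset> P \<and> P \<subseteq> S}"
    proof (rule set_eqI)
      fix P
      have "P \<in> cubes D" if "P \<in> F"
        using that F(2) by (rule subsetD[rotated])
      then show "P \<in> {P \<in> cubes D. Q \<subseteq> P \<and> P \<subseteq> S} \<longleftrightarrow> P \<in> insert Q {P \<in> F. Q \<subset> P \<and> P \<subseteq> S}"
        using 1[of P] G_F[OF Q(1)] by (metis (no_types, lifting) insert_iff mem_Collect_eq psubset_eq order_refl)
    qed
    ultimately show ?thesis using Q by blast
  qed
  define T where "T = (\<lambda>S x. \<Sum>P\<in>G S. c P * d P x)"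
  \<comment> \<open>The transform with unit coefficients. At \<open>x\<close> it equals
    \<open>avg b R - avg b S\<close>, where \<open>R\<close> is the child of the smallest unstopped
    cube with \<open>x \<in> R\<close>: a truncation of \<open>b - avg b S\<close>.\<close>
  define H where "H = (\<lambda>S x. \<Sum>P\<in>G S. d P x)"
  have finG: "finite (G S)" for S
    using F(1) by (auto simp: G_def unstopped_def)
  have restrict: "(\<Sum>P\<in>G S. a P * d P x) = (\<Sum>P\<in>{P \<in> G S. x \<in> P}. a P * d P x)" for S x a
  proof (rule sum.mono_neutral_right[OF finG])
    show "\<forall>P\<in>G S - {P \<in> G S. x \<in> P}. a P * d P x = 0"
    proof
      fix P assume P: "P \<in> G S - {P \<in> G S. x \<in> P}"
      then have "mart_diff D b P x = 0"
        by (intro mart_diff_outside G_F(3)[of P S]) auto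
      then show "a P * d P x = 0" by (simp add: d_def)
    qed
  qed auto
  have outside: "T S x = 0" "H S x = 0" if "x \<notin> S" for S x
    using restrict[of c x S] restrict[of "\<lambda>_. 1" x S] that G_F(2)
    unfolding T_def H_def by (auto intro!: sum.neutral simp: subset_iff)
  have H_le: "norm (H S x) \<le> 8 * N * \<Omega> S" if S: "S \<in> F" for S x
  proof (cases "x \<in> S")
    case True
    obtain Q where Q: "Q \<in> G S" "x \<in> Q" "{P \<in> G S. x \<in> P} = {P \<in> cubes D. Q \<subseteq> P \<and> P \<subseteq> S}"
      using minimal[OF S True] by blast
    have Qc: "Q \<in> cubes D" by (rule G_F(3)[OF Q(1)])
    obtain R where R: "R \<in> children Q" "x \<in> R"
      using Union_children[OF Qc] Q(2) by blast
    have "H S x = avg b R - avg b S"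
      unfolding H_def using restrict[of "\<lambda>_. 1" x S]
        sum_mart_diff_chain[OF Qc subsetD[OF F(2) S] G_F(2)[OF Q(1)] R]
      unfolding Q(3) d_def by simp
    then show ?thesis
      using avg_child[OF Q(1) R(1)] by simp
  qed (use outside nn N in simp)
  \<comment> \<open>Above the smallest unstopped cube the sum is controlled because that cube is not
    bad. Only its own term remains, so the constant is 8 * 16 + 256, rounded up to 512.\<close>
  have T_le: "norm (T S x) \<le> 512 * N * (\<Omega> S * fa S)" if S: "S \<in> F" for S x
  proof (cases "x \<in> S")
    case True
    obtain Q where Q: "Q \<in> G S" "x \<in> Q"
        "{P \<in> G S. x \<in> P} = insert Q {P \<in> F. Q \<subset> P \<and> P \<subseteq> S}"
      using minimal[OF S True] by auto
    have "T S x = c Q * d Q x + (\<Sum>P\<in>{P \<in> F. Q \<subset> P \<and> P \<subseteq> S}. c P * d P x)"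
      unfolding T_def using restrict[of c x S] Q(3) F(1) by simp
    also have "norm \<dots> \<le> norm (c Q) * norm (d Q x) + norm (\<Sum>P\<in>{P \<in> F. Q \<subset> P \<and> P \<subseteq> S}. c P * d P x)"
      by (rule order_trans[OF norm_triangle_ineq]) (simp add: norm_mult)
    also have "\<dots> \<le> (8 * fa S) * (16 * N * \<Omega> S) + 256 * N * (\<Omega> S * fa S)"
    proof (intro add_mono mult_mono)
      show "norm (c Q) \<le> 8 * fa S"
        by (rule c_le[OF Q(1)])
      show "norm (d Q x) \<le> 16 * N * \<Omega> S"
        by (rule d_le[OF Q(1)])
      show "norm (\<Sum>P\<in>{P \<in> F. Q \<subset> P \<and> P \<subseteq> S}. c P * d P x) \<le> 256 * N * (\<Omega> S * fa S)"
        by (rule not_bad(3)[OF Q(1,2)])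
    qed (use nn in auto)
    also have "\<dots> \<le> 512 * N * (\<Omega> S * fa S)"
    proof -
      have "0 \<le> N * (\<Omega> S * fa S)"
        using nn N by (intro mult_nonneg_nonneg) auto
      then show ?thesis by (simp add: mult_ac)
    qed
    finally show ?thesis .
  qed (use outside nn N in simp)
  have half: "2 * vol (\<Union> (?ch S)) \<le> vol S" if S: "S \<in> F" for S
  proof -
    have Sc: "S \<in> cubes D" using S F by auto
    define A1 where "A1 = {R \<in> ?ch S. 8 * fa S < fa R}"
    define A2 where "A2 = {R \<in> ?ch S. 8 * \<Omega> S < \<beta> S R}"
    define A3 where "A3 = {R \<in> ?ch S. bad3 S R}"
    have ch: "finite (?ch S)" "?ch S \<subseteq> cubes D" "disjoint (?ch S)" "\<Union> (?ch S) \<subseteq> S"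
      using F stopping_disjoint[OF F(2)] by (auto simp: stopping_def)
    have sub: "finite A" "A \<subseteq> cubes D" "disjoint A" "\<Union> A \<subseteq> S" if "A \<subseteq> ?ch S" for A
      using that ch finite_subset[OF that ch(1)] unfolding disjoint_def by blast+
    have subs: "A1 \<subseteq> ?ch S" "A2 \<subseteq> ?ch S" "A3 \<subseteq> ?ch S"
      by (auto simp: A1_def A2_def A3_def)
    have lm: "\<Union> A \<in> lmeasurable" if "A \<subseteq> ?ch S" for A
      by (intro fmeasurable.finite_Union) (use sub[OF that] lmeasurable_cube in blast)+
    have 1: "8 * vol (\<Union> A1) \<le> vol S"
      using fi[OF Sc] by (intro vol_large_average[OF sub[OF subs(1)] Sc, where g="\<lambda>x. norm (f x)"])
        (auto simp: A1_def fa_def)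
    have 2: "8 * vol (\<Union> A2) \<le> vol S"
      using bi[OF Sc] by (intro vol_large_average[OF sub[OF subs(2)] Sc, where g="\<lambda>x. norm (b x - avg b S)"])
        (auto simp: A2_def \<Omega>\<beta> \<beta>_def)
    \<comment> \<open>The differences of cubes strictly containing \<open>R\<close> are constant on
      \<open>R\<close>, so one point exceeding the threshold makes every point of \<open>R\<close>
      exceed it.\<close>
    have large: "256 * N * (\<Omega> S * fa S) < norm (T S x)" if R: "R \<in> A3" "x \<in> R" for x R
    proof -
      have Rc: "R \<in> cubes D" "R \<in> F" "R \<in> ?ch S"
        using R F by (auto simp: A3_def stopping_def)
      obtain y where y: "y \<in> R" "256 * N * (\<Omega> S * fa S)
          < norm (\<Sum>P\<in>{P \<in> F. R \<subset> P \<and> P \<subseteq> S}. c P * d P y)"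
        using R by (auto simp: A3_def bad3_def)
      have "{P \<in> G S. x \<in> P} = {P \<in> F. R \<subset> P \<and> P \<subseteq> S}"
      proof (intro equalityI subsetI)
        fix P assume P: "P \<in> {P \<in> G S. x \<in> P}"
        then have "\<not> P \<subseteq> R" using Rc by (auto simp: G_def unstopped_def)
        moreover have "P \<in> G S" "R \<inter> P \<noteq> {}"
          using P R(2) by auto
        ultimately have "R \<subset> P"
          using nested[OF Rc(1) G_F(3)[of P S]] by (metis psubset_eq order_refl)
        then show "P \<in> {P \<in> F. R \<subset> P \<and> P \<subseteq> S}"
          using G_F(1,2)[OF \<open>P \<in> G S\<close>] by simp
      next
        fix P assume P: "P \<in> {P \<in> F. R \<subset> P \<and> P \<subseteq> S}"
        have "\<not> P \<subseteq> R'" if R': "R' \<in> ?ch S" for R'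
        proof
          assume "P \<subseteq> R'"
          then have "R \<subset> R'" using P by blast
          then show False using Rc(3) R' by (auto simp: stopping_def)
        qed
        then show "P \<in> {P \<in> G S. x \<in> P}"
          using P R(2) by (auto simp: G_def unstopped_def)
      qed
      then have "T S x = (\<Sum>P\<in>{P \<in> F. R \<subset> P \<and> P \<subseteq> S}. c P * d P x)"
        unfolding T_def using restrict[of c x S] by simp
      also have "\<dots> = (\<Sum>P\<in>{P \<in> F. R \<subset> P \<and> P \<subseteq> S}. c P * d P y)"
      proof (intro sum.cong refl arg_cong2[where f="(*)"])
        fix P assume "P \<in> {P \<in> F. R \<subset> P \<and> P \<subseteq> S}"
        then have "P \<in> F" "R \<subset> P" by auto
        then show "d P x = d P y"
          unfolding d_def by (intro mart_diff_const[OF Rc(1) subsetD[OF F(2)] _ R(2) y(1)])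
      qed
      finally show ?thesis using y(2) by simp
    qed
    have 3: "16 * vol (\<Union> A3) \<le> vol S"
    proof (cases "\<Omega> S * fa S = 0")
      \<comment> \<open>With threshold zero Chebyshev's inequality is empty. Here \<open>T S\<close>
        vanishes identically, and the strict inequality in \<open>bad3\<close> rules out every
        cube.\<close>
      case True
      have "norm (c P * d P x) \<le> 0" if "P \<in> G S" for P x
      proof -
        have "norm (c P) * norm (d P x) \<le> (8 * fa S) * (16 * N * \<Omega> S)"
          using c_le[OF that] d_le[OF that] nn by (intro mult_mono) auto
        also have "\<dots> = 0" using True by auto
        finally show ?thesis by (simp add: norm_mult)
      qed
      then have "T S x = 0" for x
        unfolding T_def by (intro sum.neutral) auto
      then have "A3 = {}"
        using large True nonempty_cube sub(2)[OF subs(3)] by (metis all_not_in_conv mult_zero_right norm_zero order_less_irrefl subsetD)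
      then show ?thesis by simp
    next
      case False
      \<comment> \<open>The factor 64 N is the product of 8 from the coefficients and 8 N from the
        bound of \<open>H S\<close>. The threshold 256 N in \<open>bad3\<close> is four times as
        large, which gives the fraction 1/16 after squaring.\<close>
      define \<kappa> where "\<kappa> = 64 * N * (\<Omega> S * fa S)"
      have \<kappa>: "0 < \<kappa>"
        using False nn(2,3)[of S] N unfolding \<kappa>_def by (intro mult_pos_pos) (auto simp: less_le)
      have GD: "G S \<subseteq> cubes D" by (rule subsetI) (rule G_F(3))
      have i: "integrable lebesgue (\<lambda>x. (norm (T S x))\<^sup>2)" "integrable lebesgue (\<lambda>x. (norm (H S x))\<^sup>2)"
        using integrable_mart_transform(2)[OF finG GD, where b=b and c=c] integrable_mart_transform(2)[OF finG GD, where b=b and c="\<lambda>_. 1"]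
        unfolding T_def H_def d_def by simp_all
      have U: "\<Union> A3 \<in> lmeasurable" using lm[OF subs(3)] .
      have "(4 * \<kappa>)\<^sup>2 * vol (\<Union> A3) = (LINT x|lebesgue. indicat_real (\<Union> A3) x * (4 * \<kappa>)\<^sup>2)"
        using U by (simp add: fmeasurable_def)
      also have "\<dots> \<le> (LINT x|lebesgue. (norm (T S x))\<^sup>2)"
      proof (rule integral_mono[OF _ i(1)])
        show "integrable lebesgue (\<lambda>x. indicat_real (\<Union> A3) x * (4 * \<kappa>)\<^sup>2)"
          using U by (auto simp: fmeasurable_def)
        fix x
        have "(4 * \<kappa>)\<^sup>2 \<le> (norm (T S x))\<^sup>2" if "x \<in> \<Union> A3"
        proof (rule power_mono)
          obtain R where "R \<in> A3" "x \<in> R" using \<open>x \<in> \<Union> A3\<close> by blast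
          from large[OF this] show "4 * \<kappa> \<le> norm (T S x)" by (simp add: \<kappa>_def)
        qed (use \<kappa> in simp)
        then show "indicat_real (\<Union> A3) x * (4 * \<kappa>)\<^sup>2 \<le> (norm (T S x))\<^sup>2"
          by (simp add: indicator_def)
      qed
      \<comment> \<open>Orthogonality is applied in both directions: the square norm is split, the
        coefficients are replaced by their common bound, and the remaining sum is reassembled into
        the square norm of \<open>H S\<close>.\<close>
      also have "\<dots> = (\<Sum>P\<in>G S. (norm (c P))\<^sup>2 * (LINT x|lebesgue. (norm (d P x))\<^sup>2))"
        unfolding T_def d_def by (rule mart_diff_orthogonal[OF finG GD b])
      also have "\<dots> \<le> (\<Sum>P\<in>G S. (8 * fa S)\<^sup>2 * (LINT x|lebesgue. (norm (d P x))\<^sup>2))"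
        using c_le by (intro sum_mono mult_right_mono power_mono) auto
      also have "\<dots> = (8 * fa S)\<^sup>2 * (LINT x|lebesgue. (norm (H S x))\<^sup>2)"
        using mart_diff_orthogonal[OF finG GD b, where c="\<lambda>_. 1"]
        by (simp add: H_def d_def sum_distrib_left)
      also have "\<dots> \<le> (8 * fa S)\<^sup>2 * (LINT x|lebesgue. indicat_real S x * (8 * N * \<Omega> S)\<^sup>2)"
      proof (intro mult_left_mono integral_mono[OF i(2)])
        show "integrable lebesgue (\<lambda>x. indicat_real S x * (8 * N * \<Omega> S)\<^sup>2)"
          using lmeasurable_cube[OF Sc] by (auto simp: fmeasurable_def)
        show "(norm (H S x))\<^sup>2 \<le> indicat_real S x * (8 * N * \<Omega> S)\<^sup>2" for x
          using power_mono[OF H_le[OF S, of x], of 2] outside(2)[of x S] by (auto simp: indicator_def)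
      qed simp
      also have "\<dots> = \<kappa>\<^sup>2 * vol S"
        using sets_cube[OF Sc] by (simp add: \<kappa>_def power2_eq_square)
      finally have "\<kappa>\<^sup>2 * (16 * vol (\<Union> A3)) \<le> \<kappa>\<^sup>2 * vol S"
        by (simp add: power2_eq_square)
      then show ?thesis using \<kappa> by simp
    qed
    have "\<Union> (?ch S) = \<Union> A1 \<union> (\<Union> A2 \<union> \<Union> A3)"
      by (auto simp: A1_def A2_def A3_def stopping_def bad_def)
    then have "vol (\<Union> (?ch S)) \<le> vol (\<Union> A1) + (vol (\<Union> A2) + vol (\<Union> A3))"
      using lm[OF subs(1)] lm[OF subs(2)] lm[OF subs(3)]
        measure_Un_le[of "\<Union> A1" lebesgue "\<Union> A2 \<union> \<Union> A3"] measure_Un_le[of "\<Union> A2" lebesgue "\<Union> A3"]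
        sets.Un[of "\<Union> A2" lebesgue "\<Union> A3"]
      by (simp add: fmeasurable_def)
    then show ?thesis using 1 2 3 vol_pos[OF Sc] by linarith
  qed
  obtain \<S> \<pi> where \<S>: "sparse \<S>" "\<S> \<subseteq> F" "\<pi> ` F \<subseteq> \<S>" "\<forall>S\<in>\<S>. {Q \<in> F. \<pi> Q = S} = G S"
    using stopping_sparse[OF F half] unfolding G_def by blast
  have "norm (\<Sum>Q\<in>F. c Q * d Q x) \<le> 512 * N * (\<Sum>S\<in>\<S>. \<Omega> S * fa S * indicator S x)" for x
  proof -
    have "(\<Sum>Q\<in>F. c Q * d Q x) = (\<Sum>S\<in>\<S>. T S x)"
      unfolding T_def using \<S> F(1) by (subst sum.group[of F \<S> \<pi>, symmetric]) (auto simp: sparse_def)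
    also have "norm \<dots> \<le> (\<Sum>S\<in>\<S>. 512 * N * (\<Omega> S * fa S) * indicator S x)"
    proof (rule sum_norm_le)
      fix S assume "S \<in> \<S>"
      then have "S \<in> F" using \<S> by auto
      then show "norm (T S x) \<le> 512 * N * (\<Omega> S * fa S) * indicator S x"
        using T_le outside(1)[of x S] by (auto simp: indicator_def)
    qed
    also have "\<dots> = 512 * N * (\<Sum>S\<in>\<S>. \<Omega> S * fa S * indicator S x)"
      by (simp add: sum_distrib_left mult.assoc)
    finally show ?thesis .
  qed
  then show ?thesis
    using \<S>(1) unfolding d_def N_def by blast
qed

text \<open>The family is enlarged to its convex hull for inclusion, which is still finite, and the
  added cubes receive coefficient 0.\<close>

lemma sparse_domination:
  fixes b f :: "real^'n \<Rightarrow> complex" and c :: "(real^'n) set \<Rightarrow> complex"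
  assumes Y: "finite Y" "Y \<subseteq> cubes D"
    and b: "\<And>Q. Q \<in> cubes D \<Longrightarrow> set_integrable lebesgue Q b"
    and f: "\<And>Q. Q \<in> cubes D \<Longrightarrow> set_integrable lebesgue Q f"
    and c: "\<And>Q. Q \<in> Y \<Longrightarrow> norm (c Q) \<le> ravg (\<lambda>x. norm (f x)) Q"
  shows "\<exists>\<S>. sparse \<S> \<and> (\<forall>x. norm (\<Sum>Q\<in>Y. c Q * mart_diff D b Q x)
           \<le> 512 * 2 ^ CARD('n) *
             (\<Sum>S\<in>\<S>. ravg (\<lambda>x. norm (b x - avg b S)) S * ravg (\<lambda>x. norm (f x)) S * indicator S x))"
proof -
  define F where "F = (\<Union>Q\<in>Y. \<Union>S\<in>Y. {P \<in> cubes D. Q \<subseteq> P \<and> P \<subseteq> S})"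
  have F: "finite F" "F \<subseteq> cubes D"
    unfolding F_def using Y finite_interval by (auto simp: subset_iff)
  have YF: "Y \<subseteq> F" unfolding F_def using Y(2) by fast
  have conv: "P \<in> F" if "Q \<in> F" "S \<in> F" "P \<in> cubes D" "Q \<subseteq> P" "P \<subseteq> S" for P Q S
  proof -
    obtain Q' S' where "Q' \<in> Y" "Q' \<subseteq> Q" "S' \<in> Y" "S \<subseteq> S'"
      using \<open>Q \<in> F\<close> \<open>S \<in> F\<close> unfolding F_def by blast
    moreover from this have "Q' \<subseteq> P" "P \<subseteq> S'"
      using that by auto
    ultimately show ?thesis
      unfolding F_def using that(3) by blast
  qed
  define c' where "c' = (\<lambda>Q. if Q \<in> Y then c Q else 0)"
  have c': "norm (c' Q) \<le> ravg (\<lambda>x. norm (f x)) Q" for Q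
    using c ravg_nonneg[of "\<lambda>x. norm (f x)" Q] by (simp add: c'_def)
  have "(\<Sum>Q\<in>Y. c Q * mart_diff D b Q x) = (\<Sum>Q\<in>F. c' Q * mart_diff D b Q x)" for x
    using YF F by (intro sum.mono_neutral_cong_left) (auto simp: c'_def)
  then show ?thesis
    using sparse_domination_convex[OF F conv b f c'] by simp
qed

end

section \<open>The Carleson embedding\<close>

text \<open>Gives access to Fubini's theorem for the layer cake formula.\<close>

lemma sigma_finite_lebesgue: "sigma_finite_measure (lebesgue :: 'a::euclidean_space measure)"
proof
  show "\<exists>A::'a set set. countable A \<and> A \<subseteq> sets lebesgue \<and> \<Union> A = space lebesgue \<and>
      (\<forall>a\<in>A. emeasure lebesgue a \<noteq> \<infinity>)"
  proof (intro exI[of _ "range (\<lambda>n::nat. cball 0 (real n))"] conjI ballI)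
    have "x \<in> (\<Union>n::nat. cball 0 (real n))" for x :: 'a
      using real_arch_simple[of "norm x"] by (auto simp: dist_norm)
    then show "\<Union> (range (\<lambda>n::nat. cball (0::'a) (real n))) = space lebesgue"
      by auto
    fix a assume "a \<in> range (\<lambda>n::nat. cball (0::'a) (real n))"
    then show "emeasure lebesgue a \<noteq> \<infinity>"
      using fmeasurableD2[OF lmeasurable_cball[of "0::'a"]] by auto
  qed auto
qed

lemma nn_integral_powr_layer:
  fixes s a :: real
  assumes "0 < s" "0 \<le> a"
  shows "(\<integral>\<^sup>+t. ennreal (s * t powr (s - 1)) * indicator {0<..<a} t \<partial>lborel) = ennreal (a powr s)"
proof -
  have "((\<lambda>t. s * t powr (s - 1)) has_integral s * (a powr (s - 1 + 1) / (s - 1 + 1))) {0..a}"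
    using assms by (intro has_integral_mult_right has_integral_powr_from_0) auto
  then have "((\<lambda>t. s * t powr (s - 1)) has_integral (a powr s)) {0..a}"
    using assms by simp
  then have "(\<integral>\<^sup>+t. ennreal (indicator {0..a} t * (s * t powr (s - 1))) \<partial>lborel) = ennreal (a powr s)"
    using assms by (intro nn_integral_has_integral_lebesgue) auto
  moreover have "(\<integral>\<^sup>+t. ennreal (indicator {0..a} t * (s * t powr (s - 1))) \<partial>lborel)
      = (\<integral>\<^sup>+t. ennreal (s * t powr (s - 1)) * indicator {0<..<a} t \<partial>lborel)"
  proof (rule nn_integral_cong_AE)
    have "AE t in lborel. t \<noteq> (0::real)" "AE t in lborel. t \<noteq> a"
      by (simp_all add: AE_lborel_singleton)
    then show "AE t in lborel. ennreal (indicator {0..a} t * (s * t powr (s - 1)))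
        = ennreal (s * t powr (s - 1)) * indicator {0<..<a} t"
      by eventually_elim (auto simp: indicator_def)
  qed
  ultimately show ?thesis by simp
qed

context lattice begin

text \<open>Every cube of \<open>B\<close> lies in a maximal one, and below each maximal cube the
  Carleson condition applies.\<close>

lemma sum_le_maximal:
  fixes m :: "(real^'n) set \<Rightarrow> ennreal"
  assumes "finite \<S>" "B \<subseteq> \<S>"
    and C: "\<And>R. R \<in> \<S> \<Longrightarrow> (\<Sum>S\<in>{S \<in> \<S>. S \<subseteq> R}. m S) \<le> A * m R"
  shows "(\<Sum>S\<in>B. m S) \<le> A * (\<Sum>R\<in>{R \<in> B. \<forall>P\<in>B. \<not> R \<subset> P}. m R)"
proof -
  let ?M = "{R \<in> B. \<forall>P\<in>B. \<not> R \<subset> P}"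
  have fin: "finite B"
    using assms finite_subset by blast
  then have finM: "finite ?M" by simp
  have "(\<Sum>S\<in>B. m S) \<le> (\<Sum>S\<in>B. \<Sum>R\<in>?M. if S \<subseteq> R then m S else 0)"
  proof (rule sum_mono)
    fix S assume S: "S \<in> B"
    obtain R where R: "R \<in> ?M" "S \<subseteq> R"
      using exists_maximal[OF fin S] by blast
    have "(if S \<subseteq> R then m S else 0) \<le> (\<Sum>R\<in>?M. if S \<subseteq> R then m S else 0)"
      by (rule sum_nonneg_leq_bound[OF finM _ refl R(1)]) simp
    then show "m S \<le> (\<Sum>R\<in>?M. if S \<subseteq> R then m S else 0)"
      using R(2) by simp
  qed
  also have "\<dots> = (\<Sum>R\<in>?M. \<Sum>S\<in>B. if S \<subseteq> R then m S else 0)"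
    by (rule sum.swap)
  also have "\<dots> \<le> (\<Sum>R\<in>?M. A * m R)"
  proof (rule sum_mono)
    fix R assume "R \<in> ?M"
    have "(\<Sum>S\<in>B. if S \<subseteq> R then m S else 0) = (\<Sum>S\<in>{S \<in> B. S \<subseteq> R}. m S)"
      using fin by (simp add: sum.inter_filter)
    also have "\<dots> \<le> (\<Sum>S\<in>{S \<in> \<S>. S \<subseteq> R}. m S)"
      using assms(1,2) by (intro sum_mono2) auto
    also have "\<dots> \<le> A * m R"
      using C[of R] \<open>R \<in> ?M\<close> assms(2) by blast
    finally show "(\<Sum>S\<in>B. if S \<subseteq> R then m S else 0) \<le> A * m R" .
  qed
  finally show ?thesis by (simp add: sum_distrib_left)
qed

lemma sum_nn_integral_disjoint_le:
  fixes g :: "real^'n \<Rightarrow> ennreal"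
  assumes "finite I" "disjoint_family_on E I" "\<And>i. i \<in> I \<Longrightarrow> E i \<in> sets lebesgue" "g \<in> borel_measurable lebesgue"
  shows "(\<Sum>i\<in>I. \<integral>\<^sup>+x\<in>E i. g x \<partial>lebesgue) \<le> (\<integral>\<^sup>+x. g x \<partial>lebesgue)"
proof -
  have "(\<Sum>i\<in>I. \<integral>\<^sup>+x\<in>E i. g x \<partial>lebesgue) = (\<integral>\<^sup>+x. (\<Sum>i\<in>I. g x * indicator (E i) x) \<partial>lebesgue)"
    using assms by (intro nn_integral_sum[symmetric]) auto
  also have "\<dots> \<le> (\<integral>\<^sup>+x. g x \<partial>lebesgue)"
  proof (rule nn_integral_mono)
    fix x
    have "(\<Sum>i\<in>I. indicator (E i) x :: ennreal) = indicator (\<Union>i\<in>I. E i) x"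
      using assms(1,2) by (simp add: indicator_UN_disjoint)
    then show "(\<Sum>i\<in>I. g x * indicator (E i) x) \<le> g x"
      by (simp add: indicator_def flip: sum_distrib_left)
  qed
  finally show ?thesis .
qed

text \<open>On a maximal cube with average above \<open>t\<close>, the part of \<open>h\<close>
  below \<open>t / 2\<close> accounts for at most half of the integral. Thus only the values of
  \<open>h\<close> above \<open>t / 2\<close> are charged, as interpolation with the bound at
  infinity requires.\<close>

lemma carleson_weak_type:
  fixes w h :: "real^'n \<Rightarrow> real"
  assumes S: "finite \<S>" "\<S> \<subseteq> cubes D"
    and w: "w \<in> borel_measurable lebesgue" "\<And>x. 0 \<le> w x" "\<And>S. S \<in> \<S> \<Longrightarrow> mass w S < \<infinity>"
    and h: "h \<in> borel_measurable lebesgue" "\<And>x. 0 \<le> h x"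
    and C: "\<And>R. R \<in> \<S> \<Longrightarrow> (\<Sum>S\<in>{S \<in> \<S>. S \<subseteq> R}. mass w S) \<le> ennreal A * mass w R"
    and a: "\<And>S. S \<in> \<S> \<Longrightarrow> ennreal (a S) * mass w S \<le> (\<integral>\<^sup>+x\<in>S. ennreal (h x * w x) \<partial>lebesgue)"
    and t: "0 < t" and A: "0 \<le> A"
  shows "ennreal t * (\<Sum>S\<in>{S \<in> \<S>. t < a S}. mass w S)
    \<le> ennreal (2 * A) * (\<integral>\<^sup>+x. ennreal (h x * w x) * indicator {x. t < 2 * h x} x \<partial>lebesgue)"
proof -
  let ?k = "\<lambda>x. ennreal (h x * w x) * indicator {x. t < 2 * h x} x"
  define M where "M = {R \<in> {S \<in> \<S>. t < a S}. \<forall>P\<in>{S \<in> \<S>. t < a S}. \<not> R \<subset> P}"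
  note [measurable] = w(1) h(1)
  have M: "finite M" "M \<subseteq> \<S>" using S by (auto simp: M_def)
  have sets: "R \<in> sets lebesgue" if "R \<in> \<S>" for R
    using that S(2) sets_cube by blast
  have disj: "disjoint_family_on (\<lambda>R. R) M"
    unfolding disjoint_family_on_def
  proof (intro ballI impI)
    fix P Q assume "P \<in> M" "Q \<in> M" "P \<noteq> Q"
    then show "P \<inter> Q = {}"
      using maximal_disjoint[of "{S \<in> \<S>. t < a S}" P Q] S(2) unfolding M_def by auto
  qed
  \<comment> \<open>The low part of \<open>h\<close> is subtracted from both sides, which is
    legitimate since the mass of \<open>R\<close> is finite.\<close>
  have half: "ennreal (t / 2) * mass w R \<le> (\<integral>\<^sup>+x\<in>R. ?k x \<partial>lebesgue)" if "R \<in> M" for R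
  proof -
    have R: "R \<in> \<S>" "t < a R" using that by (auto simp: M_def)
    note [measurable] = sets[OF R(1)]
    have "ennreal (t / 2) * mass w R + ennreal (t / 2) * mass w R = ennreal t * mass w R"
      using t by (simp flip: distrib_right ennreal_plus)
    also have "\<dots> \<le> ennreal (a R) * mass w R"
      using R t by (intro mult_right_mono ennreal_leI) auto
    also have "\<dots> \<le> (\<integral>\<^sup>+x\<in>R. ennreal (h x * w x) \<partial>lebesgue)"
      by (rule a[OF R(1)])
    also have "\<dots> \<le> (\<integral>\<^sup>+x. ?k x * indicator R x + ennreal (t / 2) * (ennreal (w x) * indicator R x) \<partial>lebesgue)"
    proof (rule nn_integral_mono)
      fix x
      have "ennreal (h x * w x) \<le> ennreal (t / 2) * ennreal (w x)" if "\<not> t < 2 * h x"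
      proof -
        have "h x * w x \<le> t / 2 * w x"
          using that w(2)[of x] by (intro mult_right_mono) auto
        then show ?thesis
          using w(2)[of x] t by (simp add: ennreal_leI flip: ennreal_mult)
      qed
      then show "ennreal (h x * w x) * indicator R x
          \<le> ?k x * indicator R x + ennreal (t / 2) * (ennreal (w x) * indicator R x)"
        by (auto simp: indicator_def)
    qed
    also have "\<dots> = (\<integral>\<^sup>+x\<in>R. ?k x \<partial>lebesgue) + ennreal (t / 2) * mass w R"
      unfolding mass_def by (subst nn_integral_add) (auto simp: nn_integral_cmult)
    finally have "ennreal (t / 2) * mass w R + ennreal (t / 2) * mass w R
        \<le> ennreal (t / 2) * mass w R + (\<integral>\<^sup>+x\<in>R. ?k x \<partial>lebesgue)"
      by (simp only: add.commute)
    moreover have "ennreal (t / 2) * mass w R < \<infinity>"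
      using w(3)[OF R(1)] by (simp add: ennreal_mult_less_top)
    ultimately show ?thesis
      by (simp only: ennreal_add_left_cancel_le) auto
  qed
  have "ennreal (t / 2) * (\<Sum>R\<in>M. mass w R) \<le> (\<Sum>R\<in>M. \<integral>\<^sup>+x\<in>R. ?k x \<partial>lebesgue)"
    unfolding sum_distrib_left by (rule sum_mono) (rule half)
  also have "\<dots> \<le> (\<integral>\<^sup>+x. ?k x \<partial>lebesgue)"
    by (rule sum_nn_integral_disjoint_le[OF M(1) disj]) (use sets M(2) in auto)
  finally have 1: "ennreal (t / 2) * (\<Sum>R\<in>M. mass w R) \<le> (\<integral>\<^sup>+x. ?k x \<partial>lebesgue)" .
  have "ennreal t * (\<Sum>S\<in>{S \<in> \<S>. t < a S}. mass w S) \<le> ennreal t * (ennreal A * (\<Sum>R\<in>M. mass w R))"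
    unfolding M_def by (intro mult_left_mono sum_le_maximal[OF S(1) _ C]) auto
  also have "\<dots> = ennreal (2 * A) * (ennreal (t / 2) * (\<Sum>R\<in>M. mass w R))"
  proof -
    have "ennreal t * ennreal A = ennreal (2 * A) * ennreal (t / 2)"
      using t A by (simp add: mult.commute flip: ennreal_mult)
    then show ?thesis by (metis mult.assoc)
  qed
  also have "\<dots> \<le> ennreal (2 * A) * (\<integral>\<^sup>+x. ?k x \<partial>lebesgue)"
    using 1 by (intro mult_left_mono) auto
  finally show ?thesis .
qed

text \<open>Marcinkiewicz interpolation between the trivial bound at infinity and the weak type bound,
  for the map sending a function to its averages over the cubes of a Carleson family.\<close>

lemma carleson_embedding:
  fixes w h :: "real^'n \<Rightarrow> real"
  assumes p: "1 < p" and S: "finite \<S>" "\<S> \<subseteq> cubes D"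
    and w: "w \<in> borel_measurable lebesgue" "\<And>x. 0 \<le> w x" "\<And>S. S \<in> \<S> \<Longrightarrow> mass w S < \<infinity>"
    and h: "h \<in> borel_measurable lebesgue" "\<And>x. 0 \<le> h x"
    and C: "\<And>R. R \<in> \<S> \<Longrightarrow> (\<Sum>S\<in>{S \<in> \<S>. S \<subseteq> R}. mass w S) \<le> ennreal A * mass w R"
    and a: "\<And>S. S \<in> \<S> \<Longrightarrow> 0 \<le> a S"
      "\<And>S. S \<in> \<S> \<Longrightarrow> ennreal (a S) * mass w S \<le> (\<integral>\<^sup>+x\<in>S. ennreal (h x * w x) \<partial>lebesgue)"
    and A: "0 \<le> A"
  shows "(\<Sum>S\<in>\<S>. ennreal (a S powr p) * mass w S)
    \<le> ennreal (2 powr p * (p / (p - 1)) * A) * (\<integral>\<^sup>+x. ennreal (h x powr p * w x) \<partial>lebesgue)"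
proof -
  note [measurable] = w(1) h(1)
  interpret L: sigma_finite_measure "lebesgue :: (real^'n) measure"
    by (rule sigma_finite_lebesgue)
  interpret LL: pair_sigma_finite "lborel :: real measure" "lebesgue :: (real^'n) measure" ..
  \<comment> \<open>Chosen so that \<open>\<phi> t * t\<close> is the density
    \<open>p * t powr (p - 1)\<close> of the layer cake formula, with one factor \<open>t\<close>
    set aside for the weak type inequality.\<close>
  define \<phi> where "\<phi> = (\<lambda>t. ennreal (p * t powr (p - 2)) * indicator {0<..} t)"
  have [measurable]: "\<phi> \<in> borel_measurable lborel"
    unfolding \<phi>_def by measurable
  have layer: "ennreal (b powr p) = (\<integral>\<^sup>+t. \<phi> t * (ennreal t * indicator {..<b} t) \<partial>lborel)" if "0 \<le> b" for b
  proof -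
    have "ennreal (b powr p) = (\<integral>\<^sup>+t. ennreal (p * t powr (p - 1)) * indicator {0<..<b} t \<partial>lborel)"
      using nn_integral_powr_layer[of p b] that p by simp
    also have "\<dots> = (\<integral>\<^sup>+t. \<phi> t * (ennreal t * indicator {..<b} t) \<partial>lborel)"
    proof (rule nn_integral_cong)
      fix t :: real
      have "p * t powr (p - 1) = (p * t powr (p - 2)) * t" if "0 < t"
        using that powr_add[of t "p - 2" 1] by simp
      then show "ennreal (p * t powr (p - 1)) * indicator {0<..<b} t
          = \<phi> t * (ennreal t * indicator {..<b} t)"
        using p by (auto simp: \<phi>_def indicator_def ennreal_mult mult.assoc)
    qed
    finally show ?thesis .
  qed
  \<comment> \<open>The inner integral after Fubini. The power \<open>p - 1\<close> of
    \<open>2 * h x\<close> joins the factor \<open>h x\<close> from the weak type bound;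
    integrability at 0 uses p > 1.\<close>
  have layer': "(\<integral>\<^sup>+t. \<phi> t * indicator {t. t < b} t \<partial>lborel) = ennreal (p / (p - 1) * b powr (p - 1))"
    if "0 \<le> b" for b
  proof -
    have "(\<integral>\<^sup>+t. \<phi> t * indicator {t. t < b} t \<partial>lborel)
      = (\<integral>\<^sup>+t. ennreal (p / (p - 1)) * (ennreal ((p - 1) * t powr (p - 1 - 1)) * indicator {0<..<b} t) \<partial>lborel)"
      using p by (intro nn_integral_cong) (auto simp: \<phi>_def indicator_def ennreal_mult[symmetric])
    also have "\<dots> = ennreal (p / (p - 1)) * ennreal (b powr (p - 1))"
      using p that nn_integral_powr_layer[of "p - 1" b] by (subst nn_integral_cmult) auto
    also have "\<dots> = ennreal (p / (p - 1) * b powr (p - 1))"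
      using p by (intro ennreal_mult[symmetric]) auto
    finally show ?thesis .
  qed
  have "(\<Sum>S\<in>\<S>. ennreal (a S powr p) * mass w S)
      = (\<Sum>S\<in>\<S>. \<integral>\<^sup>+t. \<phi> t * (ennreal t * indicator {..<a S} t) * mass w S \<partial>lborel)"
    using layer a(1) by (intro sum.cong refl) (simp add: nn_integral_multc)
  also have "\<dots> = (\<integral>\<^sup>+t. (\<Sum>S\<in>\<S>. \<phi> t * (ennreal t * indicator {..<a S} t) * mass w S) \<partial>lborel)"
    by (rule nn_integral_sum[symmetric]) measurable
  also have "\<dots> = (\<integral>\<^sup>+t. \<phi> t * (ennreal t * (\<Sum>S\<in>{S \<in> \<S>. t < a S}. mass w S)) \<partial>lborel)"
  proof (rule nn_integral_cong)
    fix t :: real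
    have "(\<Sum>S\<in>\<S>. \<phi> t * (ennreal t * indicator {..<a S} t) * mass w S)
        = \<phi> t * (ennreal t * (\<Sum>S\<in>\<S>. indicator {..<a S} t * mass w S))"
      by (simp add: sum_distrib_left mult_ac)
    also have "(\<Sum>S\<in>\<S>. indicator {..<a S} t * mass w S) = (\<Sum>S\<in>{S \<in> \<S>. t < a S}. mass w S)"
      using S(1) by (intro sum.mono_neutral_cong_right) (auto simp: indicator_def)
    finally show "(\<Sum>S\<in>\<S>. \<phi> t * (ennreal t * indicator {..<a S} t) * mass w S)
        = \<phi> t * (ennreal t * (\<Sum>S\<in>{S \<in> \<S>. t < a S}. mass w S))" .
  qed
  also have "\<dots> \<le> (\<integral>\<^sup>+t. \<phi> t * (ennreal (2 * A) *
      (\<integral>\<^sup>+x. ennreal (h x * w x) * indicator {x. t < 2 * h x} x \<partial>lebesgue)) \<partial>lborel)"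
  proof (rule nn_integral_mono)
    fix t :: real
    show "\<phi> t * (ennreal t * (\<Sum>S\<in>{S \<in> \<S>. t < a S}. mass w S)) \<le> \<phi> t * (ennreal (2 * A) *
      (\<integral>\<^sup>+x. ennreal (h x * w x) * indicator {x. t < 2 * h x} x \<partial>lebesgue))"
    proof (cases "0 < t")
      case True
      then show ?thesis
        by (intro mult_left_mono carleson_weak_type S w h C a A) auto
    qed (simp add: \<phi>_def)
  qed
  also have "\<dots> = ennreal (2 * A) * (\<integral>\<^sup>+t. (\<integral>\<^sup>+x. \<phi> t * (ennreal (h x * w x) * indicator {x. t < 2 * h x} x) \<partial>lebesgue) \<partial>lborel)"
  proof -
    have "\<phi> t * (ennreal (2 * A) * (\<integral>\<^sup>+x. ennreal (h x * w x) * indicator {x. t < 2 * h x} x \<partial>lebesgue))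
       = ennreal (2 * A) * (\<integral>\<^sup>+x. \<phi> t * (ennreal (h x * w x) * indicator {x. t < 2 * h x} x) \<partial>lebesgue)" for t
      by (subst nn_integral_cmult) (auto simp: mult_ac)
    then show ?thesis
      by (simp only:) (rule nn_integral_cmult, measurable)
  qed
  also have "(\<integral>\<^sup>+t. (\<integral>\<^sup>+x. \<phi> t * (ennreal (h x * w x) * indicator {x. t < 2 * h x} x) \<partial>lebesgue) \<partial>lborel)
      = (\<integral>\<^sup>+x. (\<integral>\<^sup>+t. \<phi> t * (ennreal (h x * w x) * indicator {x. t < 2 * h x} x) \<partial>lborel) \<partial>lebesgue)"
    by (rule LL.Fubini'[symmetric]) measurable
  also have "\<dots> = (\<integral>\<^sup>+x. ennreal (2 powr (p - 1) * (p / (p - 1))) * ennreal (h x powr p * w x) \<partial>lebesgue)"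
  proof (rule nn_integral_cong)
    fix x
    have "(\<integral>\<^sup>+t. \<phi> t * (ennreal (h x * w x) * indicator {x. t < 2 * h x} x) \<partial>lborel)
        = (\<integral>\<^sup>+t. ennreal (h x * w x) * (\<phi> t * indicator {t. t < 2 * h x} t) \<partial>lborel)"
      by (intro nn_integral_cong) (auto simp: indicator_def mult_ac)
    also have "\<dots> = ennreal (h x * w x) * ennreal (p / (p - 1) * (2 * h x) powr (p - 1))"
      using layer'[of "2 * h x"] h(2) by (subst nn_integral_cmult) auto
    also have "\<dots> = ennreal ((h x * w x) * (p / (p - 1) * (2 * h x) powr (p - 1)))"
      using h(2) w(2) p by (intro ennreal_mult[symmetric] mult_nonneg_nonneg) auto
    also have "(h x * w x) * (p / (p - 1) * (2 * h x) powr (p - 1))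
       = (2 powr (p - 1) * (p / (p - 1))) * (h x powr p * w x)"
    proof -
      have "h x powr p = h x powr (p - 1) * h x"
        using powr_add[of "h x" "p - 1" 1] h(2)[of x] by simp
      then show ?thesis
        using h(2)[of x] by (simp add: powr_mult mult_ac)
    qed
    also have "ennreal \<dots> = ennreal (2 powr (p - 1) * (p / (p - 1))) * ennreal (h x powr p * w x)"
      using h(2) w(2) p by (intro ennreal_mult mult_nonneg_nonneg) auto
    finally show "(\<integral>\<^sup>+t. \<phi> t * (ennreal (h x * w x) * indicator {x. t < 2 * h x} x) \<partial>lborel)
        = ennreal (2 powr (p - 1) * (p / (p - 1))) * ennreal (h x powr p * w x)" .
  qed
  also have "\<dots> = ennreal (2 powr (p - 1) * (p / (p - 1))) * (\<integral>\<^sup>+x. ennreal (h x powr p * w x) \<partial>lebesgue)"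
    by (rule nn_integral_cmult) measurable
  finally have "(\<Sum>S\<in>\<S>. ennreal (a S powr p) * mass w S)
     \<le> ennreal (2 * A) * (ennreal (2 powr (p - 1) * (p / (p - 1))) * (\<integral>\<^sup>+x. ennreal (h x powr p * w x) \<partial>lebesgue))" .
  also have "\<dots> = ennreal (2 * A * (2 powr (p - 1) * (p / (p - 1)))) * (\<integral>\<^sup>+x. ennreal (h x powr p * w x) \<partial>lebesgue)"
    using A p by (subst ennreal_mult) (auto simp: mult.assoc)
  also have "2 * A * (2 powr (p - 1) * (p / (p - 1))) = 2 powr p * (p / (p - 1)) * A"
    using p by (simp add: powr_diff field_simps)
  finally show ?thesis .
qed

text \<open>The mass of \<open>S\<close> is at most twice its average times the volume of its major
  subset, and on that subset the average is below the localised maximal function. The major subsets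
  being disjoint, the sum is at most twice the integral that \<open>A_inf\<close> compares with the
  mass of \<open>R\<close>.\<close>

lemma sparse_carleson:
  assumes "sparse \<S>" "R \<in> cubes D" and w: "\<And>S. S \<in> cubes D \<Longrightarrow> 0 < mass w S \<and> mass w S < \<infinity>"
    and A: "A_inf D w \<le> ennreal A"
  shows "(\<Sum>S\<in>{S \<in> \<S>. S \<subseteq> R}. mass w S) \<le> ennreal (2 * A) * mass w R"
proof -
  obtain E where E: "finite \<S>" "\<S> \<subseteq> cubes D" "disjoint_family_on E \<S>"
    "\<And>Q. Q \<in> \<S> \<Longrightarrow> E Q \<in> sets lebesgue \<and> E Q \<subseteq> Q \<and> vol Q \<le> 2 * vol (E Q)"
    using assms(1) unfolding sparse_def by blast
  define I where "I = {S \<in> \<S>. S \<subseteq> R}"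
  have I: "finite I" "I \<subseteq> \<S>" using E by (auto simp: I_def)
  let ?M = "\<lambda>x. SUP P\<in>{P \<in> cubes D. x \<in> P \<and> P \<subseteq> R}. wavg w P"
  have "mass w S \<le> 2 * (wavg w S * emeasure lebesgue (E S))" if "S \<in> I" for S
  proof -
    have S: "S \<in> \<S>" "S \<in> cubes D" using that I E(2) by auto
    have "E S \<in> lmeasurable"
      using E(4)[OF S(1)] lmeasurable_cube[OF S(2)] fmeasurableI2 by blast
    then have eE: "emeasure lebesgue (E S) = ennreal (vol (E S))"
      by (simp add: emeasure_eq_measure2)
    have "mass w S = wavg w S * emeasure lebesgue S"
      unfolding wavg_def emeasure_cube[OF S(2)] using vol_pos[OF S(2)]
      by (simp add: ennreal_divide_times)
    also have "\<dots> \<le> wavg w S * (2 * emeasure lebesgue (E S))"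
    proof (rule mult_left_mono)
      have "2 * ennreal (vol (E S)) = ennreal (2 * vol (E S))"
        by (simp add: ennreal_mult')
      then show "emeasure lebesgue S \<le> 2 * emeasure lebesgue (E S)"
        unfolding emeasure_cube[OF S(2)] eE using E(4)[OF S(1)] by (simp add: ennreal_leI)
    qed simp
    finally show ?thesis by (simp add: mult_ac)
  qed
  then have "(\<Sum>S\<in>I. mass w S) \<le> 2 * (\<Sum>S\<in>I. wavg w S * emeasure lebesgue (E S))"
    unfolding sum_distrib_left by (rule sum_mono)
  also have "(\<Sum>S\<in>I. wavg w S * emeasure lebesgue (E S)) = (\<Sum>S\<in>I. \<integral>\<^sup>+x. wavg w S * indicator (E S) x \<partial>lebesgue)"
    using E(4) I by (intro sum.cong refl nn_integral_cmult_indicator[symmetric]) auto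
  also have "\<dots> = (\<integral>\<^sup>+x. (\<Sum>S\<in>I. wavg w S * indicator (E S) x) \<partial>lebesgue)"
  proof (rule nn_integral_sum[symmetric])
    fix S assume "S \<in> I"
    then have [measurable]: "E S \<in> sets lebesgue" using E(4) I by auto
    show "(\<lambda>x. wavg w S * indicator (E S) x) \<in> borel_measurable lebesgue" by measurable
  qed
  also have "\<dots> \<le> (\<integral>\<^sup>+x\<in>R. ?M x \<partial>lebesgue)"
  proof (rule nn_integral_mono)
    fix x
    show "(\<Sum>S\<in>I. wavg w S * indicator (E S) x) \<le> ?M x * indicator R x"
    proof (cases "\<exists>S\<in>I. x \<in> E S")
      case True
      then obtain S where S: "S \<in> I" "x \<in> E S" by blast
      have "(\<Sum>S\<in>I. wavg w S * indicator (E S) x) = (\<Sum>S\<in>{S}. wavg w S * indicator (E S) x)"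
        using S I E(3) by (intro sum.mono_neutral_right) (auto simp: disjoint_family_on_def indicator_def)
      also have "\<dots> = wavg w S" using S by simp
      also have "\<dots> \<le> ?M x"
      proof (rule SUP_upper)
        have "S \<in> cubes D" "x \<in> S" "S \<subseteq> R"
          using S I E(2) E(4)[of S] by (auto simp: I_def)
        then show "S \<in> {P \<in> cubes D. x \<in> P \<and> P \<subseteq> R}" by simp
      qed
      also have "\<dots> = ?M x * indicator R x"
        using S E(4)[of S] by (auto simp: I_def)
      finally show ?thesis .
    next
      case False
      then have "(\<Sum>S\<in>I. wavg w S * indicator (E S) x) = 0"
        by (intro sum.neutral) (auto simp: indicator_def)
      then show ?thesis by simp
    qed
  qed
  also have "\<dots> \<le> ennreal A * mass w R"
  proof -
    let ?I = "\<integral>\<^sup>+x\<in>R. ?M x \<partial>lebesgue"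
    have "?I = (?I / mass w R) * mass w R"
    proof -
      have "mass w R / mass w R = 1"
        using w[OF assms(2)] by (intro ennreal_divide_self) auto
      then show ?thesis by (simp only: ennreal_divide_times mult_1_right)
    qed
    also have "?I / mass w R \<le> A_inf D w"
      unfolding A_inf_def by (rule SUP_upper[OF assms(2)])
    finally show ?thesis
      using A by (meson mult_right_mono order_trans zero_le)
  qed
  finally show ?thesis
    unfolding I_def by (simp add: ennreal_mult' mult.assoc mult_left_mono)
qed

end

section \<open>Unconditional convergence from bounded multipliers\<close>

lemma powr_strict_midpoint:
  fixes x y q :: real
  assumes "1 < q" "0 \<le> x" "x < y"
  shows "((x + y) / 2) powr q < (x powr q + y powr q) / 2"
proof -
  define m where "m = (x + y) / 2"
  have m: "x < m" "m < y" "y - m = m - x" "0 < m" using assms by (auto simp: m_def field_simps)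
  have d: "((\<lambda>t. t powr q) has_real_derivative q * t powr (q - 1)) (at t)" if "0 < t" for t
    using that by (auto intro!: derivative_eq_intros)
  have c: "continuous_on {a..b} (\<lambda>t. t powr q)" if "0 \<le> a" for a b
    using that assms(1) by (intro continuous_on_powr' continuous_intros) auto
  have mvt: "\<exists>z. a < z \<and> z < b \<and> b powr q - a powr q = (b - a) * (q * z powr (q - 1))"
    if "0 \<le> a" "a < b" for a b :: real
  proof -
    have "\<exists>l z. a < z \<and> z < b \<and> ((\<lambda>t. t powr q) has_real_derivative l) (at z)
        \<and> b powr q - a powr q = (b - a) * l"
      using that d by (intro MVT c) (auto simp: real_differentiable_def intro: order_le_less_trans)
    then show ?thesis
      using d that by (metis DERIV_unique le_less_trans)
  qed
  obtain u where u: "x < u" "u < m" "m powr q - x powr q = (m - x) * (q * u powr (q - 1))"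
    using mvt[OF assms(2) m(1)] by blast
  obtain v where v: "m < v" "v < y" "y powr q - m powr q = (y - m) * (q * v powr (q - 1))"
    using mvt[of m y] m by auto
  have "u powr (q - 1) < v powr (q - 1)"
    using u v assms by (intro powr_less_mono2) auto
  then have "(m - x) * (q * u powr (q - 1)) < (m - x) * (q * v powr (q - 1))"
    using m assms(1) by simp
  then have "m powr q - x powr q < y powr q - m powr q"
    using u v m by simp
  then show ?thesis by (simp add: m_def)
qed

text \<open>If the norms of \<open>a + b\<close> and \<open>a - b\<close> agree, the parallelogram
  law makes both larger than that of \<open>a\<close>. If they differ, the triangle inequality and
  strict convexity of the power give the strict sign.\<close>

lemma norm_powr_midpoint_less:
  fixes a b :: complex
  assumes "1 < q" "b \<noteq> 0"
  shows "norm a powr q < (norm (a + b) powr q + norm (a - b) powr q) / 2"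
proof (cases "norm (a + b) = norm (a - b)")
  case True
  have "(norm (a + b))\<^sup>2 + (norm (a - b))\<^sup>2 = 2 * (norm a)\<^sup>2 + 2 * (norm b)\<^sup>2"
    by (simp add: power2_norm_eq_inner inner_add_left inner_add_right inner_diff_left inner_diff_right)
  then have "(norm (a + b))\<^sup>2 = (norm a)\<^sup>2 + (norm b)\<^sup>2"
    using True by simp
  then have "(norm a)\<^sup>2 < (norm (a + b))\<^sup>2"
    using assms(2) by simp
  then have "norm a < norm (a + b)"
    by (rule power2_less_imp_less) simp
  then have "norm a powr q < norm (a + b) powr q"
    using assms(1) by (intro powr_less_mono2) auto
  then show ?thesis using True by simp
next
  case False
  have "a = ((a + b) + (a - b)) / 2" by simp
  then have "norm a \<le> (norm (a + b) + norm (a - b)) / 2"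
    by (metis norm_divide norm_numeral divide_right_mono norm_triangle_ineq zero_le_numeral)
  then have "norm a powr q \<le> ((norm (a + b) + norm (a - b)) / 2) powr q"
    using assms(1) by (intro powr_mono2) auto
  also have "\<dots> < (norm (a + b) powr q + norm (a - b) powr q) / 2"
    using powr_strict_midpoint[OF assms(1), of "norm (a + b)" "norm (a - b)"]
      powr_strict_midpoint[OF assms(1), of "norm (a - b)" "norm (a + b)"] False
    by (cases "norm (a + b) < norm (a - b)") (auto simp: add.commute)
  finally show ?thesis .
qed

text \<open>Uniform convexity, with a constant obtained by compactness and homogeneity.\<close>

lemma norm_powr_uniform_convexity:
  assumes q: "1 < q" and \<tau>: "0 < \<tau>"
  obtains C :: real where "0 < C" "\<And>a b :: complex. norm b powr q + C * norm a powr q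
      \<le> \<tau> * norm a powr q + C * ((norm (a + b) powr q + norm (a - b) powr q) / 2)"
proof -
  define \<psi> :: "complex \<times> complex \<Rightarrow> real" where
    "\<psi> = (\<lambda>(a, b). (norm (a + b) powr q + norm (a - b) powr q) / 2 - norm a powr q)"
  \<comment> \<open>Separates the two regimes: if \<open>norm a\<close> exceeds
    \<open>\<rho> * norm b\<close>, the term with \<tau> alone dominates. Otherwise dividing both by
    \<open>norm b\<close> lands in the compact set \<open>K\<close>, where \<psi> has a positive
    minimum, the inverse of the constant.\<close>
  define \<rho> where "\<rho> = \<tau> powr (- (1 / q))"
  have "\<rho> powr q = \<tau> powr (- 1)"
    using q by (simp add: \<rho>_def powr_powr)
  then have \<rho>: "0 < \<rho>" "\<rho> powr q = 1 / \<tau>"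
    using \<tau> by (auto simp: \<rho>_def powr_minus_divide)
  define K :: "(complex \<times> complex) set" where "K = cball 0 \<rho> \<times> sphere 0 1"
  have "compact K" unfolding K_def by (intro compact_Times compact_cball compact_sphere)
  moreover have "(0, 1) \<in> K" using \<rho> by (simp add: K_def)
  moreover have "continuous_on K \<psi>"
    unfolding \<psi>_def case_prod_beta using q
    by (intro continuous_on_diff continuous_on_divide continuous_on_add continuous_on_powr'
          continuous_intros) auto
  ultimately obtain z where z: "z \<in> K" "\<And>y. y \<in> K \<Longrightarrow> \<psi> z \<le> \<psi> y"
    using continuous_attains_inf[of K \<psi>] by blast
  have "snd z \<noteq> 0" using z(1) by (auto simp: K_def)
  then have m: "0 < \<psi> z"
    using norm_powr_midpoint_less[OF q, of "snd z" "fst z"] by (auto simp: \<psi>_def case_prod_beta)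
  have \<psi>: "0 \<le> \<psi> (a, b)" for a b
    using norm_powr_midpoint_less[OF q, of b a] by (cases "b = 0") (auto simp: \<psi>_def)
  show ?thesis
  proof
    show "0 < 1 / \<psi> z" using m by simp
    fix a b :: complex
    have "norm b powr q \<le> \<tau> * norm a powr q + (1 / \<psi> z) * \<psi> (a, b)"
    proof (cases "b = 0")
      case True
      then show ?thesis using \<tau> \<psi>[of a b] m q by simp
    next
      case False
      show ?thesis
      proof (cases "norm a > \<rho> * norm b")
        case True
        then have "norm b < norm a / \<rho>"
          using \<rho> by (simp add: field_simps)
        then have "norm b powr q \<le> (norm a / \<rho>) powr q"
          using q by (intro powr_mono2) auto
        also have "\<dots> = \<tau> * norm a powr q"
          using \<rho> by (simp add: powr_divide)
        finally show ?thesis using \<psi>[of a b] m by (simp add: add_increasing2)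
      next
        case le: False
        define t where "t = norm b"
        have t: "0 < t" using False by (simp add: t_def)
        have "(a / of_real t, b / of_real t) \<in> K"
          using le t False by (auto simp: K_def t_def norm_divide field_simps)
        then have "\<psi> z \<le> \<psi> (a / of_real t, b / of_real t)" by (rule z(2))
        also have "\<dots> = \<psi> (a, b) / t powr q"
        proof -
          have "a / of_real t + b / of_real t = (a + b) / of_real t"
            "a / of_real t - b / of_real t = (a - b) / of_real t"
            by (simp_all add: add_divide_distrib diff_divide_distrib)
          then show ?thesis
            using t by (simp add: \<psi>_def norm_divide powr_divide field_simps)
        qed
        finally have "t powr q * \<psi> z \<le> \<psi> (a, b)"
          using t by (simp add: field_simps)
        then have "t powr q \<le> (1 / \<psi> z) * \<psi> (a, b)"
          using m by (simp add: field_simps)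
        then show ?thesis
          using \<tau> by (simp add: t_def add_increasing)
      qed
    qed
    moreover have "\<psi> (a, b) = (norm (a + b) powr q + norm (a - b) powr q) / 2 - norm a powr q"
      by (simp add: \<psi>_def)
    ultimately show "norm b powr q + 1 / \<psi> z * norm a powr q
      \<le> \<tau> * norm a powr q + 1 / \<psi> z * ((norm (a + b) powr q + norm (a - b) powr q) / 2)"
      by (simp only: right_diff_distrib)
  qed
qed

abbreviation nn_powr :: "'a measure \<Rightarrow> real \<Rightarrow> ('a \<Rightarrow> complex) \<Rightarrow> ennreal" where
  "nn_powr M q g \<equiv> \<integral>\<^sup>+x. ennreal (norm (g x) powr q) \<partial>M"

text \<open>Choose a multiplier sum \<open>a\<close> that almost attains the supremum
  \<open>s\<close>. For a sum \<open>b\<close> over a disjoint index set, \<open>a + b\<close> and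
  \<open>a - b\<close> are again admissible and cannot exceed \<open>s\<close>, so uniform convexity
  forces \<open>b\<close> to be small.\<close>

lemma bounded_multipliers_tail:
  fixes F :: "'i \<Rightarrow> 'a \<Rightarrow> complex"
  assumes q: "1 < q" and F: "\<And>i. i \<in> A \<Longrightarrow> F i \<in> borel_measurable M"
    and bound: "\<And>X \<theta>. finite X \<Longrightarrow> X \<subseteq> A \<Longrightarrow> (\<And>i. \<bar>\<theta> i\<bar> \<le> 1) \<Longrightarrow>
       nn_powr M q (\<lambda>x. \<Sum>i\<in>X. of_real (\<theta> i) * F i x) \<le> ennreal K"
    and \<epsilon>: "0 < \<epsilon>"
  shows "\<exists>X0. finite X0 \<and> X0 \<subseteq> A \<and> (\<forall>Z \<theta>. finite Z \<longrightarrow> Z \<subseteq> A \<longrightarrow> Z \<inter> X0 = {} \<longrightarrow> (\<forall>i. \<bar>\<theta> i\<bar> \<le> 1) \<longrightarrow>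
       nn_powr M q (\<lambda>x. \<Sum>i\<in>Z. of_real (\<theta> i) * F i x) \<le> ennreal \<epsilon>)"
proof -
  define V where "V = (\<lambda>X \<theta>. nn_powr M q (\<lambda>x. \<Sum>i\<in>X. complex_of_real (\<theta> i) * F i x))"
  define P where "P = {(X, \<theta> :: 'i \<Rightarrow> real). finite X \<and> X \<subseteq> A \<and> (\<forall>i. \<bar>\<theta> i\<bar> \<le> 1)}"
  have meas: "(\<lambda>x. \<Sum>i\<in>X. complex_of_real (\<theta> i) * F i x) \<in> borel_measurable M" if "X \<subseteq> A" for X \<theta>
    using F that by (intro borel_measurable_sum borel_measurable_times borel_measurable_const) auto
  define W where "W = (\<lambda>X \<theta>. enn2real (V X \<theta>))"
  have V: "V X \<theta> \<le> ennreal K" if "(X, \<theta>) \<in> P" for X \<theta>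
    using bound that by (auto simp: P_def V_def)
  have VW: "V X \<theta> = ennreal (W X \<theta>)" if "(X, \<theta>) \<in> P" for X \<theta>
    unfolding W_def using V[OF that] by (metis ennreal_enn2real ennreal_less_top le_less_trans)
  have W0: "0 \<le> W X \<theta>" for X \<theta> by (simp add: W_def)
  have WK: "W X \<theta> \<le> max K 0" if "(X, \<theta>) \<in> P" for X \<theta>
    using V[OF that] W0[of X \<theta>] unfolding VW[OF that] by (metis ennreal_le_iff2 max.coboundedI1 max.coboundedI2)
  define s where "s = (SUP (X, \<theta>)\<in>P. W X \<theta>)"
  have bdd: "bdd_above ((\<lambda>(X, \<theta>). W X \<theta>) ` P)"
    using WK by (auto intro!: bdd_aboveI[of _ "max K 0"])
  have P0: "({}, \<lambda>_. 0) \<in> P" by (simp add: P_def)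
  have Ws: "W X \<theta> \<le> s" if "(X, \<theta>) \<in> P" for X \<theta>
    unfolding s_def using cSUP_upper[OF that bdd] by simp
  have s0: "0 \<le> s" using Ws[OF P0] W0 order_trans by blast
  \<comment> \<open>Makes the error term \<open>\<tau> * s\<close> at most
    \<open>\<epsilon> / 2\<close>; adding 1 to \<open>s\<close> covers the case
    \<open>s = 0\<close>.\<close>
  define \<tau> where "\<tau> = \<epsilon> / (2 * (s + 1))"
  have \<tau>: "0 < \<tau>" "\<tau> * s \<le> \<epsilon> / 2"
    using s0 \<epsilon> by (auto simp: \<tau>_def field_simps)
  obtain C :: real where C: "0 < C" "\<And>a b :: complex. norm b powr q + C * norm a powr q
      \<le> \<tau> * norm a powr q + C * ((norm (a + b) powr q + norm (a - b) powr q) / 2)"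
    using norm_powr_uniform_convexity[OF q \<tau>(1)] by blast
  have "s - \<epsilon> / (2 * C) < s" using C \<epsilon> by simp
  then have "\<exists>z\<in>P. s - \<epsilon> / (2 * C) < (case z of (X, \<theta>) \<Rightarrow> W X \<theta>)"
    unfolding s_def using less_cSUP_iff[THEN iffD1, OF _ bdd] P0 by blast
  then obtain X0 \<theta>0 where X0: "(X0, \<theta>0) \<in> P" "s - \<epsilon> / (2 * C) < W X0 \<theta>0"
    by auto
  have "V Z \<theta> \<le> ennreal \<epsilon>" if Z: "finite Z" "Z \<subseteq> A" "Z \<inter> X0 = {}" "\<forall>i. \<bar>\<theta> i\<bar> \<le> 1" for Z \<theta>
  proof -
    have ZP: "(Z, \<theta>) \<in> P" using Z by (simp add: P_def)
    \<comment> \<open>With \<open>t\<close> equal to 1 or -1 these multipliers produce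
      \<open>a + b\<close> and \<open>a - b\<close> on the union of the two index sets.\<close>
    define \<theta>' where "\<theta>' = (\<lambda>t i. if i \<in> X0 then \<theta>0 i else t * \<theta> i)"
    have P': "(X0 \<union> Z, \<theta>' t) \<in> P" if "t = 1 \<or> t = -1" for t
      using that X0(1) Z by (auto simp: P_def \<theta>'_def)
    let ?a = "\<lambda>x. \<Sum>i\<in>X0. complex_of_real (\<theta>0 i) * F i x"
    let ?b = "\<lambda>x. \<Sum>i\<in>Z. complex_of_real (\<theta> i) * F i x"
    have XA: "finite X0" "X0 \<subseteq> A" using X0 by (auto simp: P_def)
    have split: "(\<Sum>i\<in>X0 \<union> Z. complex_of_real (\<theta>' t i) * F i x) = ?a x + complex_of_real t * ?b x" for t x
    proof -
      have "(\<Sum>i\<in>X0 \<union> Z. complex_of_real (\<theta>' t i) * F i x)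
        = (\<Sum>i\<in>X0. complex_of_real (\<theta>' t i) * F i x) + (\<Sum>i\<in>Z. complex_of_real (\<theta>' t i) * F i x)"
        by (rule sum.union_disjoint) (use XA Z in auto)
      also have "(\<Sum>i\<in>X0. complex_of_real (\<theta>' t i) * F i x) = ?a x"
        by (intro sum.cong) (auto simp: \<theta>'_def)
      also have "(\<Sum>i\<in>Z. complex_of_real (\<theta>' t i) * F i x) = complex_of_real t * ?b x"
        unfolding sum_distrib_left using Z(3) by (intro sum.cong) (auto simp: \<theta>'_def)
      finally show ?thesis .
    qed
    have [measurable]: "?a \<in> borel_measurable M" "?b \<in> borel_measurable M"
      using meas XA Z by auto
    define c2 where "c2 = C / 2"
    have c2: "0 < c2" using C(1) by (simp add: c2_def)
    have "V Z \<theta> + ennreal C * V X0 \<theta>0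
        = (\<integral>\<^sup>+x. ennreal (norm (?b x) powr q + C * norm (?a x) powr q) \<partial>M)"
      unfolding V_def using C(1) by (simp add: nn_integral_add nn_integral_cmult ennreal_mult)
    also have "\<dots> \<le> (\<integral>\<^sup>+x. ennreal (\<tau> * norm (?a x) powr q
          + c2 * (norm (?a x + ?b x) powr q + norm (?a x - ?b x) powr q)) \<partial>M)"
    proof (intro nn_integral_mono ennreal_leI)
      fix x
      show "norm (?b x) powr q + C * norm (?a x) powr q \<le> \<tau> * norm (?a x) powr q
          + c2 * (norm (?a x + ?b x) powr q + norm (?a x - ?b x) powr q)"
        using C(2)[of "?b x" "?a x"] by (simp add: c2_def)
    qed
    also have "\<dots> = ennreal \<tau> * V X0 \<theta>0 + ennreal c2 * (V (X0 \<union> Z) (\<theta>' 1) + V (X0 \<union> Z) (\<theta>' (-1)))"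
      unfolding V_def split using c2 \<tau>(1)
      by (simp add: nn_integral_add nn_integral_cmult ennreal_mult)
    finally have "W Z \<theta> + C * W X0 \<theta>0 \<le> \<tau> * W X0 \<theta>0 + c2 * (W (X0 \<union> Z) (\<theta>' 1) + W (X0 \<union> Z) (\<theta>' (-1)))"
      unfolding VW[OF ZP] VW[OF X0(1)] VW[OF P'[OF disjI1[OF refl]]] VW[OF P'[OF disjI2[OF refl]]]
      using C(1) c2 \<tau>(1) W0 by (simp flip: ennreal_mult ennreal_plus)
    also have "\<dots> \<le> \<tau> * s + c2 * (s + s)"
      using Ws X0(1) P' c2 \<tau>(1) by (intro add_mono mult_left_mono) auto
    finally have "W Z \<theta> \<le> \<epsilon> / 2 + C * (s - W X0 \<theta>0)"
      using \<tau>(2) by (simp add: algebra_simps c2_def)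
    also have "C * (s - W X0 \<theta>0) \<le> C * (\<epsilon> / (2 * C))"
      using X0(2) C(1) by (intro mult_left_mono) auto
    also have "\<dots> = \<epsilon> / 2" using C(1) by simp
    finally show ?thesis
      unfolding VW[OF ZP] by (simp add: ennreal_leI)
  qed
  then show ?thesis
    using X0(1) unfolding V_def P_def by blast
qed

text \<open>Completeness in the style of Riesz and Fischer: a rapidly chosen sequence of partial
  sums converges almost everywhere, and Fatou's lemma transfers to the limit both the bound and the
  closeness of the finite sums.\<close>

lemma bounded_multipliers_sum:
  fixes F :: "'i \<Rightarrow> 'a \<Rightarrow> complex"
  assumes q: "1 < q" and F: "\<And>i. i \<in> A \<Longrightarrow> F i \<in> borel_measurable M"
    and bound: "\<And>X \<theta>. finite X \<Longrightarrow> X \<subseteq> A \<Longrightarrow> (\<And>i. \<bar>\<theta> i\<bar> \<le> 1) \<Longrightarrow>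
       nn_powr M q (\<lambda>x. \<Sum>i\<in>X. of_real (\<theta> i) * F i x) \<le> ennreal K"
  shows "\<exists>g\<in>borel_measurable M. nn_powr M q g \<le> ennreal K \<and>
     ((\<lambda>X. nn_powr M q (\<lambda>x. (\<Sum>i\<in>X. F i x) - g x)) \<longlongrightarrow> 0) (finite_subsets_at_top A)"
proof -
  \<comment> \<open>Consecutive partial sums will differ by at most 4 to the power -n in norm, so
    the sum still converges after weighting by 2 to the power n.\<close>
  define \<epsilon> :: "nat \<Rightarrow> real" where "\<epsilon> n = ((1 / 4) ^ n) powr q" for n
  have \<epsilon>: "0 < \<epsilon> n" for n by (simp add: \<epsilon>_def)
  have "\<forall>n. \<exists>X0. finite X0 \<and> X0 \<subseteq> A \<and> (\<forall>Z \<theta>. finite Z \<longrightarrow> Z \<subseteq> A \<longrightarrow> Z \<inter> X0 = {} \<longrightarrow> (\<forall>i. \<bar>\<theta> i\<bar> \<le> 1) \<longrightarrow>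
       nn_powr M q (\<lambda>x. \<Sum>i\<in>Z. of_real (\<theta> i) * F i x) \<le> ennreal (\<epsilon> n))"
    by (intro allI bounded_multipliers_tail[where K=K] q F bound \<epsilon>)
  from choice[OF this] obtain Y where Y0: "\<forall>n. finite (Y n) \<and> Y n \<subseteq> A \<and> (\<forall>Z \<theta>. finite Z \<longrightarrow> Z \<subseteq> A \<longrightarrow> Z \<inter> Y n = {} \<longrightarrow> (\<forall>i. \<bar>\<theta> i\<bar> \<le> 1) \<longrightarrow>
       nn_powr M q (\<lambda>x. \<Sum>i\<in>Z. of_real (\<theta> i) * F i x) \<le> ennreal (\<epsilon> n))"
    by (rule exE)
  have Y: "\<And>n. finite (Y n)" "\<And>n. Y n \<subseteq> A"
    "\<And>n Z \<theta>. finite Z \<Longrightarrow> Z \<subseteq> A \<Longrightarrow> Z \<inter> Y n = {} \<Longrightarrow> (\<And>i. \<bar>\<theta> i\<bar> \<le> 1) \<Longrightarrow>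
       nn_powr M q (\<lambda>x. \<Sum>i\<in>Z. of_real (\<theta> i) * F i x) \<le> ennreal (\<epsilon> n)"
    using Y0 by simp_all
  define X where "X n = (\<Union>m\<le>n. Y m)" for n
  have X: "finite (X n)" "X n \<subseteq> A" "Y n \<subseteq> X n" for n
    using Y by (auto simp: X_def)
  have Xmono: "X m \<subseteq> X n" if "m \<le> n" for m n
    using that by (fastforce simp: X_def)
  define S where "S n x = (\<Sum>i\<in>X n. F i x)" for n x
  have meas: "(\<lambda>x. \<Sum>i\<in>Z. F i x) \<in> borel_measurable M" if "Z \<subseteq> A" for Z
    using F that by (intro borel_measurable_sum) auto
  have S_meas [measurable]: "S n \<in> borel_measurable M" for n
    unfolding S_def using meas X by simp
  have near: "nn_powr M q (\<lambda>x. (\<Sum>i\<in>Z. F i x) - S m x) \<le> ennreal (\<epsilon> n)"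
    if Z: "finite Z" "Z \<subseteq> A" "X n \<subseteq> Z" and "n \<le> m" for Z n m
  proof -
    \<comment> \<open>The difference of two partial sums that contain \<open>X n\<close> is a sum
      outside \<open>X n\<close> with multipliers 1, 0 and -1. This is where the tail estimate needs
      signs.\<close>
    define \<theta> where "\<theta> = (\<lambda>i. (if i \<in> Z then 1 else 0) - (if i \<in> X m then 1 else 0 :: real))"
    let ?U = "(Z \<union> X m) - X n"
    have "(\<Sum>i\<in>Z. F i x) - S m x = (\<Sum>i\<in>?U. of_real (\<theta> i) * F i x)" for x
    proof -
      have "(\<Sum>i\<in>?U. of_real (\<theta> i) * F i x) = (\<Sum>i\<in>Z \<union> X m. of_real (\<theta> i) * F i x)"
        using Z X Xmono[OF \<open>n \<le> m\<close>] by (intro sum.mono_neutral_left) (auto simp: \<theta>_def)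
      also have "\<dots> = (\<Sum>i\<in>Z \<union> X m. if i \<in> Z then F i x else 0) - (\<Sum>i\<in>Z \<union> X m. if i \<in> X m then F i x else 0)"
        by (simp add: \<theta>_def algebra_simps if_distrib sum_subtractf flip: sum_subtractf) (auto intro: sum.cong)
      also have "(\<Sum>i\<in>Z \<union> X m. if i \<in> Z then F i x else 0) = (\<Sum>i\<in>Z. F i x)"
        using Z X by (intro sum.mono_neutral_cong_right) auto
      also have "(\<Sum>i\<in>Z \<union> X m. if i \<in> X m then F i x else 0) = S m x"
        unfolding S_def using Z X by (intro sum.mono_neutral_cong_right) auto
      finally show ?thesis by simp
    qed
    moreover have "nn_powr M q (\<lambda>x. \<Sum>i\<in>?U. of_real (\<theta> i) * F i x) \<le> ennreal (\<epsilon> n)"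
    proof (rule Y(3))
      show "?U \<subseteq> A" "?U \<inter> Y n = {}"
        using Z(2) X(2)[of m] X(3)[of n] by blast+
    qed (use Z(1) X(1) in \<open>auto simp: \<theta>_def\<close>)
    ultimately show ?thesis by simp
  qed
  \<comment> \<open>Integrating the sum of these powers makes the weighted increments tend to 0
    almost everywhere, hence the increments decay geometrically. No triangle inequality for the norm
    is involved.\<close>
  have "(\<integral>\<^sup>+x. (\<Sum>n. ennreal ((2 ^ n * norm (S (Suc n) x - S n x)) powr q)) \<partial>M)
      = (\<Sum>n. \<integral>\<^sup>+x. ennreal ((2 ^ n * norm (S (Suc n) x - S n x)) powr q) \<partial>M)"
    by (rule nn_integral_suminf) measurable
  also have "\<dots> \<le> (\<Sum>n. ennreal (((1 / 2) powr q) ^ n))"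
  proof (intro suminf_le)
    fix n
    have "(\<integral>\<^sup>+x. ennreal ((2 ^ n * norm (S (Suc n) x - S n x)) powr q) \<partial>M)
       = ennreal ((2 ^ n) powr q) * nn_powr M q (\<lambda>x. (\<Sum>i\<in>X (Suc n). F i x) - S n x)"
      by (simp add: powr_mult ennreal_mult nn_integral_cmult S_def[of "Suc n"] flip: S_def[of n])
         (simp add: nn_integral_cmult flip: S_def)
    also have "\<dots> \<le> ennreal ((2 ^ n) powr q) * ennreal (\<epsilon> n)"
      using near[of "X (Suc n)" n n] X Xmono[of n "Suc n"] by (intro mult_left_mono) auto
    also have "\<dots> = ennreal (((1 / 2) powr q) ^ n)"
    proof -
      have "(2 ^ n) powr q * \<epsilon> n = (2 ^ n * (1 / 4) ^ n) powr q"
        by (simp add: \<epsilon>_def powr_mult)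
      also have "(2::real) ^ n * (1 / 4) ^ n = (1 / 2) ^ n"
        by (simp flip: power_mult_distrib)
      also have "((1 / 2 :: real) ^ n) powr q = ((1 / 2) powr q) ^ n"
        by (simp add: powr_powr powr_realpow[symmetric] mult.commute)
      finally show ?thesis by (metis ennreal_mult' powr_ge_zero)
    qed
    finally show "(\<integral>\<^sup>+x. ennreal ((2 ^ n * norm (S (Suc n) x - S n x)) powr q) \<partial>M) \<le> \<dots>" .
  qed auto
  also have "\<dots> < \<infinity>"
  proof -
    have "(1 / 2 :: real) powr q < 1"
      using q powr_less_mono2[of q "1 / 2" 1] by simp
    then have "summable (\<lambda>n. ((1 / 2 :: real) powr q) ^ n)"
      by (intro summable_geometric) simp
    then show ?thesis by (simp add: suminf_ennreal2 less_top)
  qed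
  finally have "AE x in M. (\<Sum>n. ennreal ((2 ^ n * norm (S (Suc n) x - S n x)) powr q)) \<noteq> \<infinity>"
    by (intro nn_integral_PInf_AE) (auto simp: less_top)
  then have conv: "AE x in M. convergent (\<lambda>n. S n x)"
  proof eventually_elim
    case (elim x)
    define a where "a n = (2 ^ n * norm (S (Suc n) x - S n x)) powr q" for n
    have "summable a"
      using elim by (intro summable_suminf_not_top) (auto simp: a_def)
    then have "a \<longlonglongrightarrow> 0" by (rule summable_LIMSEQ_zero)
    then have "eventually (\<lambda>n. a n < 1) sequentially"
      by (rule order_tendstoD) simp
    then have ev: "eventually (\<lambda>n. norm (norm (S (Suc n) x - S n x)) \<le> (1 / 2) ^ n) sequentially"
    proof eventually_elim
      case (elim n)
      have "2 ^ n * norm (S (Suc n) x - S n x) \<le> 1"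
      proof (rule ccontr)
        assume "\<not> ?thesis"
        then have "1 \<le> a n"
          unfolding a_def using q by (intro ge_one_powr_ge_zero) auto
        then show False using elim by simp
      qed
      then show ?case by (simp add: field_simps)
    qed
    have "summable (\<lambda>n. norm (S (Suc n) x - S n x))"
      by (rule summable_comparison_test_ev[OF ev]) (simp add: summable_geometric)
    then have "summable (\<lambda>n. S (Suc n) x - S n x)"
      by (rule summable_norm_cancel)
    then have "convergent (\<lambda>n. \<Sum>k<n. S (Suc k) x - S k x)"
      by (simp add: summable_iff_convergent)
    then have "convergent (\<lambda>n. S n x - S 0 x)"
      by (simp add: sum_lessThan_telescope[of "\<lambda>n. S n x"])
    then have "convergent (\<lambda>n. S 0 x + (S n x - S 0 x))"
      by (intro convergent_add convergent_const)
    then show ?case by simp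
  qed
  \<comment> \<open>Where the sequence diverges, \<open>lim\<close> is an unspecified value; this
    concerns only a null set.\<close>
  define g where "g x = lim (\<lambda>n. S n x)" for x
  have g_meas [measurable]: "g \<in> borel_measurable M"
    unfolding g_def by measurable
  \<comment> \<open>Used twice: with \<open>h = 0\<close> for the bound on \<open>g\<close>, and
    with \<open>h\<close> a finite partial sum for the convergence.\<close>
  have fatou: "nn_powr M q (\<lambda>x. h x - g x) \<le> ennreal B"
    if h: "h \<in> borel_measurable M"
      and B: "eventually (\<lambda>m. nn_powr M q (\<lambda>x. h x - S m x) \<le> ennreal B) sequentially" for h B
  proof -
    have "nn_powr M q (\<lambda>x. h x - g x) = (\<integral>\<^sup>+x. liminf (\<lambda>m. ennreal (norm (h x - S m x) powr q)) \<partial>M)"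
    proof (rule nn_integral_cong_AE, use conv in eventually_elim)
      case (elim x)
      then have "(\<lambda>m. S m x) \<longlonglongrightarrow> g x"
        by (simp add: g_def convergent_LIMSEQ_iff)
      then have "(\<lambda>m. ennreal (norm (h x - S m x) powr q)) \<longlonglongrightarrow> ennreal (norm (h x - g x) powr q)"
        using q by (intro tendsto_ennrealI tendsto_powr2 tendsto_intros) auto
      then show ?case by (rule lim_imp_Liminf[OF sequentially_bot, symmetric])
    qed
    also have "\<dots> \<le> liminf (\<lambda>m. nn_powr M q (\<lambda>x. h x - S m x))"
    proof (rule nn_integral_liminf)
      show "(\<lambda>x. ennreal (norm (h x - S m x) powr q)) \<in> borel_measurable M" for m
        using h S_meas[of m] by simp
    qed
    also have "\<dots> \<le> limsup (\<lambda>m. nn_powr M q (\<lambda>x. h x - S m x))"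
      by (intro Liminf_le_Limsup) simp
    also have "\<dots> \<le> ennreal B"
      using B by (rule Limsup_bounded)
    finally show ?thesis .
  qed
  have "nn_powr M q (\<lambda>x. 0 - g x) \<le> ennreal K"
  proof (rule fatou)
    have "nn_powr M q (S m) \<le> ennreal K" for m
      using bound[of "X m" "\<lambda>_. 1"] X by (simp add: S_def[abs_def])
    then show "eventually (\<lambda>m. nn_powr M q (\<lambda>x. 0 - S m x) \<le> ennreal K) sequentially"
      by simp
  qed simp
  then have "nn_powr M q g \<le> ennreal K" by simp
  moreover have "((\<lambda>X. nn_powr M q (\<lambda>x. (\<Sum>i\<in>X. F i x) - g x)) \<longlongrightarrow> 0) (finite_subsets_at_top A)"
  proof (rule order_tendstoI)
    fix a :: ennreal assume "0 < a"
    have "(\<lambda>n. (1 / 4 :: real) ^ n) \<longlonglongrightarrow> 0"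
      by (rule LIMSEQ_realpow_zero) auto
    then have "(\<lambda>n. ((1 / 4 :: real) ^ n) powr q) \<longlonglongrightarrow> 0 powr q"
      using q by (intro tendsto_powr2 tendsto_const) auto
    then have "(\<lambda>n. ennreal (\<epsilon> n)) \<longlonglongrightarrow> ennreal 0"
      unfolding \<epsilon>_def using q by (intro tendsto_ennrealI) simp
    then have "eventually (\<lambda>n. ennreal (\<epsilon> n) < a) sequentially"
      using \<open>0 < a\<close> by (intro order_tendstoD) auto
    then obtain n where n: "ennreal (\<epsilon> n) < a"
      by (auto simp: eventually_sequentially)
    show "eventually (\<lambda>X. nn_powr M q (\<lambda>x. (\<Sum>i\<in>X. F i x) - g x) < a) (finite_subsets_at_top A)"
      unfolding eventually_finite_subsets_at_top
    proof (intro exI conjI allI impI)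
      fix Z assume Z: "finite Z \<and> X n \<subseteq> Z \<and> Z \<subseteq> A"
      have "eventually (\<lambda>m. nn_powr M q (\<lambda>x. (\<Sum>i\<in>Z. F i x) - S m x) \<le> ennreal (\<epsilon> n)) sequentially"
        using eventually_ge_at_top[of n] by eventually_elim (use near Z in blast)
      then have "nn_powr M q (\<lambda>x. (\<Sum>i\<in>Z. F i x) - g x) \<le> ennreal (\<epsilon> n)"
        using Z by (intro fatou meas) auto
      then show "nn_powr M q (\<lambda>x. (\<Sum>i\<in>Z. F i x) - g x) < a"
        using n by simp
    qed (use X in auto)
  qed simp
  ultimately show ?thesis using g_meas by blast
qed

section \<open>The A-infinity property\<close>

lemma young_2:
  fixes x y a b :: real
  assumes "0 \<le> x" "0 \<le> y" "0 < a" "0 < b" "a + b = 1"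
  shows "x powr a * y powr b \<le> a * x + b * y"
proof (cases "x = 0 \<or> y = 0")
  case True
  then show ?thesis using assms by auto
next
  case False
  then show ?thesis using assms by (intro Youngs_inequality_0) auto
qed

lemma young_3:
  fixes x y z a b c :: real
  assumes "0 \<le> x" "0 \<le> y" "0 \<le> z" "0 < a" "0 < b" "0 < c" "a + b + c = 1"
  shows "x powr a * y powr b * z powr c \<le> a * x + b * y + c * z"
proof -
  define s where "s = b + c"
  have s: "0 < s" using assms by (simp add: s_def)
  define t where "t = y powr (b / s) * z powr (c / s)"
  have "t powr s = y powr b * z powr c"
    using s by (simp add: t_def powr_mult powr_powr)
  then have "x powr a * y powr b * z powr c = x powr a * t powr s"
    by simp
  also have "\<dots> \<le> a * x + s * t"
    using assms s by (intro young_2) (auto simp: s_def t_def)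
  also have "t \<le> b / s * y + c / s * z"
    unfolding t_def
  proof (rule young_2)
    show "b / s + c / s = 1"
      using s by (simp add: s_def flip: add_divide_distrib)
  qed (use assms s in auto)
  then have "s * t \<le> b * y + c * z"
    using s by (simp add: field_simps)
  finally show ?thesis by simp
qed

section \<open>Measurability and masses of weights\<close>

lemma locally_integrable_measurable:
  fixes f :: "real^'n \<Rightarrow> 'b::{banach, second_countable_topology}"
  assumes "locally_integrable f"
  shows "f \<in> borel_measurable lebesgue"
proof (rule borel_measurable_LIMSEQ_metric)
  fix n :: nat
  have "set_integrable lebesgue (cball 0 (real n)) f"
    using assms by (simp add: locally_integrable_def)
  then show "(\<lambda>x. indicator (cball 0 (real n)) x *\<^sub>R f x) \<in> borel_measurable lebesgue"
    unfolding set_integrable_def by (rule borel_measurable_integrable)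
next
  fix x :: "real^'n"
  obtain N where N: "norm x \<le> real N" using real_arch_simple by blast
  have "eventually (\<lambda>n. indicator (cball 0 (real n)) x *\<^sub>R f x = f x) sequentially"
    using eventually_ge_at_top[of N]
  proof eventually_elim
    case (elim n)
    then have "norm x \<le> real n" using N by linarith
    then show ?case by (simp add: dist_norm)
  qed
  then show "(\<lambda>n. indicator (cball 0 (real n)) x *\<^sub>R f x) \<longlonglongrightarrow> f x"
    by (rule tendsto_eventually)
qed

lemma mass_mono: "A \<subseteq> B \<Longrightarrow> mass w A \<le> mass w B"
  unfolding mass_def by (intro nn_integral_mono) (auto simp: indicator_def)

lemma mass_pos:
  assumes "w \<in> borel_measurable lebesgue" "\<And>x. 0 < w x" "E \<in> sets lebesgue" "0 < emeasure lebesgue E"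
  shows "0 < mass w E"
proof (rule ccontr)
  note [measurable] = assms(1,3)
  assume "\<not> 0 < mass w E"
  then have "(\<integral>\<^sup>+x. ennreal (w x) * indicator E x \<partial>lebesgue) = 0"
    by (simp add: mass_def)
  then have "AE x in lebesgue. ennreal (w x) * indicator E x = 0"
    by (subst (asm) nn_integral_0_iff_AE) auto
  then have "AE x in lebesgue. x \<notin> E"
  proof eventually_elim
    case (elim x)
    then show ?case
      using assms(2)[of x] by (auto simp: indicator_def split: if_splits)
  qed
  then have "emeasure lebesgue E = 0"
    using assms(3) by (simp add: AE_iff_null_sets null_setsD1)
  then show False using assms(4) by simp
qed

context lattice begin

lemma locally_integrable_cube:
  fixes f :: "real^'n \<Rightarrow> 'b::{banach, second_countable_topology}"
  assumes "locally_integrable f" "Q \<in> cubes D"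
  shows "set_integrable lebesgue Q f"
proof -
  obtain a where "Q \<subseteq> cbox (- a) a"
    using bounded_subset_cbox_symmetric[OF bounded_cube[OF assms(2)]] by blast
  moreover have "set_integrable lebesgue (cbox (- a) a) f"
    using assms(1) by (simp add: locally_integrable_def)
  ultimately show ?thesis
    by (intro set_integrable_subset[OF _ sets_cube[OF assms(2)]])
qed

lemma mass_eq_integral:
  assumes "set_integrable lebesgue Q w" "\<And>x. 0 \<le> w x"
  shows "mass w Q = ennreal (LINT x:Q|lebesgue. w x)"
proof -
  have "mass w Q = (\<integral>\<^sup>+x. ennreal (indicator Q x *\<^sub>R w x) \<partial>lebesgue)"
    unfolding mass_def using assms(2) by (intro nn_integral_cong) (auto simp: indicator_def)
  also have "\<dots> = ennreal (LINT x|lebesgue. indicator Q x *\<^sub>R w x)"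
    using assms by (intro nn_integral_eq_integral) (auto simp: set_integrable_def)
  finally show ?thesis by (simp add: set_lebesgue_integral_def)
qed

lemma mass_cube_pos:
  assumes "w \<in> borel_measurable lebesgue" "\<And>x. 0 < w x" "Q \<in> cubes D"
  shows "0 < mass w Q"
  by (rule mass_pos[OF assms(1,2) sets_cube[OF assms(3)]])
     (simp add: emeasure_cube[OF assms(3)] vol_pos[OF assms(3)])

lemma weight_mass:
  assumes "weight w" "Q \<in> cubes D"
  shows "0 < mass w Q" "mass w Q < \<infinity>"
proof -
  have w: "\<And>x. 0 < w x" "locally_integrable w" using assms(1) by (auto simp: weight_def)
  show "0 < mass w Q"
    by (rule mass_cube_pos[OF locally_integrable_measurable[OF w(2)] w(1) assms(2)])
  show "mass w Q < \<infinity>"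
    using mass_eq_integral[OF locally_integrable_cube[OF w(2) assms(2)]] w(1) by (simp add: less_imp_le)
qed

text \<open>Hoelder's inequality for three functions whose weighted product is 1, obtained by
  dividing each function by its mass, applying Young's inequality pointwise and integrating over
  \<open>E\<close>.\<close>

lemma vol_le_mass_product:
  assumes w: "u \<in> borel_measurable lebesgue" "v \<in> borel_measurable lebesgue" "z \<in> borel_measurable lebesgue"
    and pos: "\<And>x. 0 < u x" "\<And>x. 0 < v x" "\<And>x. 0 < z x"
    and e: "0 < a" "0 < b" "0 < c" "a + b + c = 1"
    and one: "\<And>x. u x powr a * v x powr b * z x powr c = 1"
    and E: "E \<in> lmeasurable" "mass u E < \<infinity>" "mass v E < \<infinity>" "mass z E < \<infinity>"
  shows "vol E \<le> enn2real (mass u E) powr a * enn2real (mass v E) powr b * enn2real (mass z E) powr c"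
proof (cases "vol E = 0")
  case False
  note [measurable] = w fmeasurableD[OF E(1)]
  have eE: "emeasure lebesgue E = ennreal (vol E)" "0 < vol E"
    using E(1) False by (auto simp: emeasure_eq_measure2 less_le)
  define U V Z where "U = enn2real (mass u E)" and "V = enn2real (mass v E)" and "Z = enn2real (mass z E)"
  have m: "mass u E = ennreal U" "mass v E = ennreal V" "mass z E = ennreal Z"
    using E by (simp_all add: U_def V_def Z_def)
  have "0 < mass u E" "0 < mass v E" "0 < mass z E"
    using mass_pos[OF w(1) pos(1)] mass_pos[OF w(2) pos(2)] mass_pos[OF w(3) pos(3)] fmeasurableD[OF E(1)] eE
    by auto
  then have UVZ: "0 < U" "0 < V" "0 < Z" by (auto simp: m)
  define \<kappa> where "\<kappa> = U powr a * V powr b * Z powr c"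
  have \<kappa>: "0 < \<kappa>" using UVZ by (simp add: \<kappa>_def)
  have pt: "1 / \<kappa> \<le> a / U * u x + b / V * v x + c / Z * z x" for x
  proof -
    have "1 / \<kappa> = (u x / U) powr a * (v x / V) powr b * (z x / Z) powr c"
      using one[of x] UVZ pos[of x] unfolding \<kappa>_def by (simp add: powr_divide)
    also have "\<dots> \<le> a * (u x / U) + b * (v x / V) + c * (z x / Z)"
      using UVZ pos[of x] e by (intro young_3) (auto simp: less_imp_le)
    finally show ?thesis by simp
  qed
  have "ennreal (1 / \<kappa>) * emeasure lebesgue E = (\<integral>\<^sup>+x. ennreal (1 / \<kappa>) * indicator E x \<partial>lebesgue)"
    by (intro nn_integral_cmult_indicator[symmetric]) measurable
  also have "\<dots> \<le> (\<integral>\<^sup>+x. ennreal (a / U) * (ennreal (u x) * indicator E x)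
      + ennreal (b / V) * (ennreal (v x) * indicator E x) + ennreal (c / Z) * (ennreal (z x) * indicator E x) \<partial>lebesgue)"
  proof (rule nn_integral_mono)
    fix x
    have "ennreal (1 / \<kappa>) \<le> ennreal (a / U * u x + b / V * v x + c / Z * z x)"
      by (rule ennreal_leI[OF pt])
    also have "\<dots> = ennreal (a / U) * ennreal (u x) + ennreal (b / V) * ennreal (v x) + ennreal (c / Z) * ennreal (z x)"
      using UVZ pos[of x] e by (simp add: less_imp_le flip: ennreal_mult ennreal_plus)
    finally show "ennreal (1 / \<kappa>) * indicator E x \<le> ennreal (a / U) * (ennreal (u x) * indicator E x)
      + ennreal (b / V) * (ennreal (v x) * indicator E x) + ennreal (c / Z) * (ennreal (z x) * indicator E x)"
      by (auto simp: indicator_def)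
  qed
  also have "\<dots> = ennreal (a / U) * mass u E + ennreal (b / V) * mass v E + ennreal (c / Z) * mass z E"
    unfolding mass_def by (simp add: nn_integral_add nn_integral_cmult)
  also have "\<dots> = ennreal (a / U * U + b / V * V + c / Z * Z)"
    unfolding m using UVZ e by (simp add: less_imp_le flip: ennreal_mult ennreal_plus)
  also have "a / U * U + b / V * V + c / Z * Z = 1"
    using UVZ e by simp
  finally have "1 / \<kappa> * vol E \<le> 1"
    unfolding eE using \<kappa> by (simp flip: ennreal_mult)
  then show ?thesis
    using \<kappa> by (simp add: \<kappa>_def U_def V_def Z_def field_simps)
qed simp

text \<open>Hoelder's inequality bounds \<open>vol E\<close> by a product of masses of \<open>E\<close>; the hypothesis reverses
  this on \<open>Q\<close>.\<close>

lemma mass_large_subset: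
  assumes w: "u \<in> borel_measurable lebesgue" "v \<in> borel_measurable lebesgue" "z \<in> borel_measurable lebesgue"
    and pos: "\<And>x. 0 < u x" "\<And>x. 0 < v x" "\<And>x. 0 < z x"
    and e: "0 < a" "0 < b" "0 < c" "a + b + c = 1"
    and one: "\<And>x. u x powr a * v x powr b * z x powr c = 1"
    and fin: "\<And>Q. Q \<in> cubes D \<Longrightarrow> mass u Q < \<infinity>" "\<And>Q. Q \<in> cubes D \<Longrightarrow> mass v Q < \<infinity>"
      "\<And>Q. Q \<in> cubes D \<Longrightarrow> mass z Q < \<infinity>"
    and K: "\<And>Q. Q \<in> cubes D \<Longrightarrow>
      enn2real (mass u Q) powr a * enn2real (mass v Q) powr b * enn2real (mass z Q) powr c \<le> K * vol Q"
    and E: "Q \<in> cubes D" "E \<in> sets lebesgue" "E \<subseteq> Q" "vol Q \<le> 2 * vol E"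
  shows "mass u Q \<le> ennreal ((2 * K) powr (1 / a)) * mass u E"
proof -
  have lm: "E \<in> lmeasurable"
    using lmeasurable_cube[OF E(1)] E(2,3) fmeasurableI2 by blast
  have finE: "mass u E < \<infinity>" "mass v E < \<infinity>" "mass z E < \<infinity>"
    using mass_mono[OF E(3)] fin[OF E(1)] by (meson le_less_trans)+
  define U V Z where "U = enn2real (mass u Q)" and "V = enn2real (mass v Q)" and "Z = enn2real (mass z Q)"
  define U' where "U' = enn2real (mass u E)"
  have UVZ: "0 < U" "0 < V" "0 < Z"
    using mass_cube_pos[OF w(1) pos(1) E(1)] mass_cube_pos[OF w(2) pos(2) E(1)]
      mass_cube_pos[OF w(3) pos(3) E(1)] fin[OF E(1)]
    by (auto simp: U_def V_def Z_def enn2real_positive_iff)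
  have K0: "0 \<le> K"
  proof -
    have "0 \<le> K * vol Q" by (rule order_trans[OF _ K[OF E(1)]]) simp
    then show ?thesis using vol_pos[OF E(1)] by (simp add: zero_le_mult_iff)
  qed
  have "vol E \<le> U' powr a * enn2real (mass v E) powr b * enn2real (mass z E) powr c"
    unfolding U'_def by (rule vol_le_mass_product[OF w pos e one lm finE])
  also have "\<dots> \<le> U' powr a * V powr b * Z powr c"
    unfolding V_def Z_def using e mass_mono[OF E(3)] fin[OF E(1)]
    by (intro mult_mono powr_mono2 enn2real_mono) (auto simp: U'_def)
  finally have "U powr a * vol E \<le> U' powr a * (U powr a * V powr b * Z powr c)"
    using UVZ by (simp add: mult_ac)
  also have "\<dots> \<le> U' powr a * (K * vol Q)"
    using K[OF E(1)] unfolding U_def V_def Z_def by (intro mult_left_mono) auto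
  also have "\<dots> \<le> U' powr a * (K * (2 * vol E))"
    using E(4) K0 by (intro mult_left_mono) auto
  \<comment> \<open>The masses of \<open>v\<close> and \<open>z\<close> are bounded by those of all
    of \<open>Q\<close>, so only the mass of \<open>u\<close> on \<open>E\<close> survives. The
    factor 2 is the ratio allowed between the volumes, and \<open>vol E\<close> now cancels.\<close>
  finally have "vol E * U powr a \<le> vol E * (2 * K * U' powr a)"
    by (simp add: mult_ac)
  moreover have "0 < vol E" using E(4) vol_pos[OF E(1)] by simp
  ultimately have "U powr a \<le> 2 * K * U' powr a"
    by simp
  then have "(U powr a) powr (1 / a) \<le> (2 * K * U' powr a) powr (1 / a)"
    using e by (intro powr_mono2) auto
  then have "U \<le> (2 * K) powr (1 / a) * U'"
    using e UVZ K0 by (simp add: powr_mult powr_powr U'_def)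
  then show ?thesis
    using fin(1)[OF E(1)] finE(1) unfolding U_def U'_def
    by (metis ennreal_enn2real ennreal_leI ennreal_mult' infinity_ennreal_def less_top powr_ge_zero top.not_eq_extremum)
qed

text \<open>Stop whenever the average of \<open>u\<close> doubles. Then the maximal function over a
  finite family is at most twice the sum of averages over the selected cubes, whose masses are
  comparable by \<open>C\<close> to those of disjoint subsets of the top cube.\<close>

lemma A_inf_finite:
  assumes u: "u \<in> borel_measurable lebesgue" "\<And>x. 0 < u x" "\<And>Q. Q \<in> cubes D \<Longrightarrow> mass u Q < \<infinity>"
    and C: "\<And>Q E. Q \<in> cubes D \<Longrightarrow> E \<in> sets lebesgue \<Longrightarrow> E \<subseteq> Q \<Longrightarrow> vol Q \<le> 2 * vol E \<Longrightarrow>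
      mass u Q \<le> ennreal C * mass u E"
  shows "A_inf D u \<le> ennreal (2 * C)"
  unfolding A_inf_def
proof (rule SUP_least)
  fix R assume R: "R \<in> cubes D"
  note [measurable] = u(1)
  define \<A> where "\<A> = {P \<in> cubes D. P \<subseteq> R}"
  have \<A>: "countable \<A>" "R \<in> \<A>"
  proof -
    show "countable \<A>"
      unfolding \<A>_def by (rule countable_subset[OF Collect_restrict countable_cubes])
    show "R \<in> \<A>" using R by (simp add: \<A>_def)
  qed
  \<comment> \<open>Stopping is available for finite families only, so the cubes inside
    \<open>R\<close> are exhausted by finite ones and monotone convergence is applied at the
    end.\<close>
  define F where "F n = insert R (from_nat_into \<A> ` {..n})" for n :: nat
  have F: "finite (F n)" "F n \<subseteq> \<A>" "R \<in> F n" for n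
    using from_nat_into[of \<A>] \<A>(2) by (auto simp: F_def)
  have FA: "(\<Union>n. F n) = \<A>"
  proof
    show "(\<Union>n. F n) \<subseteq> \<A>" using F by blast
    show "\<A> \<subseteq> (\<Union>n. F n)"
      using from_nat_into_surj[OF \<A>(1)] unfolding F_def by blast
  qed
  have sets: "P \<in> sets lebesgue" "P \<in> cubes D" if "P \<in> \<A>" for P
    using that sets_cube by (simp_all add: \<A>_def)
  define m where "m n x = (SUP P\<in>F n. wavg u P * indicator P x)" for n x
  have mass_wavg: "wavg u P * emeasure lebesgue P = mass u P" if "P \<in> cubes D" for P
    unfolding wavg_def emeasure_cube[OF that] using vol_pos[OF that]
    by (simp add: ennreal_divide_times)
  have wavg: "wavg u P = ennreal (ravg u P)" "set_integrable lebesgue P u" if "P \<in> cubes D" for P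
  proof -
    note [measurable] = sets_cube[OF that]
    show int: "set_integrable lebesgue P u"
      unfolding set_integrable_def
    proof (rule integrableI_nonneg)
      have "(\<integral>\<^sup>+x. ennreal (indicat_real P x *\<^sub>R u x) \<partial>lebesgue) = mass u P"
        unfolding mass_def by (intro nn_integral_cong) (auto simp: indicator_def)
      then show "(\<integral>\<^sup>+x. ennreal (indicat_real P x *\<^sub>R u x) \<partial>lebesgue) < \<infinity>"
        using u(3)[OF that] by simp
    qed (use u(2) in \<open>auto simp: less_imp_le\<close>)
    have nn: "0 \<le> (LINT x:P|lebesgue. u x)"
      unfolding set_lebesgue_integral_def using u(2)
      by (intro Bochner_Integration.integral_nonneg) (auto simp: less_imp_le)
    have "mass u P = ennreal (LINT x:P|lebesgue. u x)"
      using int u(2) by (intro mass_eq_integral) (auto simp: less_imp_le)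
    then show "wavg u P = ennreal (ravg u P)"
      unfolding wavg_def emeasure_cube[OF that] using vol_pos[OF that] nn by (simp add: divide_ennreal)
  qed
  have bound: "(\<integral>\<^sup>+x. m n x \<partial>lebesgue) \<le> ennreal (2 * C) * mass u R" for n
  proof -
    \<comment> \<open>Doubling yields both the bound for averages over unstopped cubes and, by
      Chebyshev's inequality, the half needed for sparseness.\<close>
    define bad where "bad S P \<longleftrightarrow> 2 * ravg u S < ravg u P" for S P
    have Fc: "F n \<subseteq> cubes D" using F(2)[of n] by (auto simp: \<A>_def)
    have half: "2 * vol (\<Union> (stopping (F n) bad S)) \<le> vol S" if "S \<in> F n" for S
    proof (rule vol_large_average[where g=u])
      show "finite (stopping (F n) bad S)"
        using F(1) by (simp add: stopping_def)
      show "stopping (F n) bad S \<subseteq> cubes D"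
        by (rule order_trans[OF _ Fc]) (auto simp: stopping_def)
      show "disjoint (stopping (F n) bad S)"
        by (rule stopping_disjoint[OF Fc])
      show "\<Union> (stopping (F n) bad S) \<subseteq> S"
        by (auto simp: stopping_def)
      show S: "S \<in> cubes D"
        using Fc that by (rule subsetD)
      show "set_integrable lebesgue S u" by (rule wavg(2)[OF S])
      show "0 \<le> u x" for x using u(2)[of x] by simp
    qed (auto simp: stopping_def bad_def)
    obtain \<S> \<pi> where S: "sparse \<S>" "\<S> \<subseteq> F n" "\<pi> ` F n \<subseteq> \<S>"
      "\<forall>S\<in>\<S>. {Q \<in> F n. \<pi> Q = S} = unstopped (F n) bad S"
      using stopping_sparse[where bad=bad, OF F(1) Fc half, simplified] by (elim exE conjE) (rule that)
    obtain E where E: "finite \<S>" "\<S> \<subseteq> cubes D" "disjoint_family_on E \<S>"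
      "\<And>Q. Q \<in> \<S> \<Longrightarrow> E Q \<in> sets lebesgue \<and> E Q \<subseteq> Q \<and> vol Q \<le> 2 * vol (E Q)"
      using S(1) unfolding sparse_def by blast
    have le: "wavg u P \<le> 2 * wavg u (\<pi> P)" "P \<subseteq> \<pi> P" if "P \<in> F n" for P
    proof -
      have \<pi>: "\<pi> P \<in> \<S>" using S(3) that by auto
      then have unst: "P \<in> unstopped (F n) bad (\<pi> P)" using S(4) that by blast
      then show "P \<subseteq> \<pi> P" by (simp add: unstopped_def)
      have "ravg u P \<le> 2 * ravg u (\<pi> P)"
      proof (cases "P = \<pi> P")
        case True
        have "0 \<le> ravg u (\<pi> P)" using ravg_nonneg[of u] u(2) by (simp add: less_imp_le)
        then show ?thesis using True by simp
      next
        case False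
        then show ?thesis
          using unstopped_not_bad[OF F(1) unst] by (simp add: bad_def not_less)
      qed
      then have "ennreal (ravg u P) \<le> ennreal (2 * ravg u (\<pi> P))" by (rule ennreal_leI)
      also have "\<dots> = 2 * ennreal (ravg u (\<pi> P))"
        using ennreal_mult'[of 2 "ravg u (\<pi> P)"] by simp
      finally show "wavg u P \<le> 2 * wavg u (\<pi> P)"
        unfolding wavg(1)[OF subsetD[OF Fc that]] wavg(1)[OF subsetD[OF E(2) \<pi>]] .
    qed
    have "(\<integral>\<^sup>+x. m n x \<partial>lebesgue) \<le> (\<integral>\<^sup>+x. (\<Sum>S\<in>\<S>. 2 * wavg u S * indicator S x) \<partial>lebesgue)"
    proof (rule nn_integral_mono)
      fix x
      show "m n x \<le> (\<Sum>S\<in>\<S>. 2 * wavg u S * indicator S x)"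
        unfolding m_def
      proof (rule SUP_least)
        fix P assume P: "P \<in> F n"
        have "wavg u P * indicator P x \<le> 2 * wavg u (\<pi> P) * indicator (\<pi> P) x"
          using le[OF P] by (auto simp: indicator_def)
        also have "\<dots> \<le> (\<Sum>S\<in>\<S>. 2 * wavg u S * indicator S x)"
          using S(3) P E(1) by (intro sum_nonneg_leq_bound[OF E(1) _ refl]) auto
        finally show "wavg u P * indicator P x \<le> \<dots>" .
      qed
    qed
    also have "\<dots> = (\<Sum>S\<in>\<S>. \<integral>\<^sup>+x. 2 * wavg u S * indicator S x \<partial>lebesgue)"
    proof (rule nn_integral_sum)
      fix S assume "S \<in> \<S>"
      then have [measurable]: "S \<in> sets lebesgue" using E(2) sets_cube by blast
      show "(\<lambda>x. 2 * wavg u S * indicator S x) \<in> borel_measurable lebesgue" by measurable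
    qed
    also have "\<dots> = (\<Sum>S\<in>\<S>. 2 * mass u S)"
    proof (rule sum.cong)
      fix S assume "S \<in> \<S>"
      then have S: "S \<in> cubes D" "S \<in> sets lebesgue" using E(2) sets_cube by blast+
      show "(\<integral>\<^sup>+x. 2 * wavg u S * indicator S x \<partial>lebesgue) = 2 * mass u S"
        unfolding nn_integral_cmult_indicator[OF S(2)] by (simp only: mult.assoc mass_wavg[OF S(1)])
    qed simp
    also have "\<dots> \<le> (\<Sum>S\<in>\<S>. 2 * (ennreal C * mass u (E S)))"
    proof (intro sum_mono mult_left_mono)
      fix S assume "S \<in> \<S>"
      then show "mass u S \<le> ennreal C * mass u (E S)"
        using E(2) E(4)[of S] by (intro C) auto
    qed simp
    also have "\<dots> = ennreal (2 * C) * (\<Sum>S\<in>\<S>. \<integral>\<^sup>+x\<in>E S. (ennreal (u x) * indicator R x) \<partial>lebesgue)"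
    proof -
      have "mass u (E S) = (\<integral>\<^sup>+x\<in>E S. (ennreal (u x) * indicator R x) \<partial>lebesgue)" if "S \<in> \<S>" for S
      proof -
        have "E S \<subseteq> R" using E(4)[OF that] that S(2) F(2)[of n] by (auto simp: \<A>_def)
        then show ?thesis
          unfolding mass_def by (intro nn_integral_cong) (auto simp: indicator_def)
      qed
      then show ?thesis
        by (simp add: sum_distrib_left ennreal_mult' mult.assoc)
    qed
    also have "\<dots> \<le> ennreal (2 * C) * mass u R"
      unfolding mass_def using E(1,3,4) sets_cube[OF R]
      by (intro mult_left_mono sum_nn_integral_disjoint_le) auto
    finally show ?thesis .
  qed
  have "(\<integral>\<^sup>+x\<in>R. (SUP P\<in>{P \<in> cubes D. x \<in> P \<and> P \<subseteq> R}. wavg u P) \<partial>lebesgue) \<le> (\<integral>\<^sup>+x. (SUP n. m n x) \<partial>lebesgue)"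
  proof (rule nn_integral_mono)
    fix x
    have "(SUP P\<in>{P \<in> cubes D. x \<in> P \<and> P \<subseteq> R}. wavg u P) \<le> (SUP n. m n x)"
    proof (rule SUP_least)
      fix P assume P: "P \<in> {P \<in> cubes D. x \<in> P \<and> P \<subseteq> R}"
      then have "P \<in> \<A>" by (simp add: \<A>_def)
      then obtain n where "P \<in> F n" using FA by blast
      then have "wavg u P * indicator P x \<le> m n x"
        unfolding m_def by (rule SUP_upper)
      also have "\<dots> \<le> (SUP n. m n x)" by (rule SUP_upper) simp
      finally show "wavg u P \<le> (SUP n. m n x)" using P by simp
    qed
    then show "(SUP P\<in>{P \<in> cubes D. x \<in> P \<and> P \<subseteq> R}. wavg u P) * indicator R x \<le> (SUP n. m n x)"
      by (auto simp: indicator_def)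
  qed
  also have "\<dots> = (SUP n. \<integral>\<^sup>+x. m n x \<partial>lebesgue)"
  proof (rule nn_integral_monotone_convergence_SUP)
    have "F i \<subseteq> F j" if "i \<le> j" for i j
      using that by (auto simp: F_def)
    then show "incseq m"
      unfolding incseq_def le_fun_def m_def by (intro allI impI SUP_subset_mono) auto
    show "m n \<in> borel_measurable lebesgue" for n
      unfolding m_def
    proof (rule borel_measurable_SUP)
      show "countable (F n)" using F(1) by (rule countable_finite)
      fix P assume "P \<in> F n"
      then have [measurable]: "P \<in> sets lebesgue" using F(2) sets by blast
      show "(\<lambda>x. wavg u P * indicator P x) \<in> borel_measurable lebesgue" by measurable
    qed
  qed
  also have "\<dots> \<le> ennreal (2 * C) * mass u R"
    by (rule SUP_least) (rule bound)
  finally have "(\<integral>\<^sup>+x\<in>R. (SUP P\<in>{P \<in> cubes D. x \<in> P \<and> P \<subseteq> R}. wavg u P) \<partial>lebesgue) \<le> ennreal (2 * C) * mass u R" .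
  then show "(\<integral>\<^sup>+x\<in>R. (SUP P\<in>{P \<in> cubes D. x \<in> P \<and> P \<subseteq> R}. wavg u P) \<partial>lebesgue) / mass u R \<le> ennreal (2 * C)"
    using mass_cube_pos[OF u(1,2) R] u(3)[OF R] by (intro divide_le_posI_ennreal) (auto simp: mult.commute)
qed

end

section \<open>Sparse operators\<close>

lemma ennpowr_ennreal: "0 \<le> a \<Longrightarrow> ennreal a ennpowr s = ennreal (a powr s)"
  by (simp add: ennpowr_def)

lemma ennpowr_less_top_iff: "x ennpowr s < top \<longleftrightarrow> x < top"
  by (simp add: ennpowr_def less_top)

lemma ennpowr_pos: "0 < x \<Longrightarrow> 0 < x ennpowr s"
  by (cases x) (auto simp: ennpowr_def)

lemma ennpowr_mono: "0 \<le> s \<Longrightarrow> x \<le> y \<Longrightarrow> x ennpowr s \<le> y ennpowr s"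
  by (cases x; cases y) (auto simp: ennpowr_def top_unique intro!: ennreal_leI powr_mono2)

text \<open>After normalising the sums to 1 all terms are at most 1, so lowering the exponents until
  they add up to 1 only increases the powers. This is why p < q is as good as p = q.\<close>

lemma sum_powr_holder:
  fixes x y :: "'i \<Rightarrow> real"
  assumes ab: "0 < a" "0 < b" "1 \<le> a + b"
    and nn: "\<And>i. i \<in> I \<Longrightarrow> 0 \<le> x i" "\<And>i. i \<in> I \<Longrightarrow> 0 \<le> y i"
  shows "(\<Sum>i\<in>I. x i powr a * y i powr b) \<le> (\<Sum>i\<in>I. x i) powr a * (\<Sum>i\<in>I. y i) powr b"
proof (cases "finite I \<and> (\<Sum>i\<in>I. x i) \<noteq> 0 \<and> (\<Sum>i\<in>I. y i) \<noteq> 0")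
  case False
  then consider "infinite I" | "finite I" "\<forall>i\<in>I. x i = 0" | "finite I" "\<forall>i\<in>I. y i = 0"
    using nn by (auto simp: sum_nonneg_eq_0_iff)
  then have "(\<Sum>i\<in>I. x i powr a * y i powr b) = 0"
    by cases (auto intro!: sum.neutral)
  then show ?thesis by simp
next
  case True
  define X where "X = (\<Sum>i\<in>I. x i)"
  define Y where "Y = (\<Sum>i\<in>I. y i)"
  have XY: "0 < X" "0 < Y"
    using True nn sum_nonneg[of I x] sum_nonneg[of I y] by (auto simp: X_def Y_def less_le)
  have le: "x i \<le> X" "y i \<le> Y" if "i \<in> I" for i
    unfolding X_def Y_def using True nn that by (auto intro: member_le_sum)
  have summand: "x i powr a * y i powr b \<le> X powr a * Y powr b * (a / (a + b) * (x i / X) + b / (a + b) * (y i / Y))"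
    if i: "i \<in> I" for i
  proof -
    have "(x i / X) powr a * (y i / Y) powr b \<le> (x i / X) powr (a / (a + b)) * (y i / Y) powr (b / (a + b))"
    proof -
      have "a / (a + b) \<le> a" "b / (a + b) \<le> b"
        using ab mult_left_mono[of 1 "a + b" a] mult_left_mono[of 1 "a + b" b]
        by (simp_all add: pos_divide_le_eq)
      then show ?thesis
        using XY nn[OF i] le[OF i] ab by (intro mult_mono powr_mono') auto
    qed
    also have "\<dots> \<le> a / (a + b) * (x i / X) + b / (a + b) * (y i / Y)"
      using XY nn[OF i] ab by (intro young_2) (auto simp flip: add_divide_distrib)
    finally have "X powr a * Y powr b * ((x i / X) powr a * (y i / Y) powr b)
        \<le> X powr a * Y powr b * (a / (a + b) * (x i / X) + b / (a + b) * (y i / Y))"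
      by (intro mult_left_mono) auto
    moreover have "X powr a * Y powr b * ((x i / X) powr a * (y i / Y) powr b) = x i powr a * y i powr b"
      using XY nn[OF i] by (simp add: powr_divide)
    ultimately show ?thesis by simp
  qed
  have "(\<Sum>i\<in>I. x i powr a * y i powr b)
      \<le> (\<Sum>i\<in>I. X powr a * Y powr b * (a / (a + b) * (x i / X) + b / (a + b) * (y i / Y)))"
    by (rule sum_mono) (rule summand)
  also have "\<dots> = X powr a * Y powr b * (a / (a + b) * ((\<Sum>i\<in>I. x i) / X) + b / (a + b) * ((\<Sum>i\<in>I. y i) / Y))"
    by (simp only: sum_distrib_left sum_divide_distrib sum.distrib flip: sum_distrib_left)
  also have "\<dots> = X powr a * Y powr b"
    using XY ab by (simp add: X_def[symmetric] Y_def[symmetric] flip: add_divide_distrib)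
  finally show ?thesis by (simp add: X_def Y_def)
qed

text \<open>The last two factors are merged into one, and the inequality for two factors is applied
  twice.\<close>

lemma sum_powr_holder_3:
  fixes x y z :: "'i \<Rightarrow> real"
  assumes abc: "0 < a" "0 < b" "0 < c" "1 \<le> a + b + c"
    and nn: "\<And>i. i \<in> I \<Longrightarrow> 0 \<le> x i" "\<And>i. i \<in> I \<Longrightarrow> 0 \<le> y i" "\<And>i. i \<in> I \<Longrightarrow> 0 \<le> z i"
  shows "(\<Sum>i\<in>I. x i powr a * y i powr b * z i powr c)
    \<le> (\<Sum>i\<in>I. x i) powr a * (\<Sum>i\<in>I. y i) powr b * (\<Sum>i\<in>I. z i) powr c"
proof -
  define s where "s = b + c"
  have s: "0 < s" using abc by (simp add: s_def)
  define t where "t i = y i powr (b / s) * z i powr (c / s)" for i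
  have ts: "t i powr s = y i powr b * z i powr c" for i
    using s by (simp add: t_def powr_mult powr_powr)
  have "(\<Sum>i\<in>I. x i powr a * y i powr b * z i powr c) = (\<Sum>i\<in>I. x i powr a * t i powr s)"
    by (simp add: ts mult.assoc)
  also have "\<dots> \<le> (\<Sum>i\<in>I. x i) powr a * (\<Sum>i\<in>I. t i) powr s"
    using abc s nn by (intro sum_powr_holder) (auto simp: s_def t_def)
  also have "\<dots> \<le> (\<Sum>i\<in>I. x i) powr a * ((\<Sum>i\<in>I. y i) powr (b / s) * (\<Sum>i\<in>I. z i) powr (c / s)) powr s"
  proof (intro mult_left_mono powr_mono2)
    show "(\<Sum>i\<in>I. t i) \<le> (\<Sum>i\<in>I. y i) powr (b / s) * (\<Sum>i\<in>I. z i) powr (c / s)"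
      unfolding t_def using abc s nn
      by (intro sum_powr_holder) (auto simp: s_def simp flip: add_divide_distrib)
  qed (use s in \<open>auto simp: t_def intro!: sum_nonneg\<close>)
  also have "\<dots> = (\<Sum>i\<in>I. x i) powr a * (\<Sum>i\<in>I. y i) powr b * (\<Sum>i\<in>I. z i) powr c"
    using s by (simp add: powr_mult powr_powr)
  finally show ?thesis .
qed

text \<open>Removes the power of \<open>I\<close> that testing a function against a power of itself
  leaves on the right. That \<open>I\<close> is real, that is finite, makes the cancellation
  legitimate.\<close>

lemma le_powr_self_improve:
  fixes I K q :: real
  assumes "1 < q" "0 \<le> I" "0 \<le> K" "I \<le> K * I powr (1 - 1 / q)"
  shows "I \<le> K powr q"
proof (cases "I = 0")
  case False
  then have I: "0 < I" using assms by simp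
  have "I = I powr (1 / q) * I powr (1 - 1 / q)"
    using I by (simp flip: powr_add)
  then have "I powr (1 / q) * I powr (1 - 1 / q) \<le> K * I powr (1 - 1 / q)"
    using assms(4) by simp
  then have "I powr (1 / q) \<le> K"
    using I by simp
  then have "(I powr (1 / q)) powr q \<le> K powr q"
    using assms by (intro powr_mono2) auto
  then show ?thesis using I assms by (simp add: powr_powr)
qed simp

text \<open>The constant of the embedding theorem; the last factor 2 is the sparse parameter
  entering through \<open>sparse_carleson\<close>.\<close>

definition carleson_const :: "real \<Rightarrow> real" where
  "carleson_const p = 2 powr p * (p / (p - 1)) * 2"

context lattice begin

abbreviation rmass :: "(real^'n \<Rightarrow> real) \<Rightarrow> (real^'n) set \<Rightarrow> real" where
  "rmass w Q \<equiv> enn2real (mass w Q)"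

lemma carleson_embedding_sparse:
  assumes p: "1 < p" and S: "sparse \<S>"
    and w: "w \<in> borel_measurable lebesgue" "\<And>x. 0 < w x" "\<And>Q. Q \<in> cubes D \<Longrightarrow> mass w Q < \<infinity>"
    and h: "h \<in> borel_measurable lebesgue" "\<And>x. 0 \<le> h x"
    and A: "A_inf D w \<le> ennreal A" "0 \<le> A"
    and a: "\<And>S. S \<in> \<S> \<Longrightarrow> 0 \<le> a S"
      "\<And>S. S \<in> \<S> \<Longrightarrow> ennreal (a S) * mass w S \<le> (\<integral>\<^sup>+x\<in>S. ennreal (h x * w x) \<partial>lebesgue)"
    and I: "(\<integral>\<^sup>+x. ennreal (h x powr p * w x) \<partial>lebesgue) \<le> ennreal I" "0 \<le> I"
  shows "(\<Sum>S\<in>\<S>. a S powr p * rmass w S) \<le> 2 powr p * (p / (p - 1)) * (2 * A) * I"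
proof -
  have fin: "finite \<S>" "\<S> \<subseteq> cubes D" using S by (auto simp: sparse_def)
  have m: "mass w S = ennreal (rmass w S)" if "S \<in> \<S>" for S
    using w(3) fin(2) that by (simp add: subset_iff)
  have "ennreal (\<Sum>S\<in>\<S>. a S powr p * rmass w S) = (\<Sum>S\<in>\<S>. ennreal (a S powr p) * mass w S)"
    using a(1) m by (subst sum_ennreal[symmetric]) (auto simp: ennreal_mult intro!: sum.cong)
  also have "\<dots> \<le> ennreal (2 powr p * (p / (p - 1)) * (2 * A)) * (\<integral>\<^sup>+x. ennreal (h x powr p * w x) \<partial>lebesgue)"
  proof (rule carleson_embedding[OF p fin w(1) _ _ h _ a])
    show "0 \<le> w x" for x using w(2)[of x] by simp
    show "mass w S < \<infinity>" if "S \<in> \<S>" for S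
      using w(3) fin(2) that by (meson subsetD)
    show "(\<Sum>S\<in>{S \<in> \<S>. S \<subseteq> R}. mass w S) \<le> ennreal (2 * A) * mass w R" if "R \<in> \<S>" for R
      using sparse_carleson[OF S _ _ A(1)] fin(2) that mass_cube_pos[OF w(1,2)] w(3) by (meson subsetD)
  qed (use A in auto)
  also have "\<dots> \<le> ennreal (2 powr p * (p / (p - 1)) * (2 * A)) * ennreal I"
    by (intro mult_left_mono I) simp
  also have "\<dots> = ennreal (2 powr p * (p / (p - 1)) * (2 * A) * I)"
    using p A I by (intro ennreal_mult[symmetric]) auto
  finally show ?thesis
    using p A I by (subst (asm) ennreal_le_iff) auto
qed

text \<open>The last hypothesis abstracts the final Hoelder inequality, so that the cases p \<le> q
  and p > q share this proof. The embedding with exponent \<open>p\<close> contributes the power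
  \<open>1 / p\<close> of \<open>Au\<close>, the one with the conjugate of \<open>q\<close> the
  power \<open>1 - 1 / q\<close> of \<open>Av\<close>.\<close>

lemma sparse_operator_bound:
  fixes f :: "real^'n \<Rightarrow> complex"
  assumes pq: "1 < p" "1 < q"
    and S: "sparse \<S>"
    and u: "u \<in> borel_measurable lebesgue" "\<And>x. 0 < u x" "\<And>Q. Q \<in> cubes D \<Longrightarrow> mass u Q < \<infinity>"
    and v: "v \<in> borel_measurable lebesgue" "\<And>x. 0 < v x" "\<And>Q. Q \<in> cubes D \<Longrightarrow> mass v Q < \<infinity>"
    and z: "\<And>Q. Q \<in> cubes D \<Longrightarrow> 0 < rmass z Q"
    and B: "\<And>Q. Q \<in> cubes D \<Longrightarrow>
      rmass u Q powr (1 - 1 / p) * rmass v Q powr (1 / q) * rmass z Q powr s \<le> B * (vol Q)\<^sup>2"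
    and Au: "A_inf D u \<le> ennreal Au" "0 \<le> Au" and Av: "A_inf D v \<le> ennreal Av" "0 \<le> Av"
    and f: "f \<in> borel_measurable lebesgue" "\<And>Q. Q \<in> cubes D \<Longrightarrow> set_integrable lebesgue Q f"
    and \<Phi>: "(\<integral>\<^sup>+x. ennreal ((norm (f x) / u x) powr p * u x) \<partial>lebesgue) \<le> ennreal \<Phi>" "0 \<le> \<Phi>"
    and o: "\<And>S. S \<in> \<S> \<Longrightarrow> 0 \<le> os S" and N: "0 \<le> N"
      "\<And>x y. (\<And>S. S \<in> \<S> \<Longrightarrow> 0 \<le> x S) \<Longrightarrow> (\<And>S. S \<in> \<S> \<Longrightarrow> 0 \<le> y S) \<Longrightarrow>
        (\<Sum>S\<in>\<S>. os S / rmass z S powr s * (x S powr (1 / p) * y S powr (1 - 1 / q)))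
        \<le> N * ((\<Sum>S\<in>\<S>. x S) powr (1 / p) * (\<Sum>S\<in>\<S>. y S) powr (1 - 1 / q))"
  shows "(\<integral>\<^sup>+x. ennreal ((\<Sum>S\<in>\<S>. os S / vol S * ravg (\<lambda>x. norm (f x)) S * indicator S x) powr q * v x) \<partial>lebesgue)
    \<le> ennreal ((B * N * (carleson_const p * Au * \<Phi>) powr (1 / p)
        * (carleson_const (q / (q - 1)) * Av) powr (1 - 1 / q)) powr q)"
proof -
  define q' where "q' = q / (q - 1)"
  have q': "1 < q'" "1 - 1 / q = 1 / q'" "(q - 1) * q' = q"
    using pq by (auto simp: q'_def field_simps)
  have fin: "finite \<S>" "\<S> \<subseteq> cubes D" using S by (auto simp: sparse_def)
  note cube = subsetD[OF fin(2)]
  note [measurable] = u(1) v(1) f(1)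
  define fa where "fa = ravg (\<lambda>x. norm (f x))"
  define t where "t S = os S / vol S * fa S" for S
  have fa0: "0 \<le> fa S" for S unfolding fa_def by (rule ravg_nonneg) simp
  have t0: "0 \<le> t S" if "S \<in> \<S>" for S
    unfolding t_def using o[OF that] fa0 by simp
  define G where "G x = (\<Sum>S\<in>\<S>. t S * indicator S x)" for x
  have G0: "0 \<le> G x" for x unfolding G_def using t0 by (intro sum_nonneg) auto
  have sets: "S \<in> sets lebesgue" if "S \<in> \<S>" for S using sets_cube[OF cube[OF that]] .
  have [measurable]: "G \<in> borel_measurable lebesgue"
    unfolding G_def using sets by (intro borel_measurable_sum borel_measurable_times borel_measurable_indicator) auto
  \<comment> \<open>\<open>G\<close> is bounded by \<open>T\<close> and vanishes outside finitely
    many cubes, so the quantities below are finite and may be treated as reals.\<close>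
  define T where "T = (\<Sum>S\<in>\<S>. t S)"
  have GT: "G x \<le> T" for x
    unfolding G_def T_def using t0 by (intro sum_mono) (auto simp: indicator_def)
  have T0: "0 \<le> T" using GT[of undefined] G0[of undefined] by linarith
  have mu: "mass u S = ennreal (rmass u S)" "0 < rmass u S" and mv: "mass v S = ennreal (rmass v S)" "0 < rmass v S"
    if "S \<in> \<S>" for S
    using u(3)[OF cube[OF that]] v(3)[OF cube[OF that]] mass_cube_pos[OF u(1,2) cube[OF that]]
      mass_cube_pos[OF v(1,2) cube[OF that]] by (auto simp: enn2real_positive_iff)
  \<comment> \<open>The average over \<open>S\<close>, with respect to \<open>v\<close>, of the test
    function \<open>G powr (q - 1)\<close>.\<close>
  define \<kappa> where "\<kappa> S = enn2real (\<integral>\<^sup>+x\<in>S. ennreal (G x powr (q - 1) * v x) \<partial>lebesgue) / rmass v S" for S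
  have \<kappa>0: "0 \<le> \<kappa> S" for S by (simp add: \<kappa>_def)
  have \<kappa>: "(\<integral>\<^sup>+x\<in>S. ennreal (G x powr (q - 1) * v x) \<partial>lebesgue) = ennreal (\<kappa> S * rmass v S)" if "S \<in> \<S>" for S
  proof -
    have "(\<integral>\<^sup>+x\<in>S. ennreal (G x powr (q - 1) * v x) \<partial>lebesgue)
        \<le> (\<integral>\<^sup>+x. ennreal (T powr (q - 1)) * (ennreal (v x) * indicator S x) \<partial>lebesgue)"
      using pq G0 GT v(2) by (intro nn_integral_mono)
        (auto simp: indicator_def less_imp_le simp flip: ennreal_mult intro!: ennreal_leI mult_right_mono powr_mono2)
    also have "\<dots> = ennreal (T powr (q - 1)) * mass v S"
    proof -
      note [measurable] = sets[OF that]
      show ?thesis unfolding mass_def by (rule nn_integral_cmult) measurable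
    qed
    also have "\<dots> < \<infinity>"
      using v(3)[OF cube[OF that]] by (simp add: ennreal_mult_less_top)
    finally show ?thesis
      using mv(2)[OF that] by (simp add: \<kappa>_def)
  qed
  have Gq: "ennreal (G x powr q * v x) = (\<Sum>S\<in>\<S>. ennreal (t S) * (ennreal (G x powr (q - 1) * v x) * indicator S x))" for x
  proof -
    have "G x powr q = G x * G x powr (q - 1)"
      using powr_add[of "G x" 1 "q - 1"] G0[of x] by simp
    then have "G x powr q * v x = G x * (G x powr (q - 1) * v x)"
      by simp
    also have "\<dots> = (\<Sum>S\<in>\<S>. t S * indicator S x * (G x powr (q - 1) * v x))"
      unfolding sum_distrib_right[symmetric] by (simp only: G_def)
    also have "\<dots> = (\<Sum>S\<in>\<S>. t S * ((G x powr (q - 1) * v x) * indicator S x))"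
      by (simp only: mult_ac)
    also have "ennreal \<dots> = (\<Sum>S\<in>\<S>. ennreal (t S * ((G x powr (q - 1) * v x) * indicator S x)))"
      using t0 v(2) by (intro sum_ennreal[symmetric]) (auto simp: less_imp_le)
    also have "\<dots> = (\<Sum>S\<in>\<S>. ennreal (t S) * (ennreal (G x powr (q - 1) * v x) * indicator S x))"
      using t0 v(2) by (intro sum.cong) (auto simp: indicator_def ennreal_mult less_imp_le)
    finally show ?thesis .
  qed
  \<comment> \<open>Expanding one factor \<open>G\<close> in the integral of \<open>G powr q\<close>
    against \<open>v\<close> gives this sum. The same integral is the norm of the test function in
    the dual space, since \<open>(q - 1) * q' = q\<close>, and so \<open>I\<close> reappears on the
    right.\<close>
  define I where "I = (\<Sum>S\<in>\<S>. t S * (\<kappa> S * rmass v S))"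
  have I0: "0 \<le> I" unfolding I_def using t0 \<kappa>0 by (intro sum_nonneg) auto
  have I: "(\<integral>\<^sup>+x. ennreal (G x powr q * v x) \<partial>lebesgue) = ennreal I"
  proof -
    have "(\<integral>\<^sup>+x. ennreal (G x powr q * v x) \<partial>lebesgue)
        = (\<Sum>S\<in>\<S>. \<integral>\<^sup>+x. ennreal (t S) * (ennreal (G x powr (q - 1) * v x) * indicator S x) \<partial>lebesgue)"
      unfolding Gq using sets by (intro nn_integral_sum) auto
    also have "\<dots> = (\<Sum>S\<in>\<S>. ennreal (t S) * (\<integral>\<^sup>+x\<in>S. ennreal (G x powr (q - 1) * v x) \<partial>lebesgue))"
      using sets by (intro sum.cong refl nn_integral_cmult) auto
    also have "\<dots> = (\<Sum>S\<in>\<S>. ennreal (t S * (\<kappa> S * rmass v S)))"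
      using \<kappa> t0 \<kappa>0 by (intro sum.cong refl) (simp add: ennreal_mult)
    also have "\<dots> = ennreal I"
      unfolding I_def using t0 \<kappa>0 by (intro sum_ennreal) auto
    finally show ?thesis .
  qed
  \<comment> \<open>The average of \<open>norm (f x) / u x\<close> with respect to \<open>u\<close>,
    that is, of \<open>h\<close> when \<open>f\<close> is written as \<open>h\<close> times the dual
    weight.\<close>
  define H where "H S = (LINT x:S|lebesgue. norm (f x)) / rmass u S" for S
  have int0: "0 \<le> (LINT x:S|lebesgue. norm (f x))" for S
    unfolding set_lebesgue_integral_def by (intro Bochner_Integration.integral_nonneg) auto
  have H0: "0 \<le> H S" for S unfolding H_def using int0 by simp
  define X where "X S = H S powr p * rmass u S" for S
  define Y where "Y S = \<kappa> S powr q' * rmass v S" for S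
  have XY0: "0 \<le> X S" "0 \<le> Y S" for S by (simp_all add: X_def Y_def)
  have X: "(\<Sum>S\<in>\<S>. X S) \<le> carleson_const p * Au * \<Phi>"
  proof -
    have "(\<Sum>S\<in>\<S>. H S powr p * rmass u S) \<le> 2 powr p * (p / (p - 1)) * (2 * Au) * \<Phi>"
    proof (rule carleson_embedding_sparse[OF pq(1) S u _ _ Au H0 _ \<Phi>])
      show "(\<lambda>x. norm (f x) / u x) \<in> borel_measurable lebesgue" by measurable
      show "0 \<le> norm (f x) / u x" for x using u(2)[of x] by simp
      fix S assume S: "S \<in> \<S>"
      have "ennreal (H S) * mass u S = ennreal (H S * rmass u S)"
        by (subst mu(1)[OF S]) (simp add: ennreal_mult H0)
      also have "H S * rmass u S = (LINT x:S|lebesgue. norm (f x))"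
        using mu(2)[OF S] by (simp add: H_def)
      also have "ennreal \<dots> = mass (\<lambda>x. norm (f x)) S"
        using set_integrable_norm[OF f(2)[OF cube[OF S]]] by (intro mass_eq_integral[symmetric]) auto
      also have "\<dots> = (\<integral>\<^sup>+x\<in>S. ennreal (norm (f x) / u x * u x) \<partial>lebesgue)"
        unfolding mass_def using u(2) by (simp add: less_imp_neq[symmetric])
      finally show "ennreal (H S) * mass u S \<le> (\<integral>\<^sup>+x\<in>S. ennreal (norm (f x) / u x * u x) \<partial>lebesgue)"
        by simp
    qed
    then show ?thesis by (simp add: X_def carleson_const_def mult_ac)
  qed
  have Y: "(\<Sum>S\<in>\<S>. Y S) \<le> carleson_const q' * Av * I"
  proof -
    have "(\<Sum>S\<in>\<S>. \<kappa> S powr q' * rmass v S) \<le> 2 powr q' * (q' / (q' - 1)) * (2 * Av) * I"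
    proof (rule carleson_embedding_sparse[OF q'(1) S v _ _ Av \<kappa>0 _ _ I0])
      show "(\<lambda>x. G x powr (q - 1)) \<in> borel_measurable lebesgue" by measurable
      show "(\<integral>\<^sup>+x. ennreal ((G x powr (q - 1)) powr q' * v x) \<partial>lebesgue) \<le> ennreal I"
        using I by (simp add: powr_powr q'(3))
      fix S assume S: "S \<in> \<S>"
      show "ennreal (\<kappa> S) * mass v S \<le> (\<integral>\<^sup>+x\<in>S. ennreal (G x powr (q - 1) * v x) \<partial>lebesgue)"
        using \<kappa>[OF S] mv(1)[OF S] \<kappa>0[of S] by (simp add: ennreal_mult)
    qed auto
    then show ?thesis by (simp add: Y_def carleson_const_def mult_ac)
  qed
  have B0: "0 \<le> B" if "S \<in> \<S>" for S
  proof -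
    have "0 \<le> B * (vol S)\<^sup>2" by (rule order_trans[OF _ B[OF cube[OF that]]]) simp
    then show ?thesis using vol_pos[OF cube[OF that]] by (simp add: zero_le_mult_iff)
  qed
  have summand: "t S * (\<kappa> S * rmass v S) \<le> B * (os S / rmass z S powr s * (X S powr (1 / p) * Y S powr (1 - 1 / q)))"
    if S: "S \<in> \<S>" for S
  proof -
    note c = cube[OF S]
    have V: "0 < vol S" using vol_pos[OF c] .
    have zs: "0 < rmass z S powr s" using z[OF c] by simp
    have 1: "X S powr (1 / p) = H S * rmass u S powr (1 / p)"
      using pq(1) H0[of S] by (simp add: X_def powr_mult powr_powr)
    have 2: "Y S powr (1 - 1 / q) = \<kappa> S * rmass v S powr (1 - 1 / q)"
      using q'(1) \<kappa>0[of S] unfolding q'(2) by (simp add: Y_def powr_mult powr_powr)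
    \<comment> \<open>Each mass is split into two powers: one is absorbed by the characteristic, the
      other makes up \<open>X S\<close> or \<open>Y S\<close> for the embedding.\<close>
    have 3: "rmass u S = rmass u S powr (1 - 1 / p) * rmass u S powr (1 / p)"
      "rmass v S = rmass v S powr (1 / q) * rmass v S powr (1 - 1 / q)"
      using mu(2)[OF S] mv(2)[OF S] by (simp_all flip: powr_add)
    have BB: "rmass u S powr (1 - 1 / p) * rmass v S powr (1 / q) \<le> B * (vol S)\<^sup>2 / rmass z S powr s"
      using B[OF c] zs by (simp add: pos_le_divide_eq)
    have "t S * (\<kappa> S * rmass v S) = os S / (vol S)\<^sup>2 * (H S * \<kappa> S) * (rmass u S * rmass v S)"
      using mu(2)[OF S] by (simp add: t_def fa_def H_def power2_eq_square)
    also have "\<dots> = (os S / (vol S)\<^sup>2 * (H S * \<kappa> S) * (rmass u S powr (1 / p) * rmass v S powr (1 - 1 / q)))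
        * (rmass u S powr (1 - 1 / p) * rmass v S powr (1 / q))"
      by (subst (1) 3(1), subst (1) 3(2)) (simp only: mult_ac)
    also have "\<dots> \<le> (os S / (vol S)\<^sup>2 * (H S * \<kappa> S) * (rmass u S powr (1 / p) * rmass v S powr (1 - 1 / q)))
        * (B * (vol S)\<^sup>2 / rmass z S powr s)"
      using o[OF S] H0 \<kappa>0 by (intro mult_left_mono BB mult_nonneg_nonneg) auto
    also have "\<dots> = B * (os S / rmass z S powr s * (X S powr (1 / p) * Y S powr (1 - 1 / q)))"
      unfolding 1 2 using V by simp
    finally show ?thesis .
  qed
  define K where "K = B * N * (carleson_const p * Au * \<Phi>) powr (1 / p) * (carleson_const q' * Av) powr (1 - 1 / q)"
  have "I \<le> K powr q"
  proof (cases "\<S> = {}")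
    case False
    then have B0: "0 \<le> B" using B0 by blast
    have K0: "0 \<le> K" unfolding K_def using B0 N(1) by simp
    have "I \<le> B * (\<Sum>S\<in>\<S>. os S / rmass z S powr s * (X S powr (1 / p) * Y S powr (1 - 1 / q)))"
      unfolding I_def sum_distrib_left by (rule sum_mono) (rule summand)
    also have "\<dots> \<le> B * (N * ((\<Sum>S\<in>\<S>. X S) powr (1 / p) * (\<Sum>S\<in>\<S>. Y S) powr (1 - 1 / q)))"
      using XY0 by (intro mult_left_mono N(2) B0)
    also have "\<dots> \<le> B * (N * ((carleson_const p * Au * \<Phi>) powr (1 / p) * (carleson_const q' * Av * I) powr (1 - 1 / q)))"
      using B0 N(1) X Y XY0 pq by (intro mult_left_mono mult_mono powr_mono2 sum_nonneg) auto
    also have "\<dots> = K * I powr (1 - 1 / q)"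
    proof -
      have "0 \<le> carleson_const q' * Av"
        using q'(1) Av(2) by (simp add: carleson_const_def)
      then show ?thesis
        using I0 by (simp add: K_def powr_mult mult_ac)
    qed
    finally show ?thesis
      by (intro le_powr_self_improve[OF pq(2) I0 K0])
  qed (simp add: I_def)
  then show ?thesis
    using I unfolding G_def t_def fa_def K_def q'_def by (simp add: ennreal_leI)
qed

end

section \<open>Mean oscillation and characteristics\<close>

lemma ennpowr_tendsto_0:
  assumes "0 < s" "(f \<longlongrightarrow> (0::ennreal)) F"
  shows "((\<lambda>x. f x ennpowr s) \<longlongrightarrow> 0) F"
proof (rule order_tendstoI)
  fix a :: ennreal assume "0 < a"
  then obtain c where c: "0 < c" "ennreal c < a"
  proof -
    obtain y where "0 < y" "y < a" using dense[OF \<open>0 < a\<close>] by blast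
    moreover have "y < top" by (rule less_le_trans[OF \<open>y < a\<close> top_greatest])
    ultimately show ?thesis using that[of "enn2real y"] by (simp add: enn2real_positive_iff)
  qed
  have "eventually (\<lambda>x. f x < ennreal (c powr (1 / s))) F"
    using assms c by (intro order_tendstoD(2)[OF assms(2)]) simp
  then show "eventually (\<lambda>x. f x ennpowr s < a) F"
  proof eventually_elim
    case (elim x)
    have "f x ennpowr s \<le> ennreal (c powr (1 / s)) ennpowr s"
      using elim assms(1) by (intro ennpowr_mono) auto
    also have "\<dots> = ennreal c"
      using c assms(1) by (simp add: ennpowr_ennreal powr_powr)
    finally show ?case using c(2) by simp
  qed
qed simp

lemma nn_Lp_norm_real:
  "(\<And>x. 0 \<le> F x) \<Longrightarrow> (\<And>x. 0 \<le> w x) \<Longrightarrow>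
   nn_Lp_norm p w (\<lambda>x. ennreal (F x)) = (\<integral>\<^sup>+x. ennreal (F x powr p * w x) \<partial>lebesgue) ennpowr (1 / p)"
  unfolding nn_Lp_norm_def by (simp add: ennpowr_ennreal ennreal_mult)

lemma conj_exp_inverse: "1 < p \<Longrightarrow> 1 / conj_exp p = 1 - 1 / p"
  by (simp add: conj_exp_def field_simps)

text \<open>The first identity identifies the power of the dual weight in the characteristic. The
  second says that multiplication by the dual weight is an isometry between the two weighted spaces
  with exponent \<open>p\<close>.\<close>

lemma dual_weight_powr:
  assumes "1 < p" "0 < \<mu> x"
  shows "dual_weight p \<mu> x powr (1 - 1 / p) = \<mu> x powr (- (1 / p))"
    "(t / dual_weight p \<mu> x) powr p * dual_weight p \<mu> x = t powr p * \<mu> x"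
proof -
  have e: "conj_exp p / p = 1 / (p - 1)"
    using assms(1) by (simp add: conj_exp_def)
  show "dual_weight p \<mu> x powr (1 - 1 / p) = \<mu> x powr (- (1 / p))"
    unfolding dual_weight_def e powr_powr using assms(1) by (simp add: field_simps)
  have pos: "0 < dual_weight p \<mu> x" using assms by (simp add: dual_weight_def)
  have "(t / dual_weight p \<mu> x) powr p * dual_weight p \<mu> x = t powr p * dual_weight p \<mu> x powr (1 - p)"
  proof (cases "t = 0")
    case False
    have "dual_weight p \<mu> x powr (1 - p) = dual_weight p \<mu> x / dual_weight p \<mu> x powr p"
      using pos by (simp add: powr_diff)
    then show ?thesis using pos by (simp add: divide_powr_uminus powr_divide)
  qed simp
  also have "dual_weight p \<mu> x powr (1 - p) = \<mu> x"
  proof -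
    have "- (1 / (p - 1)) * (1 - p) = 1"
      using assms(1) by (simp add: field_simps)
    then show ?thesis
      unfolding dual_weight_def e powr_powr using assms(2) by simp
  qed
  finally show "(t / dual_weight p \<mu> x) powr p * dual_weight p \<mu> x = t powr p * \<mu> x" .
qed

context lattice begin

lemma wavg_eq:
  assumes "Q \<in> cubes D" "mass w Q < \<infinity>"
  shows "wavg w Q = ennreal (rmass w Q / vol Q)"
proof -
  have "mass w Q = ennreal (rmass w Q)" using assms(2) by simp
  then have "wavg w Q = ennreal (rmass w Q) / ennreal (vol Q)"
    unfolding wavg_def emeasure_cube[OF assms(1)] by simp
  also have "\<dots> = ennreal (rmass w Q / vol Q)"
    using vol_pos[OF assms(1)] by (intro divide_ennreal) auto
  finally show ?thesis .
qed

lemma wavg_pos: "Q \<in> cubes D \<Longrightarrow> 0 < mass w Q \<Longrightarrow> 0 < wavg w Q"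
  unfolding wavg_def by (simp only: emeasure_cube ennreal_zero_less_divide) simp

lemma oscillation_eq:
  assumes "Q \<in> cubes D" "set_integrable lebesgue Q b"
  shows "oscillation b Q = ennreal (LINT x:Q|lebesgue. norm (b x - avg b Q))"
proof -
  have "set_integrable lebesgue Q (\<lambda>x. avg b Q)"
    using lmeasurable_cube[OF assms(1)] by (auto simp: set_integrable_def fmeasurable_def)
  then have "set_integrable lebesgue Q (\<lambda>x. norm (b x - avg b Q))"
    using assms(2) by (intro set_integrable_norm set_integral_diff(1))
  from mass_eq_integral[OF this] show ?thesis
    by (simp add: oscillation_def mass_def)
qed

text \<open>The average over \<open>Q\<close> itself is one competitor in the maximal function.
  Positivity later excludes the product 0 * \<infinity>.\<close>

lemma A_inf_pos:
  assumes "Q \<in> cubes D" "0 < mass w Q" "mass w Q < \<infinity>"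
  shows "0 < A_inf D w"
proof -
  let ?I = "\<integral>\<^sup>+x\<in>Q. (SUP R\<in>{R \<in> cubes D. x \<in> R \<and> R \<subseteq> Q}. wavg w R) \<partial>lebesgue"
  have "0 < wavg w Q * emeasure lebesgue Q"
    using wavg_pos[OF assms(1,2)] vol_pos[OF assms(1)] emeasure_cube[OF assms(1)]
    by (simp add: ennreal_zero_less_mult_iff)
  also have "\<dots> = (\<integral>\<^sup>+x. wavg w Q * indicator Q x \<partial>lebesgue)"
    by (rule nn_integral_cmult_indicator[OF sets_cube[OF assms(1)], symmetric])
  also have "\<dots> \<le> ?I"
  proof (rule nn_integral_mono)
    fix x
    show "wavg w Q * indicator Q x
        \<le> (SUP R\<in>{R \<in> cubes D. x \<in> R \<and> R \<subseteq> Q}. wavg w R) * indicator Q x"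
      using assms(1) by (cases "x \<in> Q") (auto intro!: SUP_upper)
  qed
  finally have "0 < ?I / mass w Q"
    using assms(3) by (simp add: ennreal_zero_less_divide)
  also have "\<dots> \<le> A_inf D w"
    unfolding A_inf_def by (rule SUP_upper[OF assms(1)])
  finally show ?thesis .
qed

text \<open>The BMO bound makes the quotients at most \<open>N\<close>; what is left is Hoelder's
  inequality, whose exponents add up to at least 1 because p \<le> q.\<close>

lemma holder_BMO:
  fixes p q s N :: real and m os x y :: "'i \<Rightarrow> real"
  assumes pq: "1 < p" "1 < q" "p \<le> q"
    and os: "\<And>S. S \<in> \<S> \<Longrightarrow> 0 < m S" "\<And>S. S \<in> \<S> \<Longrightarrow> os S \<le> N * m S powr s" and N: "0 \<le> N"
    and nn: "\<And>S. S \<in> \<S> \<Longrightarrow> 0 \<le> x S" "\<And>S. S \<in> \<S> \<Longrightarrow> 0 \<le> y S"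
  shows "(\<Sum>S\<in>\<S>. os S / m S powr s * (x S powr (1 / p) * y S powr (1 - 1 / q)))
        \<le> N * ((\<Sum>S\<in>\<S>. x S) powr (1 / p) * (\<Sum>S\<in>\<S>. y S) powr (1 - 1 / q))"
proof -
  have "(\<Sum>S\<in>\<S>. os S / m S powr s * (x S powr (1 / p) * y S powr (1 - 1 / q)))
      \<le> (\<Sum>S\<in>\<S>. N * (x S powr (1 / p) * y S powr (1 - 1 / q)))"
  proof (intro sum_mono mult_right_mono)
    fix S assume S: "S \<in> \<S>"
    have "0 < m S powr s" using os(1)[OF S] by simp
    then show "os S / m S powr s \<le> N"
      using os(2)[OF S] by (simp only: pos_divide_le_eq)
  qed simp
  also have "\<dots> = N * (\<Sum>S\<in>\<S>. x S powr (1 / p) * y S powr (1 - 1 / q))"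
    by (simp add: sum_distrib_left)
  also have "\<dots> \<le> N * ((\<Sum>S\<in>\<S>. x S) powr (1 / p) * (\<Sum>S\<in>\<S>. y S) powr (1 - 1 / q))"
    using pq nn N by (intro mult_left_mono sum_powr_holder) (auto simp: frac_le)
  finally show ?thesis .
qed

text \<open>Since \<open>1 - s = 1 / r\<close>, the quotient by the power \<open>s\<close> of the
  mass is \<open>\<zeta> S\<close> times its power \<open>1 / r\<close>. Hoelder's inequality with
  three exponents adding up to 1 then leaves a sum that the embedding theorem, applied to the sharp
  maximal function, controls.\<close>

lemma holder_sharp_max:
  assumes pq: "1 < p" "1 < q" "q < p" and r: "1 / r = 1 / q - 1 / p" and s: "s = 1 / p + (1 - 1 / q)"
    and S: "sparse \<S>"
    and z: "z \<in> borel_measurable lebesgue" "\<And>x. 0 < z x" "\<And>Q. Q \<in> cubes D \<Longrightarrow> mass z Q < \<infinity>"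
    and b: "\<And>Q. Q \<in> cubes D \<Longrightarrow> set_integrable lebesgue Q b"
    and A: "A_inf D z \<le> ennreal A" "0 \<le> A"
    and R: "(\<integral>\<^sup>+x. (sharp_max D z b x) ennpowr r * ennreal (z x) \<partial>lebesgue) \<le> ennreal R" "0 \<le> R"
    and nn: "\<And>S. S \<in> \<S> \<Longrightarrow> 0 \<le> x S" "\<And>S. S \<in> \<S> \<Longrightarrow> 0 \<le> y S"
  shows "(\<Sum>S\<in>\<S>. (LINT x:S|lebesgue. norm (b x - avg b S)) / rmass z S powr s * (x S powr (1 / p) * y S powr (1 - 1 / q)))
        \<le> (carleson_const r * A * R) powr (1 / r) * ((\<Sum>S\<in>\<S>. x S) powr (1 / p) * (\<Sum>S\<in>\<S>. y S) powr (1 - 1 / q))"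
proof -
  have r1: "1 < r"
  proof -
    have "0 < 1 / r" using pq r by (simp add: frac_less2)
    moreover have "1 / r < 1" using pq r by (smt (verit) divide_less_eq_1_pos divide_pos_pos)
    ultimately show ?thesis
      by (metis divide_less_eq_1_pos less_divide_eq_1_pos zero_less_divide_1_iff)
  qed
  have fin: "finite \<S>" "\<S> \<subseteq> cubes D" using S by (auto simp: sparse_def)
  note cube = subsetD[OF fin(2)]
  define os where "os S = (LINT x:S|lebesgue. norm (b x - avg b S))" for S
  have os0: "0 \<le> os S" for S
    unfolding os_def set_lebesgue_integral_def by (intro Bochner_Integration.integral_nonneg) auto
  have osc: "oscillation b S = ennreal (os S)" if "S \<in> \<S>" for S
    unfolding os_def by (rule oscillation_eq[OF cube[OF that] b[OF cube[OF that]]])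
  have mz: "mass z S = ennreal (rmass z S)" "0 < rmass z S" if "S \<in> \<S>" for S
    using z(3)[OF cube[OF that]] mass_cube_pos[OF z(1,2) cube[OF that]]
    by (auto simp: enn2real_positive_iff)
  define \<zeta> where "\<zeta> S = os S / rmass z S" for S
  have \<zeta>0: "0 \<le> \<zeta> S" for S using os0 by (simp add: \<zeta>_def)
  \<comment> \<open>The maximum over the finite family stands in for \<open>sharp_max\<close>: it
    lies below it, and it is visibly finite and measurable.\<close>
  define m where "m x = (SUP S\<in>\<S>. ennreal (\<zeta> S) * indicator S x)" for x
  have m_fin: "m x < \<infinity>" for x
  proof -
    have "m x \<le> ennreal (\<Sum>S\<in>\<S>. \<zeta> S)"
      unfolding m_def
    proof (rule SUP_least)
      fix S assume "S \<in> \<S>"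
      then have "\<zeta> S \<le> (\<Sum>S\<in>\<S>. \<zeta> S)" using \<zeta>0 fin(1) by (intro member_le_sum) auto
      then show "ennreal (\<zeta> S) * indicator S x \<le> ennreal (\<Sum>S\<in>\<S>. \<zeta> S)"
        by (auto simp: indicator_def intro: ennreal_leI)
    qed
    then show ?thesis by (simp add: le_less_trans)
  qed
  have m_sharp: "m x \<le> sharp_max D z b x" for x
    unfolding m_def
  proof (rule SUP_least)
    fix S assume S: "S \<in> \<S>"
    have "ennreal (\<zeta> S) = oscillation b S / mass z S"
      unfolding osc[OF S] \<zeta>_def using mz(2)[OF S] os0[of S]
      by (subst mz(1)[OF S]) (rule divide_ennreal[symmetric])
    then have "ennreal (\<zeta> S) * indicator S x = indicator S x * (oscillation b S / mass z S)"
      by (simp add: mult.commute)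
    also have "\<dots> \<le> sharp_max D z b x"
      unfolding sharp_max_def by (rule SUP_upper[OF cube[OF S]])
    finally show "ennreal (\<zeta> S) * indicator S x \<le> sharp_max D z b x" .
  qed
  have [measurable]: "m \<in> borel_measurable lebesgue"
    unfolding m_def
  proof (rule borel_measurable_SUP)
    show "countable \<S>" using fin(1) by (rule countable_finite)
    fix S assume "S \<in> \<S>"
    then have [measurable]: "S \<in> sets lebesgue" using sets_cube[OF cube] by blast
    show "(\<lambda>x. ennreal (\<zeta> S) * indicator S x) \<in> borel_measurable lebesgue" by measurable
  qed
  have "(\<Sum>S\<in>\<S>. \<zeta> S powr r * rmass z S) \<le> 2 powr r * (r / (r - 1)) * (2 * A) * R"
  proof (rule carleson_embedding_sparse[OF r1 S z _ _ A \<zeta>0 _ _ R(2)])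
    show "(\<lambda>x. enn2real (m x)) \<in> borel_measurable lebesgue" by measurable
    have "(\<integral>\<^sup>+x. ennreal (enn2real (m x) powr r * z x) \<partial>lebesgue)
        \<le> (\<integral>\<^sup>+x. (sharp_max D z b x) ennpowr r * ennreal (z x) \<partial>lebesgue)"
    proof (rule nn_integral_mono)
      fix x
      have "ennreal (enn2real (m x) powr r * z x) = (m x) ennpowr r * ennreal (z x)"
        using m_fin[of x] z(2)[of x] by (simp add: ennpowr_def ennreal_mult less_imp_le)
      also have "\<dots> \<le> (sharp_max D z b x) ennpowr r * ennreal (z x)"
        using r1 m_sharp by (intro mult_right_mono ennpowr_mono) auto
      finally show "ennreal (enn2real (m x) powr r * z x) \<le> (sharp_max D z b x) ennpowr r * ennreal (z x)" .
    qed
    then show "(\<integral>\<^sup>+x. ennreal (enn2real (m x) powr r * z x) \<partial>lebesgue) \<le> ennreal R"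
      using R(1) by (rule order_trans)
    fix S assume S: "S \<in> \<S>"
    note [measurable] = sets_cube[OF cube[OF S]] z(1)
    have "ennreal (\<zeta> S) * mass z S = (\<integral>\<^sup>+x. ennreal (\<zeta> S) * (ennreal (z x) * indicator S x) \<partial>lebesgue)"
      unfolding mass_def by (rule nn_integral_cmult[symmetric]) measurable
    also have "\<dots> \<le> (\<integral>\<^sup>+x\<in>S. ennreal (enn2real (m x) * z x) \<partial>lebesgue)"
    proof (rule nn_integral_mono)
      fix x
      have "ennreal (\<zeta> S) \<le> m x" if "x \<in> S"
        unfolding m_def using that by (intro SUP_upper2[OF S]) simp
      then have "\<zeta> S \<le> enn2real (m x)" if "x \<in> S"
        using that m_fin[of x] \<zeta>0[of S] by (metis enn2real_ennreal enn2real_mono infinity_ennreal_def)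
      then show "ennreal (\<zeta> S) * (ennreal (z x) * indicator S x) \<le> ennreal (enn2real (m x) * z x) * indicator S x"
        using z(2)[of x] \<zeta>0[of S] 
        by (auto simp: indicator_def simp flip: ennreal_mult intro!: ennreal_leI mult_right_mono)
    qed
    finally show "ennreal (\<zeta> S) * mass z S \<le> (\<integral>\<^sup>+x\<in>S. ennreal (enn2real (m x) * z x) \<partial>lebesgue)" .
  qed (assumption, rule enn2real_nonneg)
  then have Z: "(\<Sum>S\<in>\<S>. \<zeta> S powr r * rmass z S) \<le> carleson_const r * A * R"
    by (simp add: carleson_const_def mult_ac)
  have "(\<Sum>S\<in>\<S>. os S / rmass z S powr s * (x S powr (1 / p) * y S powr (1 - 1 / q)))
      = (\<Sum>S\<in>\<S>. x S powr (1 / p) * y S powr (1 - 1 / q) * (\<zeta> S powr r * rmass z S) powr (1 / r))"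
  proof (rule sum.cong)
    fix S assume S: "S \<in> \<S>"
    have e: "1 / r = 1 - s" using r s by simp
    have "(\<zeta> S powr r * rmass z S) powr (1 / r) = \<zeta> S * rmass z S powr (1 / r)"
      using r1 \<zeta>0[of S] by (simp add: powr_mult powr_powr)
    also have "\<dots> = os S / rmass z S powr s"
      unfolding e using mz(2)[OF S] by (simp add: \<zeta>_def powr_diff)
    finally show "os S / rmass z S powr s * (x S powr (1 / p) * y S powr (1 - 1 / q))
      = x S powr (1 / p) * y S powr (1 - 1 / q) * (\<zeta> S powr r * rmass z S) powr (1 / r)"
      by simp
  qed simp
  also have "\<dots> \<le> (\<Sum>S\<in>\<S>. x S) powr (1 / p) * (\<Sum>S\<in>\<S>. y S) powr (1 - 1 / q)
      * (\<Sum>S\<in>\<S>. \<zeta> S powr r * rmass z S) powr (1 / r)"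
    using pq r1 r nn frac_less2[of 1 1 q p] by (intro sum_powr_holder_3) auto
  also have "\<dots> \<le> (\<Sum>S\<in>\<S>. x S) powr (1 / p) * (\<Sum>S\<in>\<S>. y S) powr (1 - 1 / q)
      * (carleson_const r * A * R) powr (1 / r)"
    using Z r1 by (intro mult_left_mono powr_mono2 sum_nonneg) auto
  finally show ?thesis
    by (simp add: os_def mult_ac)
qed


text \<open>Passing from averages to masses multiplies by the volume to the sum of the exponents,
  which is 2.\<close>

lemma B_char_bound:
  assumes pq: "1 < p" "1 < q"
    and fin: "\<And>Q. Q \<in> cubes D \<Longrightarrow> mass u Q < \<infinity>" "\<And>Q. Q \<in> cubes D \<Longrightarrow> mass v Q < \<infinity>"
      "\<And>Q. Q \<in> cubes D \<Longrightarrow> mass z Q < \<infinity>"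
    and B: "B_char D p q u v z \<le> ennreal B" "0 \<le> B" and Q: "Q \<in> cubes D"
  shows "rmass u Q powr (1 - 1 / p) * rmass v Q powr (1 / q) * rmass z Q powr (1 / p + (1 - 1 / q))
    \<le> B * (vol Q)\<^sup>2"
proof -
  define V where "V = vol Q"
  have V: "0 < V" using vol_pos[OF Q] by (simp add: V_def)
  define P where "P = rmass u Q powr (1 - 1 / p) * rmass v Q powr (1 / q) * rmass z Q powr (1 / p + (1 - 1 / q))"
  have "wavg u Q ennpowr (1 / conj_exp p) * wavg v Q ennpowr (1 / q) * wavg z Q ennpowr (1 / p + 1 / conj_exp q)
      \<le> ennreal B"
    by (rule order_trans[OF _ B(1)]) (unfold B_char_def, rule SUP_upper[OF Q])
  then have "ennreal ((rmass u Q / V) powr (1 - 1 / p) * (rmass v Q / V) powr (1 / q)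
      * (rmass z Q / V) powr (1 / p + (1 - 1 / q))) \<le> ennreal B"
    unfolding wavg_eq[OF Q fin(1)[OF Q]] wavg_eq[OF Q fin(2)[OF Q]] wavg_eq[OF Q fin(3)[OF Q]]
      conj_exp_inverse[OF pq(1)] conj_exp_inverse[OF pq(2)] V_def[symmetric]
    using V by (simp add: ennpowr_ennreal ennreal_mult)
  then have "(rmass u Q / V) powr (1 - 1 / p) * (rmass v Q / V) powr (1 / q)
      * (rmass z Q / V) powr (1 / p + (1 - 1 / q)) \<le> B"
    by (simp only: ennreal_le_iff[OF B(2)])
  also have "(rmass u Q / V) powr (1 - 1 / p) * (rmass v Q / V) powr (1 / q)
      * (rmass z Q / V) powr (1 / p + (1 - 1 / q))
    = P / (V powr (1 - 1 / p) * V powr (1 / q) * V powr (1 / p + (1 - 1 / q)))"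
    using V by (simp add: P_def powr_divide)
  also have "V powr (1 - 1 / p) * V powr (1 / q) * V powr (1 / p + (1 - 1 / q)) = V powr 2"
    by (simp only: powr_add[symmetric]) simp
  finally have "P / V\<^sup>2 \<le> B" using V by simp
  then show ?thesis
    using V by (simp add: P_def V_def pos_divide_le_eq)
qed

lemma B_char_pos:
  assumes "Q \<in> cubes D" "0 < mass u Q" "0 < mass v Q" "0 < mass z Q"
  shows "0 < B_char D p q u v z"
proof -
  have "0 < wavg u Q ennpowr (1 / conj_exp p) * wavg v Q ennpowr (1 / q) * wavg z Q ennpowr (1 / p + 1 / conj_exp q)"
    using assms by (simp add: ennreal_zero_less_mult_iff ennpowr_pos wavg_pos)
  also have "\<dots> \<le> B_char D p q u v z"
    unfolding B_char_def by (rule SUP_upper[OF assms(1)])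
  finally show ?thesis .
qed

text \<open>Local integrability of the dual weight is not assumed but follows: an infinite average
  times two positive factors would make the characteristic infinite.\<close>

lemma B_char_mass_finite:
  assumes B: "B_char D p q u v z < \<infinity>" and Q: "Q \<in> cubes D" "0 < mass v Q" "0 < mass z Q"
  shows "mass u Q < \<infinity>"
proof (rule ccontr)
  assume "\<not> mass u Q < \<infinity>"
  then have "wavg u Q = \<infinity>"
    unfolding wavg_def emeasure_cube[OF Q(1)] by (simp add: not_less top_unique ennreal_top_divide)
  then have "wavg u Q ennpowr (1 / conj_exp p) = \<infinity>"
    by (simp add: ennpowr_def)
  moreover have "wavg v Q ennpowr (1 / q) \<noteq> 0" "wavg z Q ennpowr (1 / p + 1 / conj_exp q) \<noteq> 0"
    using ennpowr_pos[OF wavg_pos[OF Q(1,2)]] ennpowr_pos[OF wavg_pos[OF Q(1,3)]] by (metis less_irrefl)+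
  ultimately have "wavg u Q ennpowr (1 / conj_exp p) * wavg v Q ennpowr (1 / q) * wavg z Q ennpowr (1 / p + 1 / conj_exp q) = \<infinity>"
    by (simp add: ennreal_top_mult)
  moreover have "wavg u Q ennpowr (1 / conj_exp p) * wavg v Q ennpowr (1 / q) * wavg z Q ennpowr (1 / p + 1 / conj_exp q)
      \<le> B_char D p q u v z"
    unfolding B_char_def by (rule SUP_upper[OF Q(1)])
  ultimately show False using B by (simp add: top_unique)
qed

text \<open>Halving the exponents makes them add up to 1 and turns the square of the volume into the
  volume, at the cost of a square root of \<open>K\<close>. The hypotheses are symmetric in the
  three weights, so each may be put first.\<close>

lemma A_inf_finite_triple:
  assumes w: "u \<in> borel_measurable lebesgue" "v \<in> borel_measurable lebesgue" "z \<in> borel_measurable lebesgue"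
    and pos: "\<And>x. 0 < u x" "\<And>x. 0 < v x" "\<And>x. 0 < z x"
    and fin: "\<And>Q. Q \<in> cubes D \<Longrightarrow> mass u Q < \<infinity>" "\<And>Q. Q \<in> cubes D \<Longrightarrow> mass v Q < \<infinity>"
      "\<And>Q. Q \<in> cubes D \<Longrightarrow> mass z Q < \<infinity>"
    and e: "0 < a" "0 < b" "0 < c" "a + b + c = 2"
    and one: "\<And>x. u x powr a * v x powr b * z x powr c = 1"
    and K: "\<And>Q. Q \<in> cubes D \<Longrightarrow>
      rmass u Q powr a * rmass v Q powr b * rmass z Q powr c \<le> K * (vol Q)\<^sup>2"
  shows "A_inf D u < \<infinity>"
proof -
  have e': "0 < a / 2" "0 < b / 2" "0 < c / 2" "a / 2 + b / 2 + c / 2 = 1"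
    using e by (auto simp flip: add_divide_distrib)
  have half: "x powr (a / 2) * y powr (b / 2) * t powr (c / 2) = (x powr a * y powr b * t powr c) powr (1 / 2)"
    if "0 \<le> x" "0 \<le> y" "0 \<le> t" for x y t :: real
    using that by (simp add: powr_mult powr_powr)
  have one': "u x powr (a / 2) * v x powr (b / 2) * z x powr (c / 2) = 1" for x
    using half[of "u x" "v x" "z x"] one[of x] pos[of x] by (simp add: less_imp_le)
  have K': "rmass u Q powr (a / 2) * rmass v Q powr (b / 2) * rmass z Q powr (c / 2) \<le> K powr (1 / 2) * vol Q"
    if Q: "Q \<in> cubes D" for Q
  proof -
    have V: "0 < vol Q" using vol_pos[OF Q] .
    have "0 \<le> K * (vol Q)\<^sup>2" by (rule order_trans[OF _ K[OF Q]]) simp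
    then have K0: "0 \<le> K" using V by (simp add: zero_le_mult_iff)
    have "rmass u Q powr (a / 2) * rmass v Q powr (b / 2) * rmass z Q powr (c / 2) \<le> (K * (vol Q)\<^sup>2) powr (1 / 2)"
      unfolding half[OF enn2real_nonneg enn2real_nonneg enn2real_nonneg] using K[OF Q] by (intro powr_mono2) auto
    also have "\<dots> = K powr (1 / 2) * vol Q"
      using V K0 by (simp add: powr_mult powr_half_sqrt)
    finally show ?thesis .
  qed
  have "A_inf D u \<le> ennreal (2 * (2 * K powr (1 / 2)) powr (1 / (a / 2)))"
    by (rule A_inf_finite[OF w(1) pos(1) fin(1)])
       (assumption, rule mass_large_subset[OF w pos e' one' fin K'], assumption+)
  then show ?thesis by (simp add: le_less_trans)
qed

text \<open>Writing \<open>norm (f x)\<close> as \<open>h\<close> times the dual weight and using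
  \<open>h \<le> 1 + h powr p\<close> bounds it by the dual weight plus an integrable
  function.\<close>

lemma cube_integrable_Lp:
  assumes p: "1 < p" and \<mu>: "\<And>x. 0 < \<mu> x" and f: "f \<in> borel_measurable lebesgue"
    and \<Phi>: "(\<integral>\<^sup>+x. ennreal (norm (f x) powr p * \<mu> x) \<partial>lebesgue) < \<infinity>"
    and u: "dual_weight p \<mu> \<in> borel_measurable lebesgue"
    and \<mu>_meas: "\<mu> \<in> borel_measurable lebesgue" and Q: "Q \<in> cubes D" "mass (dual_weight p \<mu>) Q < \<infinity>"
  shows "set_integrable lebesgue Q (f :: real^'n \<Rightarrow> complex)"
  unfolding set_integrable_def
proof (rule integrableI_bounded)
  note [measurable] = sets_cube[OF Q(1)] f u \<mu>_meas
  let ?u = "dual_weight p \<mu>"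
  show "(\<lambda>x. indicat_real Q x *\<^sub>R f x) \<in> borel_measurable lebesgue" by measurable
  have "(\<integral>\<^sup>+x. ennreal (norm (indicat_real Q x *\<^sub>R f x)) \<partial>lebesgue)
      \<le> (\<integral>\<^sup>+x. ennreal (?u x) * indicator Q x + ennreal (norm (f x) powr p * \<mu> x) \<partial>lebesgue)"
  proof (rule nn_integral_mono)
    fix x
    have u0: "0 < ?u x" using \<mu>[of x] by (simp add: dual_weight_def)
    define h where "h = norm (f x) / ?u x"
    have h: "0 \<le> h" "norm (f x) = h * ?u x" using u0 by (auto simp: h_def)
    have "h \<le> 1 + h powr p"
    proof (cases "h \<le> 1")
      case False
      then have "h powr 1 \<le> h powr p" using p by (intro powr_mono) auto
      then show ?thesis using False by simp
    qed (simp add: add_increasing2)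
    then have "norm (f x) \<le> (1 + h powr p) * ?u x"
      unfolding h(2) using u0 by (intro mult_right_mono) auto
    also have "\<dots> = ?u x + norm (f x) powr p * \<mu> x"
      using dual_weight_powr(2)[of p \<mu> x "norm (f x)", OF p \<mu>] by (simp add: h_def distrib_right)
    finally have "ennreal (norm (f x)) \<le> ennreal (?u x) + ennreal (norm (f x) powr p * \<mu> x)"
      using u0 \<mu>[of x] by (simp add: less_imp_le ennreal_leI flip: ennreal_plus)
    then show "ennreal (norm (indicat_real Q x *\<^sub>R f x))
        \<le> ennreal (?u x) * indicator Q x + ennreal (norm (f x) powr p * \<mu> x)"
      by (simp add: indicator_def)
  qed
  also have "\<dots> = mass ?u Q + (\<integral>\<^sup>+x. ennreal (norm (f x) powr p * \<mu> x) \<partial>lebesgue)"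
    unfolding mass_def by (rule nn_integral_add) measurable
  also have "\<dots> < \<infinity>" using Q(2) \<Phi> by simp
  finally show "(\<integral>\<^sup>+x. ennreal (norm (indicat_real Q x *\<^sub>R f x)) \<partial>lebesgue) < \<infinity>" .
qed

text \<open>The abstract convergence theorem for the measure with density \<open>lam\<close>, after
  which \<open>q\<close>-th roots are taken.\<close>

lemma Lp_has_sum_mart_diff:
  fixes f b :: "real^'n \<Rightarrow> complex"
  assumes q: "1 < q" and lam: "lam \<in> borel_measurable lebesgue" "\<And>x. 0 < lam x" and Z: "0 \<le> Z"
    and bound: "\<And>Y \<theta>. finite Y \<Longrightarrow> Y \<subseteq> cubes D \<Longrightarrow> (\<And>Q. \<bar>\<theta> Q\<bar> \<le> 1) \<Longrightarrow>
      (\<integral>\<^sup>+x. ennreal (norm (\<Sum>Q\<in>Y. complex_of_real (\<theta> Q) * avg f Q * mart_diff D b Q x) powr q * lam x) \<partial>lebesgue)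
      \<le> ennreal (Z powr q)"
  shows "\<exists>g. is_paraproduct D q lam b f g \<and> Lp_norm q lam g \<le> ennreal Z"
proof -
  define M where "M = density lebesgue (\<lambda>x. ennreal (lam x))"
  have meas_M: "borel_measurable M = borel_measurable lebesgue"
    by (simp add: M_def cong: measurable_cong_sets)
  note [measurable] = lam(1)
  have nM: "nn_powr M q g = (\<integral>\<^sup>+x. ennreal (norm (g x) powr q * lam x) \<partial>lebesgue)"
    if [measurable]: "g \<in> borel_measurable lebesgue" for g
    unfolding M_def using lam(2) by (subst nn_integral_density) (auto simp: ennreal_mult less_imp_le mult.commute)
  have Lp: "Lp_norm q lam g = (nn_powr M q g) ennpowr (1 / q)" if "g \<in> borel_measurable lebesgue" for g
    unfolding Lp_norm_def nM[OF that] using lam(2) by (intro nn_Lp_norm_real) (auto simp: less_imp_le)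
  define F where "F = (\<lambda>Q x. mart_diff D b Q x * avg f Q)"
  have F: "F Q \<in> borel_measurable lebesgue" if "Q \<in> cubes D" for Q
    unfolding F_def using borel_measurable_integrable[OF integrable_mart_diff[OF that]]
    by (intro borel_measurable_times) auto
  have sumF: "(\<lambda>x. \<Sum>Q\<in>Y. F Q x) \<in> borel_measurable lebesgue" if "Y \<subseteq> cubes D" for Y
    using F that by (intro borel_measurable_sum) (rule F, rule subsetD)
  have eq: "(\<Sum>Q\<in>Y. complex_of_real (\<theta> Q) * F Q x)
      = (\<Sum>Q\<in>Y. complex_of_real (\<theta> Q) * avg f Q * mart_diff D b Q x)" for Y \<theta> x
    by (simp add: F_def mult_ac)
  have bd: "nn_powr M q (\<lambda>x. \<Sum>Q\<in>Y. complex_of_real (\<theta> Q) * F Q x) \<le> ennreal (Z powr q)"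
    if Y: "finite Y" "Y \<subseteq> cubes D" "\<And>Q. \<bar>\<theta> Q\<bar> \<le> 1" for Y \<theta>
  proof (subst nM)
    show "(\<lambda>x. \<Sum>Q\<in>Y. complex_of_real (\<theta> Q) * F Q x) \<in> borel_measurable lebesgue"
      by (intro borel_measurable_sum borel_measurable_times borel_measurable_const F subsetD[OF Y(2)])
    show "(\<integral>\<^sup>+x. ennreal (norm (\<Sum>Q\<in>Y. complex_of_real (\<theta> Q) * F Q x) powr q * lam x) \<partial>lebesgue) \<le> ennreal (Z powr q)"
      unfolding eq by (rule bound[OF Y])
  qed
  have F_M: "F Q \<in> borel_measurable M" if "Q \<in> cubes D" for Q
    unfolding meas_M by (rule F[OF that])
  obtain g where g: "g \<in> borel_measurable lebesgue" "nn_powr M q g \<le> ennreal (Z powr q)"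
    "((\<lambda>X. nn_powr M q (\<lambda>x. (\<Sum>i\<in>X. F i x) - g x)) \<longlongrightarrow> 0) (finite_subsets_at_top (cubes D))"
  proof -
    have "\<exists>g\<in>borel_measurable M. nn_powr M q g \<le> ennreal (Z powr q) \<and>
        ((\<lambda>X. nn_powr M q (\<lambda>x. (\<Sum>i\<in>X. F i x) - g x)) \<longlongrightarrow> 0) (finite_subsets_at_top (cubes D))"
      by (rule bounded_multipliers_sum[OF q]) (rule F_M, assumption, rule bd)
    then show ?thesis
      using that unfolding meas_M by (elim bexE conjE)
  qed
  have Zq: "ennreal (Z powr q) ennpowr (1 / q) = ennreal Z"
    using Z q by (simp add: ennpowr_ennreal powr_powr)
  have le: "Lp_norm q lam h \<le> ennreal Z" if "h \<in> borel_measurable lebesgue" "nn_powr M q h \<le> ennreal (Z powr q)" for h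
    unfolding Lp[OF that(1)] Zq[symmetric] using q that(2) by (intro ennpowr_mono) auto
  have "Lp_has_sum q lam F (cubes D) g"
    unfolding Lp_has_sum_def
  proof (intro conjI ballI)
    fix Q assume Q: "Q \<in> cubes D"
    have "nn_powr M q (F Q) \<le> ennreal (Z powr q)"
      using bd[of "{Q}" "\<lambda>_. 1"] Q by simp
    then show "F Q \<in> Lp_space q lam"
      using F[OF Q] le[OF F[OF Q]] by (auto simp: Lp_space_def intro: le_less_trans)
  next
    show "g \<in> Lp_space q lam"
      using g(1) le[OF g(1,2)] by (auto simp: Lp_space_def intro: le_less_trans)
    show "((\<lambda>X. Lp_norm q lam (\<lambda>x. (\<Sum>i\<in>X. F i x) - g x)) \<longlongrightarrow> 0) (finite_subsets_at_top (cubes D))"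
    proof (rule Lim_transform_eventually)
      show "((\<lambda>X. (nn_powr M q (\<lambda>x. (\<Sum>i\<in>X. F i x) - g x)) ennpowr (1 / q)) \<longlongrightarrow> 0) (finite_subsets_at_top (cubes D))"
        using q by (intro ennpowr_tendsto_0 g(3)) simp
      show "eventually (\<lambda>X. (nn_powr M q (\<lambda>x. (\<Sum>i\<in>X. F i x) - g x)) ennpowr (1 / q)
          = Lp_norm q lam (\<lambda>x. (\<Sum>i\<in>X. F i x) - g x)) (finite_subsets_at_top (cubes D))"
      proof (rule eventually_mono[rotated])
        show "eventually (\<lambda>X. X \<subseteq> cubes D) (finite_subsets_at_top (cubes D))"
          by (rule eventually_finite_subsets_at_top_weakI) simp
        fix X assume "X \<subseteq> cubes D"
        then have "(\<lambda>x. (\<Sum>i\<in>X. F i x) - g x) \<in> borel_measurable lebesgue"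
          using g(1) by (intro borel_measurable_diff sumF)
        then show "(nn_powr M q (\<lambda>x. (\<Sum>i\<in>X. F i x) - g x)) ennpowr (1 / q)
          = Lp_norm q lam (\<lambda>x. (\<Sum>i\<in>X. F i x) - g x)"
          by (rule Lp[symmetric])
      qed
    qed
  qed
  then have "is_paraproduct D q lam b f g"
    by (simp add: is_paraproduct_def F_def)
  then show ?thesis using le[OF g(1,2)] by blast
qed

end

section \<open>The paraproduct\<close>

lemma carleson_const_pos: "1 < p \<Longrightarrow> 0 < carleson_const p"
  by (simp add: carleson_const_def)

lemma weightD:
  assumes "weight w"
  shows "w \<in> borel_measurable lebesgue" "\<And>x. 0 < w x"
  using assms locally_integrable_measurable by (auto simp: weight_def)

lemma exponent_gt_1:
  fixes p q r :: real
  assumes "1 < p" "1 < q" "q < p" "1 / r = 1 / q - 1 / p"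
  shows "1 < r"
proof -
  have "1 / p < 1 / q" "1 / q < 1" "0 < 1 / p"
    using assms by (auto simp: frac_less2)
  then have "0 < 1 / r" "1 / r < 1" using assms(4) by linarith+
  then show ?thesis
    by (metis divide_less_eq_1_pos zero_less_divide_1_iff)
qed

context lattice begin

lemma paraproduct_bound:
  fixes f b :: "real^'n \<Rightarrow> complex" and p q r \<alpha> :: real
  assumes pq: "1 < p" "1 < q" and r: "1 / r = 1 / q - 1 / p"
    and \<alpha>: "\<alpha> / real CARD('n) = 1 / p - 1 / q"
    and w: "weight \<mu>" "weight lam" "weight \<nu>"
    and rel: "\<And>x. \<nu> x powr (1 / p + 1 / conj_exp q) = \<mu> x powr (1 / p) * lam x powr (- (1 / q))"
    and Bfin: "B_char D p q (dual_weight p \<mu>) lam \<nu> < \<infinity>"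
    and b: "locally_integrable b"
    and fin: "(if p \<le> q then BMO_norm D \<alpha> \<nu> b else nn_Lp_norm r \<nu> (sharp_max D \<nu> b)) < \<infinity>"
    and f: "f \<in> Lp_space p \<mu>"
  shows "\<exists>g. is_paraproduct D q lam b f g \<and> Lp_norm q lam g \<le>
    ennreal (512 * 2 ^ CARD('n) * carleson_const p powr (1 / p) *
        carleson_const (q / (q - 1)) powr (1 - 1 / q) * (if p \<le> q then 1 else carleson_const r powr (1 / r))) *
      B_char D p q (dual_weight p \<mu>) lam \<nu> *
      A_inf D (dual_weight p \<mu>) ennpowr (1 / p) * A_inf D lam ennpowr (1 / conj_exp q) *
      (if p \<le> q then BMO_norm D \<alpha> \<nu> b
       else A_inf D \<nu> ennpowr (1 / r) * nn_Lp_norm r \<nu> (sharp_max D \<nu> b)) * Lp_norm p \<mu> f"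
proof -
  define u where "u = dual_weight p \<mu>"
  define s where "s = 1 / p + (1 - 1 / q)"
  note m\<mu> = weightD[OF w(1)] and mlam = weightD[OF w(2)] and m\<nu> = weightD[OF w(3)]
  have mu: "u \<in> borel_measurable lebesgue" "\<And>x. 0 < u x"
  proof -
    note [measurable] = m\<mu>(1)
    show "u \<in> borel_measurable lebesgue" unfolding u_def dual_weight_def by measurable
    show "0 < u x" for x using m\<mu>(2)[of x] by (simp add: u_def dual_weight_def)
  qed
  have fl: "mass lam Q < \<infinity>" "0 < mass lam Q" "mass \<nu> Q < \<infinity>" "0 < mass \<nu> Q" if "Q \<in> cubes D" for Q
    by (rule weight_mass[OF w(2) that] weight_mass[OF w(3) that])+
  have fu: "mass u Q < \<infinity>" if "Q \<in> cubes D" for Q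
    using B_char_mass_finite[OF Bfin that] fl[OF that] by (simp add: u_def)
  have e: "0 < 1 - 1 / p" "0 < 1 / q" "0 < s" using pq by (auto simp: s_def add_pos_pos)
  \<comment> \<open>The relation between the weights in symmetric form: the product of the very
    powers that occur in the characteristic is 1.\<close>
  have one: "u x powr (1 - 1 / p) * lam x powr (1 / q) * \<nu> x powr s = 1" for x
  proof -
    have "\<nu> x powr s = \<mu> x powr (1 / p) * lam x powr (- (1 / q))"
      using rel[of x] by (simp add: s_def conj_exp_inverse[OF pq(2)])
    then have "u x powr (1 - 1 / p) * lam x powr (1 / q) * \<nu> x powr s
        = (\<mu> x powr (- (1 / p)) * \<mu> x powr (1 / p)) * (lam x powr (1 / q) * lam x powr (- (1 / q)))"
      using dual_weight_powr(1)[of p \<mu> x, OF pq(1) m\<mu>(2)] by (simp add: u_def mult_ac)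
    also have "\<dots> = 1"
      using m\<mu>(2)[of x] mlam(2)[of x] by (simp flip: powr_add)
    finally show ?thesis .
  qed
  define B where "B = enn2real (B_char D p q u lam \<nu>)"
  have B: "B_char D p q u lam \<nu> = ennreal B" "0 \<le> B"
    using Bfin by (simp_all add: B_def u_def)
  have hB: "rmass u Q powr (1 - 1 / p) * rmass lam Q powr (1 / q) * rmass \<nu> Q powr s \<le> B * (vol Q)\<^sup>2"
    if "Q \<in> cubes D" for Q
    unfolding s_def using B by (intro B_char_bound[OF pq fu fl(1) fl(3) _ _ that]) auto
  have "A_inf D u < \<infinity>"
    by (rule A_inf_finite_triple[OF mu(1) mlam(1) m\<nu>(1) mu(2) mlam(2) m\<nu>(2) fu fl(1) fl(3) e _ one hB])
       (simp_all add: s_def)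
  moreover have "A_inf D lam < \<infinity>"
  proof (rule A_inf_finite_triple[OF mlam(1) mu(1) m\<nu>(1) mlam(2) mu(2) m\<nu>(2) fl(1) fu fl(3) e(2,1,3)])
    show "lam x powr (1 / q) * u x powr (1 - 1 / p) * \<nu> x powr s = 1" for x
      using one[of x] by (simp only: mult_ac)
    show "rmass lam Q powr (1 / q) * rmass u Q powr (1 - 1 / p) * rmass \<nu> Q powr s \<le> B * (vol Q)\<^sup>2"
      if "Q \<in> cubes D" for Q
      using hB[OF that] by (simp only: mult_ac)
  qed (assumption | simp add: s_def)+
  moreover have "A_inf D \<nu> < \<infinity>"
  proof (rule A_inf_finite_triple[OF m\<nu>(1) mu(1) mlam(1) m\<nu>(2) mu(2) mlam(2) fl(3) fu fl(1) e(3,1,2)])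
    show "\<nu> x powr s * u x powr (1 - 1 / p) * lam x powr (1 / q) = 1" for x
      using one[of x] by (simp only: mult_ac)
    show "rmass \<nu> Q powr s * rmass u Q powr (1 - 1 / p) * rmass lam Q powr (1 / q) \<le> B * (vol Q)\<^sup>2"
      if "Q \<in> cubes D" for Q
      using hB[OF that] by (simp only: mult_ac)
  qed (assumption | simp add: s_def)+
  \<comment> \<open>With these three finite, the estimates can be carried out with real
    constants.\<close>
  ultimately obtain Au Av Az where A: "A_inf D u = ennreal Au" "0 \<le> Au" "A_inf D lam = ennreal Av" "0 \<le> Av"
      "A_inf D \<nu> = ennreal Az" "0 \<le> Az"
    using that[of "enn2real (A_inf D u)" "enn2real (A_inf D lam)" "enn2real (A_inf D \<nu>)"] by auto
  define \<Phi> where "\<Phi> = enn2real (\<integral>\<^sup>+x. ennreal (norm (f x) powr p * \<mu> x) \<partial>lebesgue)"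
  have f_meas: "f \<in> borel_measurable lebesgue" using f by (simp add: Lp_space_def)
  have Lpf: "Lp_norm p \<mu> f = (\<integral>\<^sup>+x. ennreal (norm (f x) powr p * \<mu> x) \<partial>lebesgue) ennpowr (1 / p)"
    unfolding Lp_norm_def using m\<mu>(2) by (intro nn_Lp_norm_real) (auto simp: less_imp_le)
  then have \<Phi>_fin: "(\<integral>\<^sup>+x. ennreal (norm (f x) powr p * \<mu> x) \<partial>lebesgue) < \<infinity>"
    using f by (simp add: Lp_space_def ennpowr_less_top_iff)
  then have \<Phi>: "(\<integral>\<^sup>+x. ennreal (norm (f x) powr p * \<mu> x) \<partial>lebesgue) = ennreal \<Phi>" "0 \<le> \<Phi>"
    by (simp_all add: \<Phi>_def)
  have \<Phi>u: "(\<integral>\<^sup>+x. ennreal ((norm (f x) / u x) powr p * u x) \<partial>lebesgue) \<le> ennreal \<Phi>"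
    unfolding u_def dual_weight_powr(2)[OF pq(1) m\<mu>(2)] \<Phi>(1) by simp
  have fi: "set_integrable lebesgue Q f" if "Q \<in> cubes D" for Q
    using fu[OF that] mu(1) unfolding u_def
    by (intro cube_integrable_Lp[OF pq(1) m\<mu>(2) f_meas \<Phi>_fin _ m\<mu>(1) that])
  have bi: "set_integrable lebesgue Q b" if "Q \<in> cubes D" for Q
    by (rule locally_integrable_cube[OF b that])
  define os where "os Q = (LINT x:Q|lebesgue. norm (b x - avg b Q))" for Q
  have os0: "0 \<le> os Q" for Q
    unfolding os_def set_lebesgue_integral_def by (intro Bochner_Integration.integral_nonneg) auto
  have rz: "0 < rmass \<nu> Q" if "Q \<in> cubes D" for Q
    using fl(3,4)[OF that] by (simp add: enn2real_positive_iff)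
  \<comment> \<open>If p = q, the hypothesis \<open>1 / r = 0\<close> forces \<open>r = 0\<close>,
    as division by zero gives 0; \<open>carleson_const r\<close> is meaningful when p > q, where r >
    1.\<close>
  define \<kappa> where "\<kappa> = (if p \<le> q then 1 else carleson_const r powr (1 / r))"
  \<comment> \<open>\<open>N\<close> is the factor depending on \<open>b\<close> in either case, and
    \<open>hN\<close> is the form of Hoelder's inequality that \<open>sparse_operator_bound\<close>
    expects.\<close>
  obtain N where N: "0 \<le> N" "(if p \<le> q then BMO_norm D \<alpha> \<nu> b
       else A_inf D \<nu> ennpowr (1 / r) * nn_Lp_norm r \<nu> (sharp_max D \<nu> b)) = ennreal N"
    and hN: "\<And>\<S> x y. sparse \<S> \<Longrightarrow> (\<And>S. S \<in> \<S> \<Longrightarrow> 0 \<le> x S) \<Longrightarrow> (\<And>S. S \<in> \<S> \<Longrightarrow> 0 \<le> y S) \<Longrightarrow>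
        (\<Sum>S\<in>\<S>. os S / rmass \<nu> S powr s * (x S powr (1 / p) * y S powr (1 - 1 / q)))
        \<le> (\<kappa> * N) * ((\<Sum>S\<in>\<S>. x S) powr (1 / p) * (\<Sum>S\<in>\<S>. y S) powr (1 - 1 / q))"
  proof (cases "p \<le> q")
    case True
    define N where "N = enn2real (BMO_norm D \<alpha> \<nu> b)"
    have N: "BMO_norm D \<alpha> \<nu> b = ennreal N" "0 \<le> N"
      using fin True by (simp_all add: N_def)
    have osN: "os S \<le> N * rmass \<nu> S powr s" if S: "S \<in> cubes D" for S
    proof -
      have "s = 1 + \<alpha> / real CARD('n)" using \<alpha> by (simp add: s_def)
      then have "oscillation b S / mass \<nu> S ennpowr s \<le> BMO_norm D \<alpha> \<nu> b"
        unfolding BMO_norm_def by (auto intro!: SUP_upper[OF S])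
      moreover have "oscillation b S = ennreal (os S)"
        unfolding os_def by (rule oscillation_eq[OF S bi[OF S]])
      moreover have "mass \<nu> S = ennreal (rmass \<nu> S)"
        using fl(3)[OF S] by simp
      ultimately have "ennreal (os S) / ennreal (rmass \<nu> S powr s) \<le> ennreal N"
        using N(1) by (metis ennpowr_ennreal enn2real_nonneg)
      then have "os S / rmass \<nu> S powr s \<le> N"
        using rz[OF S] os0[of S] N(2) by (simp add: divide_ennreal)
      then show ?thesis using rz[OF S] by (simp add: pos_divide_le_eq)
    qed
    show ?thesis
    proof (rule that[of N])
      fix \<S> x y assume S: "sparse \<S>"
        and nn: "\<And>S :: (real^'n) set. S \<in> \<S> \<Longrightarrow> (0::real) \<le> x S" "\<And>S. S \<in> \<S> \<Longrightarrow> (0::real) \<le> y S"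
      have c: "S \<in> cubes D" if "S \<in> \<S>" for S
        using S that unfolding sparse_def by (meson subsetD)
      have "(\<Sum>S\<in>\<S>. os S / rmass \<nu> S powr s * (x S powr (1 / p) * y S powr (1 - 1 / q)))
        \<le> N * ((\<Sum>S\<in>\<S>. x S) powr (1 / p) * (\<Sum>S\<in>\<S>. y S) powr (1 - 1 / q))"
        by (rule holder_BMO[OF pq True rz[OF c] osN[OF c] N(2) nn])
      then show "(\<Sum>S\<in>\<S>. os S / rmass \<nu> S powr s * (x S powr (1 / p) * y S powr (1 - 1 / q)))
        \<le> (\<kappa> * N) * ((\<Sum>S\<in>\<S>. x S) powr (1 / p) * (\<Sum>S\<in>\<S>. y S) powr (1 - 1 / q))"
        using True by (simp add: \<kappa>_def)
    qed (use N True in simp_all)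
  next
    case False
    then have qp: "q < p" by simp
    have r1: "1 < r" by (rule exponent_gt_1[OF pq qp r])
    let ?R = "\<integral>\<^sup>+x. (sharp_max D \<nu> b x) ennpowr r * ennreal (\<nu> x) \<partial>lebesgue"
    define R where "R = enn2real ?R"
    have "?R < \<infinity>"
      using fin False by (simp add: nn_Lp_norm_def ennpowr_less_top_iff)
    then have R: "?R = ennreal R" "0 \<le> R" by (simp_all add: R_def)
    have NR: "nn_Lp_norm r \<nu> (sharp_max D \<nu> b) = ennreal (R powr (1 / r))"
      unfolding nn_Lp_norm_def R(1) using R(2) by (rule ennpowr_ennreal)
    show ?thesis
    proof (rule that[of "Az powr (1 / r) * R powr (1 / r)"])
      show "(if p \<le> q then BMO_norm D \<alpha> \<nu> b
       else A_inf D \<nu> ennpowr (1 / r) * nn_Lp_norm r \<nu> (sharp_max D \<nu> b)) = ennreal (Az powr (1 / r) * R powr (1 / r))"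
        using False A(6) by (simp add: NR A(5) ennpowr_ennreal ennreal_mult)
      fix \<S> x y assume S: "sparse \<S>"
        and nn: "\<And>S :: (real^'n) set. S \<in> \<S> \<Longrightarrow> (0::real) \<le> x S" "\<And>S. S \<in> \<S> \<Longrightarrow> (0::real) \<le> y S"
      have "(\<Sum>S\<in>\<S>. os S / rmass \<nu> S powr s * (x S powr (1 / p) * y S powr (1 - 1 / q)))
        \<le> (carleson_const r * Az * R) powr (1 / r) * ((\<Sum>S\<in>\<S>. x S) powr (1 / p) * (\<Sum>S\<in>\<S>. y S) powr (1 - 1 / q))"
        unfolding os_def
        by (rule holder_sharp_max[OF pq qp r s_def S m\<nu> fl(3) bi _ A(6) _ R(2) nn]) (simp_all add: A R)
      also have "(carleson_const r * Az * R) powr (1 / r) = \<kappa> * (Az powr (1 / r) * R powr (1 / r))"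
        using False A(6) R(2) carleson_const_pos[OF r1] by (simp add: \<kappa>_def powr_mult)
      finally show "(\<Sum>S\<in>\<S>. os S / rmass \<nu> S powr s * (x S powr (1 / p) * y S powr (1 - 1 / q)))
        \<le> (\<kappa> * (Az powr (1 / r) * R powr (1 / r))) * ((\<Sum>S\<in>\<S>. x S) powr (1 / p) * (\<Sum>S\<in>\<S>. y S) powr (1 - 1 / q))" .
    qed simp
  qed
  have \<kappa>0: "0 \<le> \<kappa>" by (simp add: \<kappa>_def)
  define C1 :: real where "C1 = 512 * 2 ^ CARD('n)"
  define Z0 where "Z0 = B * (\<kappa> * N) * (carleson_const p * Au * \<Phi>) powr (1 / p)
        * (carleson_const (q / (q - 1)) * Av) powr (1 - 1 / q)"
  have C1: "0 \<le> C1" by (simp add: C1_def)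
  have Z0: "0 \<le> Z0" using B(2) \<kappa>0 N(1) by (simp add: Z0_def)
  have bound: "(\<integral>\<^sup>+x. ennreal (norm (\<Sum>Q\<in>Y. complex_of_real (\<theta> Q) * avg f Q * mart_diff D b Q x) powr q * lam x) \<partial>lebesgue)
      \<le> ennreal ((C1 * Z0) powr q)"
    if Y: "finite Y" "Y \<subseteq> cubes D" and \<theta>: "\<And>Q. \<bar>\<theta> Q\<bar> \<le> 1" for Y \<theta>
  proof -
    have c: "norm (complex_of_real (\<theta> Q) * avg f Q) \<le> ravg (\<lambda>x. norm (f x)) Q" if "Q \<in> Y" for Q
    proof -
      have Q: "Q \<in> cubes D" using Y(2) that by (rule subsetD)
      have "norm (complex_of_real (\<theta> Q) * avg f Q) \<le> 1 * norm (avg f Q)"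
        unfolding norm_mult using \<theta>[of Q] by (intro mult_right_mono) auto
      also have "\<dots> \<le> ravg (\<lambda>x. norm (f x)) Q"
        using norm_avg_diff_le[OF Q fi[OF Q], of 0] by simp
      finally show ?thesis .
    qed
    have "\<exists>\<S>. sparse \<S> \<and> (\<forall>x. norm (\<Sum>Q\<in>Y. complex_of_real (\<theta> Q) * avg f Q * mart_diff D b Q x)
           \<le> C1 * (\<Sum>S\<in>\<S>. os S / vol S * ravg (\<lambda>x. norm (f x)) S * indicator S x))"
      unfolding os_def C1_def by (rule sparse_domination[OF Y bi fi c])
    then obtain \<S> where S: "sparse \<S>" and dom: "\<forall>x. norm (\<Sum>Q\<in>Y. complex_of_real (\<theta> Q) * avg f Q * mart_diff D b Q x)
           \<le> C1 * (\<Sum>S\<in>\<S>. os S / vol S * ravg (\<lambda>x. norm (f x)) S * indicator S x)"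
      by (elim exE conjE) (rule that)
    let ?G = "\<lambda>x. \<Sum>S\<in>\<S>. os S / vol S * ravg (\<lambda>x. norm (f x)) S * indicator S x"
    have G0: "0 \<le> ?G x" for x
      by (intro sum_nonneg mult_nonneg_nonneg ravg_nonneg) (auto simp: os0)
    have "(\<integral>\<^sup>+x. ennreal (norm (\<Sum>Q\<in>Y. complex_of_real (\<theta> Q) * avg f Q * mart_diff D b Q x) powr q * lam x) \<partial>lebesgue)
        \<le> (\<integral>\<^sup>+x. ennreal (C1 powr q) * ennreal (?G x powr q * lam x) \<partial>lebesgue)"
    proof (rule nn_integral_mono)
      fix x
      have "norm (\<Sum>Q\<in>Y. complex_of_real (\<theta> Q) * avg f Q * mart_diff D b Q x) powr q * lam x
          \<le> (C1 * ?G x) powr q * lam x"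
        using dom[THEN spec, of x] pq(2) mlam(2)[of x] by (intro mult_right_mono powr_mono2) auto
      also have "\<dots> = C1 powr q * (?G x powr q * lam x)"
        using C1 G0[of x] by (simp only: powr_mult mult.assoc)
      finally have "ennreal (norm (\<Sum>Q\<in>Y. complex_of_real (\<theta> Q) * avg f Q * mart_diff D b Q x) powr q * lam x)
        \<le> ennreal (C1 powr q * (?G x powr q * lam x))" by (rule ennreal_leI)
      also have "\<dots> = ennreal (C1 powr q) * ennreal (?G x powr q * lam x)"
        by (rule ennreal_mult') simp
      finally show "ennreal (norm (\<Sum>Q\<in>Y. complex_of_real (\<theta> Q) * avg f Q * mart_diff D b Q x) powr q * lam x)
        \<le> ennreal (C1 powr q) * ennreal (?G x powr q * lam x)" .
    qed
    also have "\<dots> = ennreal (C1 powr q) * (\<integral>\<^sup>+x. ennreal (?G x powr q * lam x) \<partial>lebesgue)"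
    proof (rule nn_integral_cmult)
      have "?G \<in> borel_measurable lebesgue"
      proof (intro borel_measurable_sum borel_measurable_times borel_measurable_const borel_measurable_indicator)
        fix S assume "S \<in> \<S>"
        then have "S \<in> cubes D" using S unfolding sparse_def by (meson subsetD)
        then show "S \<in> sets lebesgue" by (rule sets_cube)
      qed
      then show "(\<lambda>x. ennreal (?G x powr q * lam x)) \<in> borel_measurable lebesgue"
        using mlam(1) by measurable
    qed
    also have "\<dots> \<le> ennreal (C1 powr q) * ennreal (Z0 powr q)"
      unfolding Z0_def
    proof (intro mult_left_mono sparse_operator_bound[OF pq S mu fu mlam fl(1) rz hB _ A(2) _ A(4) f_meas fi \<Phi>u \<Phi>(2) os0])
      show "(\<Sum>S\<in>\<S>. os S / rmass \<nu> S powr s * (x S powr (1 / p) * y S powr (1 - 1 / q)))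
        \<le> (\<kappa> * N) * ((\<Sum>S\<in>\<S>. x S) powr (1 / p) * (\<Sum>S\<in>\<S>. y S) powr (1 - 1 / q))"
        if "\<And>S. S \<in> \<S> \<Longrightarrow> 0 \<le> x S" "\<And>S. S \<in> \<S> \<Longrightarrow> 0 \<le> y S" for x y
        by (rule hN[OF S that])
    qed (use A \<kappa>0 N(1) in simp_all)
    also have "\<dots> = ennreal ((C1 * Z0) powr q)"
      using C1 Z0 by (simp only: powr_mult) (rule ennreal_mult'[symmetric], simp)
    finally show ?thesis .
  qed
  have "\<exists>g. is_paraproduct D q lam b f g \<and> Lp_norm q lam g \<le> ennreal (C1 * Z0)"
    by (rule Lp_has_sum_mart_diff[OF pq(2) mlam mult_nonneg_nonneg[OF C1 Z0] bound])
  then obtain g where g: "is_paraproduct D q lam b f g" "Lp_norm q lam g \<le> ennreal (C1 * Z0)"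
    by (elim exE conjE) (rule that)
  have "C1 * Z0 = (C1 * carleson_const p powr (1 / p) * carleson_const (q / (q - 1)) powr (1 - 1 / q) * \<kappa>)
      * B * Au powr (1 / p) * Av powr (1 - 1 / q) * N * \<Phi> powr (1 / p)"
  proof -
    have "1 < q / (q - 1)" using pq by (simp add: field_simps)
    then have "0 < carleson_const p" "0 < carleson_const (q / (q - 1))"
      using carleson_const_pos pq by auto
    then show ?thesis
      using A \<Phi>(2) by (simp add: Z0_def powr_mult mult_ac)
  qed
  then have "ennreal (C1 * Z0) = ennreal (C1 * carleson_const p powr (1 / p) * carleson_const (q / (q - 1)) powr (1 - 1 / q) * \<kappa>)
      * ennreal B * (ennreal Au) ennpowr (1 / p) * (ennreal Av) ennpowr (1 - 1 / q) * ennreal N * (ennreal \<Phi>) ennpowr (1 / p)"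
    using A B(2) N(1) \<Phi>(2) \<kappa>0 C1 by (simp only: ennpowr_ennreal) (simp flip: ennreal_mult)
  also have "\<dots> = ennreal (512 * 2 ^ CARD('n) * carleson_const p powr (1 / p) *
        carleson_const (q / (q - 1)) powr (1 - 1 / q) * (if p \<le> q then 1 else carleson_const r powr (1 / r))) *
      B_char D p q (dual_weight p \<mu>) lam \<nu> *
      A_inf D (dual_weight p \<mu>) ennpowr (1 / p) * A_inf D lam ennpowr (1 / conj_exp q) *
      (if p \<le> q then BMO_norm D \<alpha> \<nu> b
       else A_inf D \<nu> ennpowr (1 / r) * nn_Lp_norm r \<nu> (sharp_max D \<nu> b)) * Lp_norm p \<mu> f"
    unfolding N(2) Lpf \<Phi>(1) C1_def \<kappa>_def B(1)[unfolded u_def] A(1)[unfolded u_def] A(3) conj_exp_inverse[OF pq(2)] ..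
  finally show ?thesis using g by auto
qed

end

theorem theorem3p10:
  fixes p q r \<alpha> :: real
  assumes "1 < p" and "1 < q"
    and "1 / r = 1 / q - 1 / p"
    and "\<alpha> / real CARD('n) = 1 / p - 1 / q"
  shows "\<exists>C>0. \<forall>(\<mu> :: real^'n \<Rightarrow> real) (lam :: real^'n \<Rightarrow> real) (\<nu> :: real^'n \<Rightarrow> real)
      (D :: int \<Rightarrow> (real^'n) set set) (b :: real^'n \<Rightarrow> complex).
    weight \<mu> \<and> weight lam \<and> weight \<nu> \<and>
    (\<forall>x. \<nu> x powr (1 / p + 1 / conj_exp q) = \<mu> x powr (1 / p) * lam x powr (- (1 / q))) \<and>
    dyadic_lattice D \<and>
    B_char D p q (dual_weight p \<mu>) lam \<nu> < \<infinity> \<and>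
    locally_integrable b \<longrightarrow>
    (p \<le> q \<and> BMO_norm D \<alpha> \<nu> b < \<infinity> \<or> p > q \<and> nn_Lp_norm r \<nu> (sharp_max D \<nu> b) < \<infinity> \<longrightarrow>
      (\<forall>f\<in>Lp_space p \<mu>. \<exists>g. is_paraproduct D q lam b f g)) \<and>
    (let K = ennreal C * B_char D p q (dual_weight p \<mu>) lam \<nu> *
           A_inf D (dual_weight p \<mu>) ennpowr (1 / p) * A_inf D lam ennpowr (1 / conj_exp q) *
           (if p \<le> q then BMO_norm D \<alpha> \<nu> b
            else A_inf D \<nu> ennpowr (1 / r) * nn_Lp_norm r \<nu> (sharp_max D \<nu> b))
     in K < \<infinity> \<longrightarrow>
       (\<forall>f\<in>Lp_space p \<mu>. \<exists>g. is_paraproduct D q lam b f g \<and>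
          Lp_norm q lam g \<le> K * Lp_norm p \<mu> f))"
proof -
  define C where "C = 512 * 2 ^ CARD('n) * carleson_const p powr (1 / p) *
        carleson_const (q / (q - 1)) powr (1 - 1 / q) * (if p \<le> q then 1 else carleson_const r powr (1 / r))"
  have "1 < q / (q - 1)" using assms by (simp add: field_simps)
  then have "0 < carleson_const p" "0 < carleson_const (q / (q - 1))" "\<not> p \<le> q \<Longrightarrow> 0 < carleson_const r"
    using carleson_const_pos exponent_gt_1[OF assms(1,2) _ assms(3)] assms by auto
  then have C: "0 < C" by (auto simp: C_def)
  show ?thesis
  proof (intro exI[of _ C] conjI[OF C] allI impI)
    fix \<mu> lam \<nu> :: "real^'n \<Rightarrow> real" and D :: "int \<Rightarrow> (real^'n) set set" and b :: "real^'n \<Rightarrow> complex"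
    assume *: "weight \<mu> \<and> weight lam \<and> weight \<nu> \<and>
      (\<forall>x. \<nu> x powr (1 / p + 1 / conj_exp q) = \<mu> x powr (1 / p) * lam x powr (- (1 / q))) \<and>
      dyadic_lattice D \<and> B_char D p q (dual_weight p \<mu>) lam \<nu> < \<infinity> \<and> locally_integrable b"
    then interpret lattice D by unfold_locales simp
    let ?T = "if p \<le> q then BMO_norm D \<alpha> \<nu> b
            else A_inf D \<nu> ennpowr (1 / r) * nn_Lp_norm r \<nu> (sharp_max D \<nu> b)"
    let ?F = "if p \<le> q then BMO_norm D \<alpha> \<nu> b else nn_Lp_norm r \<nu> (sharp_max D \<nu> b)"
    let ?K0 = "ennreal C * B_char D p q (dual_weight p \<mu>) lam \<nu> *
           A_inf D (dual_weight p \<mu>) ennpowr (1 / p) * A_inf D lam ennpowr (1 / conj_exp q)"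
    have main: "\<exists>g. is_paraproduct D q lam b f g \<and> Lp_norm q lam g \<le> ?K0 * ?T * Lp_norm p \<mu> f"
      if "?F < \<infinity>" "f \<in> Lp_space p \<mu>" for f
      unfolding C_def by (rule paraproduct_bound[OF assms _ _ _ _ _ _ that]) (use * in auto)
    \<comment> \<open>A vanishing factor could hide an infinite norm of \<open>b\<close>, since 0 *
      \<infinity> = 0. One cube suffices to see that all the other factors are positive.\<close>
    have fin: "?F < \<infinity>" if K: "?K0 * ?T < \<infinity>"
    proof (rule ccontr)
      assume nf: "\<not> ?F < \<infinity>"
      obtain Q where Q: "Q \<in> D 0" using cube_at by blast
      then have Qc: "Q \<in> cubes D" by blast
      have l: "0 < mass lam Q" "mass lam Q < \<infinity>" "0 < mass \<nu> Q" "mass \<nu> Q < \<infinity>"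
        using * weight_mass[OF _ Qc] by auto
      have "weight \<mu>" using * by simp
      note m\<mu> = weightD[OF this]
      have u: "0 < mass (dual_weight p \<mu>) Q"
      proof (rule mass_cube_pos[OF _ _ Qc])
        note [measurable] = m\<mu>(1)
        show "dual_weight p \<mu> \<in> borel_measurable lebesgue" unfolding dual_weight_def by measurable
        show "0 < dual_weight p \<mu> x" for x using m\<mu>(2)[of x] by (simp add: dual_weight_def)
      qed
      have uf: "mass (dual_weight p \<mu>) Q < \<infinity>"
        by (rule B_char_mass_finite[where p=p and q=q, OF _ Qc l(1,3)]) (use * in simp)
      have "0 < ?K0"
        using C B_char_pos[OF Qc u l(1,3), of p q] ennpowr_pos[OF A_inf_pos[OF Qc u uf]]
          ennpowr_pos[OF A_inf_pos[OF Qc l(1,2)]]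
        by (simp add: ennreal_zero_less_mult_iff)
      moreover have "?T = \<infinity>"
        using nf ennpowr_pos[OF A_inf_pos[OF Qc l(3,4)], of "1 / r"]
        by (auto simp: not_less top_unique ennreal_mult_eq_top_iff less_le split: if_splits)
      ultimately have "?K0 * ?T = \<infinity>"
        by (simp only:) (auto simp: ennreal_mult_eq_top_iff)
      then show False using K by simp
    qed
    show "(p \<le> q \<and> BMO_norm D \<alpha> \<nu> b < \<infinity> \<or> p > q \<and> nn_Lp_norm r \<nu> (sharp_max D \<nu> b) < \<infinity> \<longrightarrow>
        (\<forall>f\<in>Lp_space p \<mu>. \<exists>g. is_paraproduct D q lam b f g)) \<and>
      (let K = ?K0 * ?T in K < \<infinity> \<longrightarrow>
        (\<forall>f\<in>Lp_space p \<mu>. \<exists>g. is_paraproduct D q lam b f g \<and> Lp_norm q lam g \<le> K * Lp_norm p \<mu> f))"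
      unfolding Let_def
    proof (intro conjI impI ballI)
      fix f assume c: "p \<le> q \<and> BMO_norm D \<alpha> \<nu> b < \<infinity> \<or> p > q \<and> nn_Lp_norm r \<nu> (sharp_max D \<nu> b) < \<infinity>"
        and f: "f \<in> Lp_space p \<mu>"
      have "?F < \<infinity>" using c by auto
      then show "\<exists>g. is_paraproduct D q lam b f g" using main[OF _ f] by blast
    next
      fix f assume "?K0 * ?T < \<infinity>" "f \<in> Lp_space p \<mu>"
      then show "\<exists>g. is_paraproduct D q lam b f g \<and> Lp_norm q lam g \<le> ?K0 * ?T * Lp_norm p \<mu> f"
        using main fin by blast
    qed
  qed
qed

end
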